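(* Let $p$ be a prime, let $k\geq 3$, let $0<\varepsilon<1$ and set $\delta=\varepsilon^{C_{p,k}}$. Let $n\geq1$ and $X_1,\dots,X_k\subseteq\mathbb{F}_p^n$ be such that there is a collection of at least $\varepsilon N$ pairwise disjoint $k$-cycles in $X_1\times\dots\times X_k$. Then the total number of $k$-cycles $(x_1,\dots,x_k)\in X_1\times\dots\times X_k$ is at least $\delta N^{k-1}$.
   Context: Let $p$ be a fixed prime, $n\geq 1$, and $N=p^n$. For sets $X_1,\dots,X_k\subseteq\mathbb{F}_p^n$, a $k$-cycle is a $k$-tuple $(x_1,\dots,x_k)\in X_1\times\dots\times X_k$ with $x_1+\dots+x_k=0$. Two $k$-cycles $(x_1,\dots,x_k)$ and $(x_1',\dots,x_k')$ are called disjoint if $x_i\neq x_i'$ for every $i=1,\dots,k$. Define $0<c_{p,3}<1$ by $\inf_{0<t<1}\frac{t^0+t^1+\dots+t^{p-1}}{t^{(p-1)/3}}=p^{1-c_{p,3}}$, set $C_{p,3}=1+\frac{1}{c_{p,3}}$, and for $k\geq 3$ set $C_{p,k}=(k-2)(C_{p,3}-1)+1$. *)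

theory Defs
  imports "HOL-Analysis.Analysis"
begin

text \<open>F_p^n is modelled as the vector type 'a^'n, where 'a is a finite field of
  prime cardinality p (hence isomorphic to F_p) and n = CARD('n) \<ge> 1.
  A k-tuple is a function on the index set {1..k} (extensional outside).\<close>

definition k_cycles :: "nat \<Rightarrow> (nat \<Rightarrow> 'v::comm_monoid_add set) \<Rightarrow> (nat \<Rightarrow> 'v) set" where
  "k_cycles k X = {x \<in> PiE {1..k} X. (\<Sum>i=1..k. x i) = 0}"

definition disjoint_cycles :: "nat \<Rightarrow> (nat \<Rightarrow> 'v) \<Rightarrow> (nat \<Rightarrow> 'v) \<Rightarrow> bool" where
  "disjoint_cycles k x y \<longleftrightarrow> (\<forall>i\<in>{1..k}. x i \<noteq> y i)"

definition pairwise_disjoint_cycles :: "nat \<Rightarrow> (nat \<Rightarrow> 'v) set \<Rightarrow> bool" where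
  "pairwise_disjoint_cycles k S \<longleftrightarrow>
     (\<forall>x\<in>S. \<forall>y\<in>S. x \<noteq> y \<longrightarrow> disjoint_cycles k x y)"

definition c_p3 :: "nat \<Rightarrow> real" where
  "c_p3 p = 1 - log (real p)
     (INF t\<in>{0<..<1::real}. (\<Sum>j<p. t ^ j) / t powr ((real p - 1) / 3))"

definition C_p3 :: "nat \<Rightarrow> real" where
  "C_p3 p = 1 + 1 / c_p3 p"

definition C_pk :: "nat \<Rightarrow> nat \<Rightarrow> real" where
  "C_pk p k = (real k - 2) * (C_p3 p - 1) + 1"

end

theory Submission
  imports Defs
begin

text \<open>Entropy replaces counting throughout. For non-negative weights $f_1, \dots, f_k$ consider the
  distribution $P(x) \propto \prod_j f_j(x_j)$ on the $k$-cycles; its entropy is at most the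
  logarithm of the number of $k$-cycles in the supports. A near-optimal choice of weights
  supported on a matching makes every marginal almost uniform, so that each has entropy at least
  about $\log(\varepsilon N)$, and it remains to bound the entropy of such distributions from below.

  For $k = 3$, take a large tensor power, rotating the three roles so that all three marginals have
  the same entropy, and pull the typical triangles back along a random affine map
  from $\mathbb{F}_p^d$, where $d$ is as large as possible subject to most typical triangles
  becoming isolated. The isolated ones form a tricoloured sum-free set, whose size is bounded
  by the slice rank method.

  For $k > 3$, replace two roles $i, j$ by a single one carrying $x_i + x_j$. Given $x_i + x_j$, the
  remaining entries are independent of $(x_i, x_j)$, so the entropy splits into that of a product-form
  triangle distribution and that of a product-form $(k-1)$-cycle distribution. By submodularity
  the pair $i, j$ can be chosen such that the entropy of $x_i + x_j$ is not below the least entropy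
  of a marginal, so no density is lost.\<close>

subsection \<open>Tricoloured sum-free sets\<close>

text \<open>Why product form is the right generality: slice rank needs a family in which every mixed
  triple with sum zero is diagonal, so a pulled-back triangle must be isolated among all triangles
  on typical entries, not only among typical triangles. With weights that are products over the
  entries, entrywise typicality already bounds the probability of such a triangle below by about
  exp(-H). Comparison with the mass of an entry leaves at most about exp(H - H_j) triangles through
  it, H_j being the entropy of that role. Fitting F_p^d into this room gives c (2L - H) \<le> (1 +
  c)(L - average H_j), where L = ln N and c = \<open>c_p3 p\<close>; constants and typicality errors
  vanish on division by the length of the tensor power.

  Origin of the exponent: if every marginal has entropy at least L - \<beta>, with \<beta> about
  ln(1/\<epsilon>), a triangle loses (1 + 1/c) \<beta>. In a merge the entropy of x_i + x_j occurs
  in both parts and is subtracted once, so a merge adds only \<beta>/c; this bookkeeping uses c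
  \<le> 1/2. After k - 3 merges the loss is ((k - 2)/c + 1) \<beta>, that is,
  \<open>C_pk p k\<close> times \<beta>.\<close>

lemma finite_field_fermat:
  fixes x :: "'a::{field,finite}"
  assumes "x \<noteq> 0"
  shows "x ^ (CARD('a) - 1) = 1"
proof -
  let ?U = "UNIV - {0::'a}"
  have "bij_betw ((*) x) ?U ?U"
    using assms by (intro bij_betwI[where g = "\<lambda>y. y / x"]) auto
  then have "(\<Prod>y\<in>?U. x * y) = \<Prod>?U"
    using prod.reindex_bij_betw[of "(*) x" ?U ?U "\<lambda>y. y"] by simp
  moreover have "(\<Prod>y\<in>?U. x * y) = x ^ card ?U * \<Prod>?U"
    by (simp add: prod.distrib)
  moreover have "\<Prod>?U \<noteq> 0" by simp
  moreover have "card ?U = CARD('a) - 1" by simp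
  ultimately show ?thesis by simp
qed

lemma one_minus_power_card:
  fixes x :: "'a::{field,finite}"
  shows "1 - x ^ (CARD('a) - 1) = (if x = 0 then 1 else 0)"
proof -
  have "card {0, 1::'a} \<le> CARD('a)" by (intro card_mono) auto
  then have "CARD('a) - 1 > 0" by simp
  then show ?thesis using finite_field_fermat[of x] by (auto simp: power_0_left)
qed

text \<open>Pigeonhole instead of dimension theory: over a finite field the assignments on
  \<open>U\<close> outnumber the value vectors on \<open>E\<close>, so two of them collide, and
  their difference is the solution.\<close>

lemma nonzero_solution:
  fixes A :: "'e \<Rightarrow> 'u \<Rightarrow> 'a::{field,finite}"
  assumes "finite U" "finite E" "card E < card U"
  obtains x where "\<exists>u\<in>U. x u \<noteq> 0" "\<And>u. u \<notin> U \<Longrightarrow> x u = 0"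
    "\<And>e. e \<in> E \<Longrightarrow> (\<Sum>u\<in>U. A e u * x u) = 0"
proof -
  define T where "T x = (\<lambda>e\<in>E. \<Sum>u\<in>U. A e u * x u)" for x
  have one: "1 < CARD('a)"
  proof -
    have "card {0, 1::'a} \<le> CARD('a)" by (intro card_mono) auto
    then show ?thesis by simp
  qed
  have "card (PiE E (\<lambda>_. UNIV :: 'a set)) < card (PiE U (\<lambda>_. UNIV :: 'a set))"
    using assms one by (simp add: card_PiE)
  moreover have "T ` PiE U (\<lambda>_. UNIV) \<subseteq> PiE E (\<lambda>_. UNIV)" by (auto simp: T_def)
  moreover have "finite (PiE E (\<lambda>_. UNIV :: 'a set))" using assms by (intro finite_PiE) auto
  ultimately have "\<not> inj_on T (PiE U (\<lambda>_. UNIV))"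
    by (metis card_inj_on_le not_le)
  then obtain x y where xy: "x \<in> PiE U (\<lambda>_. UNIV)" "y \<in> PiE U (\<lambda>_. UNIV)" "x \<noteq> y" "T x = T y"
    by (auto simp: inj_on_def)
  show ?thesis
  proof (rule that[of "\<lambda>u. if u \<in> U then x u - y u else 0"])
    show "\<exists>u\<in>U. (if u \<in> U then x u - y u else 0) \<noteq> 0"
      using xy by (metis PiE_ext right_minus_eq)
    fix e assume "e \<in> E"
    then have "(\<Sum>u\<in>U. A e u * x u) = (\<Sum>u\<in>U. A e u * y u)"
      using fun_cong[OF xy(4), of e] by (simp add: T_def)
    then show "(\<Sum>u\<in>U. A e u * (if u \<in> U then x u - y u else 0)) = 0"
      by (simp add: algebra_simps sum_subtractf)
  qed auto
qed

text \<open>Slice rank of a diagonal tensor. Contracting the first index with a vector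
  \<open>w\<close> orthogonal to all \<open>a r\<close> kills the first group of slices and leaves a
  diagonal matrix with entries \<open>w j\<close>, written with 2 * \<open>card R\<close> rank-one
  terms. Its rank is the size of the support of \<open>w\<close>, and a \<open>w\<close> of maximal
  support misses at most \<open>card R\<close> indices.\<close>

lemma diagonal_slice_rank:
  fixes a b c :: "'r \<Rightarrow> 's \<Rightarrow> 'a::{field,finite}"
  assumes J: "finite J" and R: "finite R"
    and eq: "\<And>i j k. i \<in> J \<Longrightarrow> j \<in> J \<Longrightarrow> k \<in> J \<Longrightarrow>
      (if i = j \<and> j = k then 1 else 0) =
      (\<Sum>r\<in>R. a r i * A r j k) + (\<Sum>r\<in>R. b r j * B r i k) + (\<Sum>r\<in>R. c r k * C r i j)"
  shows "card J \<le> 3 * card R"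
proof (rule ccontr)
  assume neg: "\<not> card J \<le> 3 * card R"
  define W where "W = {w. (\<forall>i. i \<notin> J \<longrightarrow> w i = 0) \<and> (\<forall>r\<in>R. (\<Sum>i\<in>J. a r i * w i) = 0)}"
  define supp where "supp w = {i\<in>J. w i \<noteq> (0::'a)}" for w
  have suppfin: "finite (supp w)" for w using J by (simp add: supp_def)
  have "(\<lambda>_. 0) \<in> W" by (simp add: W_def)
  moreover have "\<forall>w. w \<in> W \<longrightarrow> card (supp w) < card J + 1"
    using J by (auto simp: supp_def less_Suc_eq_le intro!: card_mono)
  ultimately obtain w where w: "w \<in> W" and wmax: "\<And>v. v \<in> W \<Longrightarrow> card (supp v) \<le> card (supp w)"
    using ex_has_greatest_nat[of "\<lambda>w. w \<in> W" "\<lambda>_. 0" "\<lambda>w. card (supp w)" "card J + 1"] by blast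
  define S where "S = supp w"
  have SJ: "S \<subseteq> J" and Sfin: "finite S" using suppfin by (auto simp: S_def supp_def)
  have big: "card J \<le> card R + card S"
  proof (rule ccontr)
    assume "\<not> ?thesis"
    \<comment> \<open>With more free positions off \<open>S\<close> than constraints, some nonzero
      \<open>v\<close> in \<open>W\<close> lives off \<open>S\<close>, and \<open>w + v\<close> has
      a larger support than the maximal one.\<close>
    then have "card R < card (J - S)" using SJ J by (simp add: card_Diff_subset finite_subset)
    then obtain v where v: "\<exists>i\<in>J - S. v i \<noteq> 0" "\<And>i. i \<notin> J - S \<Longrightarrow> v i = 0"
      "\<And>r. r \<in> R \<Longrightarrow> (\<Sum>i\<in>J - S. a r i * v i) = 0"
      using nonzero_solution[of "J - S" R a] J R by auto
    have "(\<Sum>i\<in>J. a r i * v i) = 0" if "r \<in> R" for r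
    proof -
      have "(\<Sum>i\<in>J. a r i * v i) = (\<Sum>i\<in>J - S. a r i * v i)"
        using J v(2) by (intro sum.mono_neutral_right) auto
      with v(3)[OF that] show ?thesis by simp
    qed
    then have "(\<lambda>i. w i + v i) \<in> W" using w v(2) by (auto simp: W_def ring_distribs sum.distrib)
    moreover have "S \<subset> supp (\<lambda>i. w i + v i)"
      using v(1,2) SJ by (auto simp: S_def supp_def)
    ultimately show False
      using wmax suppfin psubset_card_mono[of "supp (\<lambda>i. w i + v i)" S] S_def by force
  qed
  \<comment> \<open>Left summand: the second group of slices, contracted with \<open>w\<close>;
    right summand: the functions \<open>c r\<close>. A \<open>v\<close> killed by both sends the
    right-hand side of \<open>eq\<close> to 0, but the diagonal side to
    \<open>w j * v j\<close>.\<close>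
  define R2 where "R2 = R <+> R"
  have "card R2 = 2 * card R" using R by (simp add: R2_def card_Plus)
  then have "card R2 < card S" using big neg by simp
  moreover have "finite R2" using R by (simp add: R2_def)
  ultimately obtain v where v: "\<exists>k\<in>S. v k \<noteq> 0" "\<And>k. k \<notin> S \<Longrightarrow> v k = 0"
    and v3: "\<And>e. e \<in> R2 \<Longrightarrow> (\<Sum>k\<in>S. (case e of Inl r \<Rightarrow> (\<Sum>i\<in>J. w i * B r i k) | Inr r \<Rightarrow> c r k) * v k) = 0"
    using nonzero_solution[of S R2 "\<lambda>e k. case e of Inl r \<Rightarrow> (\<Sum>i\<in>J. w i * B r i k) | Inr r \<Rightarrow> c r k"] Sfin by blast
  have vB: "(\<Sum>k\<in>S. (\<Sum>i\<in>J. w i * B r i k) * v k) = 0" and vc: "(\<Sum>k\<in>S. c r k * v k) = 0" if "r \<in> R" for r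
    using v3[of "Inl r"] v3[of "Inr r"] that by (auto simp: R2_def)
  obtain j where j: "j \<in> S" "v j \<noteq> 0" using v(1) by blast
  then have jJ: "j \<in> J" using SJ by auto
  have "(\<Sum>k\<in>S. \<Sum>i\<in>J. w i * v k * (if i = j \<and> j = k then 1 else 0)) = (\<Sum>k\<in>S. \<Sum>i\<in>J. if i = j then (if k = j then w j * v j else 0) else 0)"
    by (intro sum.cong refl) auto
  also have "\<dots> = w j * v j"
    using j jJ Sfin J by (simp add: sum.delta)
  finally have 1: "(\<Sum>k\<in>S. \<Sum>i\<in>J. w i * v k * (if i = j \<and> j = k then 1 else 0)) = w j * v j" .
  have "(\<Sum>k\<in>S. \<Sum>i\<in>J. w i * v k * (if i = j \<and> j = k then 1 else 0))
    = (\<Sum>k\<in>S. \<Sum>i\<in>J. w i * v k * ((\<Sum>r\<in>R. a r i * A r j k) + (\<Sum>r\<in>R. b r j * B r i k) + (\<Sum>r\<in>R. c r k * C r i j)))"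
    using SJ jJ by (intro sum.cong refl arg_cong2[where f = "(*)"] eq) auto
  also have "\<dots> = (\<Sum>k\<in>S. \<Sum>i\<in>J. \<Sum>r\<in>R. w i * v k * (a r i * A r j k))
     + (\<Sum>k\<in>S. \<Sum>i\<in>J. \<Sum>r\<in>R. w i * v k * (b r j * B r i k))
     + (\<Sum>k\<in>S. \<Sum>i\<in>J. \<Sum>r\<in>R. w i * v k * (c r k * C r i j))"
    by (simp add: distrib_left sum.distrib sum_distrib_left)
  also have "(\<Sum>k\<in>S. \<Sum>i\<in>J. \<Sum>r\<in>R. w i * v k * (a r i * A r j k))
     = (\<Sum>k\<in>S. \<Sum>r\<in>R. v k * A r j k * (\<Sum>i\<in>J. a r i * w i))"
    by (subst sum.swap[of _ R]) (simp add: sum_distrib_left mult_ac)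
  also have "\<dots> = 0" using w by (simp add: W_def)
  also have "(\<Sum>k\<in>S. \<Sum>i\<in>J. \<Sum>r\<in>R. w i * v k * (b r j * B r i k))
     = (\<Sum>r\<in>R. \<Sum>k\<in>S. \<Sum>i\<in>J. w i * v k * (b r j * B r i k))"
    by (subst sum.swap[of _ R J], subst sum.swap[of _ R S]) simp
  also have "\<dots> = (\<Sum>r\<in>R. b r j * (\<Sum>k\<in>S. (\<Sum>i\<in>J. w i * B r i k) * v k))"
    by (simp add: sum_distrib_left sum_distrib_right mult_ac)
  also have "\<dots> = 0" using vB by simp
  also have "(\<Sum>k\<in>S. \<Sum>i\<in>J. \<Sum>r\<in>R. w i * v k * (c r k * C r i j))
     = (\<Sum>r\<in>R. \<Sum>i\<in>J. \<Sum>k\<in>S. w i * v k * (c r k * C r i j))"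
    by (subst sum.swap[of _ R J], subst sum.swap[of _ R S], subst sum.swap[of _ J S]) simp
  also have "\<dots> = (\<Sum>r\<in>R. \<Sum>i\<in>J. w i * C r i j * (\<Sum>k\<in>S. c r k * v k))"
    by (simp add: sum_distrib_left mult_ac)
  also have "\<dots> = 0" using vc by simp
  finally have "w j * v j = 0" using 1 by simp
  then show False using j by (auto simp: S_def supp_def)
qed

section \<open>The polynomial method for sum-free sets\<close>

text \<open>Exponent vectors of the monomials in \<open>d\<close> variables that have degree below
  \<open>q\<close> in each variable and total degree at most a third of the maximum (q - 1) d. The
  factor 3 avoids a division of naturals.\<close>

definition low_exponents :: "nat \<Rightarrow> nat \<Rightarrow> (nat \<Rightarrow> nat) set" where
  "low_exponents q d = {\<alpha> \<in> PiE {..<d} (\<lambda>_. {..<q}). 3 * (\<Sum>l<d. \<alpha> l) \<le> (q - 1) * d}"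

lemma finite_low_exponents [simp]: "finite (low_exponents q d)"
  unfolding low_exponents_def by (rule finite_subset[OF _ finite_PiE[of "{..<d}" "\<lambda>_. {..<q}"]]) auto

definition exponent_triples :: "nat \<Rightarrow> (nat \<times> nat \<times> nat) set" where
  "exponent_triples n = {e. fst e + fst (snd e) + snd (snd e) \<le> n}"

lemma finite_exponent_triples [simp]: "finite (exponent_triples n)"
proof (rule finite_subset)
  show "exponent_triples n \<subseteq> {..n} \<times> {..n} \<times> {..n}" by (auto simp: exponent_triples_def)
qed auto

text \<open>What matters is that the coefficients do not depend on the point and that the degree
  stays at most \<open>n\<close>: products of such expansions become combinations of products of one
  monomial per colour.\<close>

lemma one_minus_power_expansion:
  obtains \<kappa> :: "nat \<times> nat \<times> nat \<Rightarrow> 'a::comm_ring_1" where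
    "\<And>x y z. 1 - (x + y + z) ^ n =
      (\<Sum>e\<in>exponent_triples n. \<kappa> e * x ^ fst e * y ^ fst (snd e) * z ^ snd (snd e))"
proof -
  define \<kappa> :: "nat \<times> nat \<times> nat \<Rightarrow> 'a" where
    "\<kappa> = (\<lambda>(a, b, c). (if a + b + c = 0 then 1 else 0) -
       (if a + b + c = n then of_nat (n choose a) * of_nat ((n - a) choose b) else 0))"
  have "1 - (x + y + z) ^ n =
      (\<Sum>e\<in>exponent_triples n. \<kappa> e * x ^ fst e * y ^ fst (snd e) * z ^ snd (snd e))" for x y z :: 'a
  proof -
    let ?m = "\<lambda>e. x ^ fst e * y ^ fst (snd e) * z ^ snd (snd e)"
    have "(\<Sum>e\<in>exponent_triples n. \<kappa> e * x ^ fst e * y ^ fst (snd e) * z ^ snd (snd e)) =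
       (\<Sum>e\<in>exponent_triples n. (if e = (0,0,0) then 1 else 0) * ?m e) -
       (\<Sum>e\<in>exponent_triples n. (if fst e + fst (snd e) + snd (snd e) = n then
          of_nat (n choose fst e) * of_nat ((n - fst e) choose fst (snd e)) * ?m e else 0))"
      by (simp add: sum_subtractf [symmetric], intro sum.cong refl) (auto simp: \<kappa>_def algebra_simps split: prod.splits)
    also have "(\<Sum>e\<in>exponent_triples n. (if e = (0,0,0) then 1 else 0) * ?m e) =
       (\<Sum>e\<in>exponent_triples n. if e = (0,0,0) then 1 else 0)"
      by (intro sum.cong refl) auto
    also have "\<dots> = 1" by (subst sum.delta[OF finite_exponent_triples]) (simp add: exponent_triples_def)
    also have "(\<Sum>e\<in>exponent_triples n. (if fst e + fst (snd e) + snd (snd e) = n then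
          of_nat (n choose fst e) * of_nat ((n - fst e) choose fst (snd e)) * ?m e else 0)) =
       (\<Sum>e\<in>{e\<in>exponent_triples n. fst e + fst (snd e) + snd (snd e) = n}.
          of_nat (n choose fst e) * of_nat ((n - fst e) choose fst (snd e)) * ?m e)"
      by (rule sum.inter_filter[OF finite_exponent_triples, symmetric])
    also have "\<dots> = (\<Sum>(a, b)\<in>Sigma {..n} (\<lambda>a. {..n - a}).
          of_nat (n choose a) * of_nat ((n - a) choose b) * (x ^ a * y ^ b * z ^ (n - a - b)))"
      by (rule sum.reindex_bij_witness[where i = "\<lambda>(a, b). (a, b, n - a - b)" and j = "\<lambda>(a, b, c). (a, b)"])
         (auto simp: exponent_triples_def)
    also have "\<dots> = (\<Sum>a\<le>n. \<Sum>b\<le>n - a.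
          of_nat (n choose a) * of_nat ((n - a) choose b) * (x ^ a * y ^ b * z ^ (n - a - b)))"
      by (subst sum.Sigma) auto
    also have "\<dots> = (\<Sum>a\<le>n. of_nat (n choose a) * x ^ a * (y + z) ^ (n - a))"
      by (simp add: binomial_ring sum_distrib_left mult_ac)
    also have "\<dots> = (x + (y + z)) ^ n" by (simp add: binomial_ring)
    finally show ?thesis by (simp add: add.assoc)
  qed
  then show ?thesis by (rule that)
qed

lemma sum_group_through:
  fixes g :: "'b \<Rightarrow> 'c::comm_ring"
  assumes "finite S" "finite R" "\<phi> ` S \<subseteq> R"
  shows "(\<Sum>e\<in>S. g (\<phi> e) * h e) = (\<Sum>r\<in>R. g r * (\<Sum>e\<in>{e\<in>S. \<phi> e = r}. h e))"
proof -
  have "(\<Sum>e\<in>S. g (\<phi> e) * h e) = (\<Sum>r\<in>R. \<Sum>e\<in>{e\<in>S. \<phi> e = r}. g (\<phi> e) * h e)"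
    using sum.group[OF assms, of "\<lambda>e. g (\<phi> e) * h e"] by simp
  also have "\<dots> = (\<Sum>r\<in>R. g r * (\<Sum>e\<in>{e\<in>S. \<phi> e = r}. h e))"
    unfolding sum_distrib_left by (intro sum.cong refl) auto
  finally show ?thesis .
qed

text \<open>By Fermat, the indicator of sum zero is the product over \<open>l\<close> of 1 - (x + y
  + z)^(q - 1), of total degree at most (q - 1) d. In each monomial some colour contributes at most
  a third of that degree, and its part serves as the one-index factor of a slice. So each colour
  needs only as many slices as there are low exponent vectors.\<close>

theorem tricoloured_sum_free_bound:
  fixes x y z :: "'s \<Rightarrow> nat \<Rightarrow> 'a::{field,finite}"
  assumes J: "finite J"
    and sf: "\<And>i j k. i \<in> J \<Longrightarrow> j \<in> J \<Longrightarrow> k \<in> J \<Longrightarrow>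
      (\<forall>l<d. x i l + y j l + z k l = 0) \<longleftrightarrow> i = j \<and> j = k"
  shows "card J \<le> 3 * card (low_exponents CARD('a) d)"
proof -
  define n where "n = CARD('a) - 1"
  let ?R = "low_exponents CARD('a) d"
  let ?T = "exponent_triples n"
  obtain \<kappa> :: "nat \<times> nat \<times> nat \<Rightarrow> 'a" where \<kappa>: "\<And>x y z. 1 - (x + y + z) ^ n =
      (\<Sum>e\<in>?T. \<kappa> e * x ^ fst e * y ^ fst (snd e) * z ^ snd (snd e))"
    using one_minus_power_expansion[where 'a = 'a] by blast
  have npos: "n < CARD('a)" by (simp add: n_def)
  define F where "F = PiE {..<d} (\<lambda>_. ?T)"
  have finF: "finite F" by (simp add: F_def finite_PiE)
  define pa where "pa f = (\<lambda>l\<in>{..<d}. fst (f l))" for f :: "nat \<Rightarrow> nat \<times> nat \<times> nat"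
  define pb where "pb f = (\<lambda>l\<in>{..<d}. fst (snd (f l)))" for f :: "nat \<Rightarrow> nat \<times> nat \<times> nat"
  define pc where "pc f = (\<lambda>l\<in>{..<d}. snd (snd (f l)))" for f :: "nat \<Rightarrow> nat \<times> nat \<times> nat"
  define mon where "mon v \<alpha> = (\<Prod>l<d. v l ^ \<alpha> l)" for v :: "nat \<Rightarrow> 'a" and \<alpha> :: "nat \<Rightarrow> nat"
  define K where "K f = (\<Prod>l<d. \<kappa> (f l))" for f
  \<comment> \<open>Each monomial goes to the first colour whose part has low degree, so the three
    groups of slices do not overlap.\<close>
  define FA where "FA = {f\<in>F. pa f \<in> ?R}"
  define FB where "FB = {f\<in>F. pa f \<notin> ?R \<and> pb f \<in> ?R}"
  define FC where "FC = {f\<in>F. pa f \<notin> ?R \<and> pb f \<notin> ?R}"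
  have FC: "pc f \<in> ?R" if "f \<in> FC" for f
  proof -
    have f: "f l \<in> ?T" if "l < d" for l using \<open>f \<in> FC\<close> that by (auto simp: FC_def F_def)
    then have le: "fst (f l) + fst (snd (f l)) + snd (snd (f l)) \<le> n" if "l < d" for l
      using that by (simp add: exponent_triples_def)
    have "fst (f l) < CARD('a)" "fst (snd (f l)) < CARD('a)" "snd (snd (f l)) < CARD('a)" if "l < d" for l
      using le[OF that] npos by linarith+
    then have P: "pa f \<in> PiE {..<d} (\<lambda>_. {..<CARD('a)})" "pb f \<in> PiE {..<d} (\<lambda>_. {..<CARD('a)})"
      "pc f \<in> PiE {..<d} (\<lambda>_. {..<CARD('a)})"
      by (auto simp: pa_def pb_def pc_def)
    have "(\<Sum>l<d. fst (f l) + fst (snd (f l)) + snd (snd (f l))) \<le> (\<Sum>l<d. n)"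
      using le by (intro sum_mono) auto
    then have "(\<Sum>l<d. pa f l) + (\<Sum>l<d. pb f l) + (\<Sum>l<d. pc f l) \<le> n * d"
      by (simp add: pa_def pb_def pc_def sum.distrib mult.commute)
    moreover have "3 * (\<Sum>l<d. pa f l) > n * d" "3 * (\<Sum>l<d. pb f l) > n * d"
      using that P by (auto simp: FC_def low_exponents_def n_def)
    ultimately have "3 * (\<Sum>l<d. pc f l) \<le> n * d" by linarith
    then show ?thesis using P by (simp add: low_exponents_def n_def)
  qed
  have split: "F = FA \<union> (FB \<union> FC)" "FA \<inter> (FB \<union> FC) = {}" "FB \<inter> FC = {}"
    by (auto simp: FA_def FB_def FC_def)
  have fins: "finite FA" "finite FB" "finite FC" using finF by (auto simp: FA_def FB_def FC_def)
  have "(if i = j \<and> j = k then 1 else 0) =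
      (\<Sum>r\<in>?R. mon (x i) r * (\<Sum>f\<in>{f\<in>FA. pa f = r}. K f * mon (y j) (pb f) * mon (z k) (pc f)))
    + (\<Sum>r\<in>?R. mon (y j) r * (\<Sum>f\<in>{f\<in>FB. pb f = r}. K f * mon (x i) (pa f) * mon (z k) (pc f)))
    + (\<Sum>r\<in>?R. mon (z k) r * (\<Sum>f\<in>{f\<in>FC. pc f = r}. K f * mon (x i) (pa f) * mon (y j) (pb f)))"
    if "i \<in> J" "j \<in> J" "k \<in> J" for i j k
  proof -
    let ?t = "\<lambda>f. K f * mon (x i) (pa f) * mon (y j) (pb f) * mon (z k) (pc f)"
    have "(if i = j \<and> j = k then 1 else 0) = (\<Prod>l<d. if x i l + y j l + z k l = 0 then 1 else (0::'a))"
      using sf[OF that] by (auto intro!: prod.neutral simp del: split_paired_All)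
    also have "\<dots> = (\<Prod>l<d. 1 - (x i l + y j l + z k l) ^ n)"
      unfolding n_def one_minus_power_card ..
    also have "\<dots> = (\<Prod>l<d. \<Sum>e\<in>?T. \<kappa> e * x i l ^ fst e * y j l ^ fst (snd e) * z k l ^ snd (snd e))"
      unfolding \<kappa> ..
    also have "\<dots> = (\<Sum>f\<in>F. \<Prod>l<d. \<kappa> (f l) * x i l ^ fst (f l) * y j l ^ fst (snd (f l)) * z k l ^ snd (snd (f l)))"
      unfolding F_def by (intro prod_sum_PiE) auto
    also have "\<dots> = (\<Sum>f\<in>F. ?t f)"
      by (intro sum.cong refl) (simp add: K_def mon_def pa_def pb_def pc_def prod.distrib)
    also have "\<dots> = (\<Sum>f\<in>FA. ?t f) + ((\<Sum>f\<in>FB. ?t f) + (\<Sum>f\<in>FC. ?t f))"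
      using split fins by (simp add: sum.union_disjoint)
    also have "(\<Sum>f\<in>FA. ?t f) = (\<Sum>f\<in>FA. mon (x i) (pa f) * (K f * mon (y j) (pb f) * mon (z k) (pc f)))"
      by (simp add: mult_ac)
    also have "\<dots> = (\<Sum>r\<in>?R. mon (x i) r * (\<Sum>f\<in>{f\<in>FA. pa f = r}. K f * mon (y j) (pb f) * mon (z k) (pc f)))"
      using fins by (intro sum_group_through) (auto simp: FA_def)
    also have "(\<Sum>f\<in>FB. ?t f) = (\<Sum>f\<in>FB. mon (y j) (pb f) * (K f * mon (x i) (pa f) * mon (z k) (pc f)))"
      by (simp add: mult_ac)
    also have "\<dots> = (\<Sum>r\<in>?R. mon (y j) r * (\<Sum>f\<in>{f\<in>FB. pb f = r}. K f * mon (x i) (pa f) * mon (z k) (pc f)))"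
      using fins by (intro sum_group_through) (auto simp: FB_def)
    also have "(\<Sum>f\<in>FC. ?t f) = (\<Sum>f\<in>FC. mon (z k) (pc f) * (K f * mon (x i) (pa f) * mon (y j) (pb f)))"
      by (simp add: mult_ac)
    also have "\<dots> = (\<Sum>r\<in>?R. mon (z k) r * (\<Sum>f\<in>{f\<in>FC. pc f = r}. K f * mon (x i) (pa f) * mon (y j) (pb f)))"
      using fins FC by (intro sum_group_through) auto
    finally show ?thesis by (simp add: add.assoc)
  qed
  then show ?thesis
    by (rule diagonal_slice_rank[OF J finite_low_exponents, where
        a = "\<lambda>r i. mon (x i) r" and b = "\<lambda>r j. mon (y j) r" and c = "\<lambda>r k. mon (z k) r"
        and A = "\<lambda>r j k. \<Sum>f\<in>{f\<in>FA. pa f = r}. K f * mon (y j) (pb f) * mon (z k) (pc f)"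
        and B = "\<lambda>r i k. \<Sum>f\<in>{f\<in>FB. pb f = r}. K f * mon (x i) (pa f) * mon (z k) (pc f)"
        and C = "\<lambda>r i j. \<Sum>f\<in>{f\<in>FC. pc f = r}. K f * mon (x i) (pa f) * mon (y j) (pb f)"])
qed

text \<open>Chernoff's trick: as t < 1, every low exponent vector has t^degree at least t^((q - 1) d
  / 3), and the sum of t^degree over all exponent vectors with entries below \<open>q\<close>
  factorises over the variables.\<close>

lemma card_low_exponents_le:
  fixes t :: real
  assumes t: "0 < t" "t < 1" and q: "q \<ge> 1"
  shows "real (card (low_exponents q d)) \<le> ((\<Sum>j<q. t ^ j) / t powr ((real q - 1) / 3)) ^ d"
proof -
  define D where "D = (real q - 1) / 3 * real d"
  have "real (card (low_exponents q d)) * t powr D = (\<Sum>\<alpha>\<in>low_exponents q d. t powr D)" by simp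
  also have "\<dots> \<le> (\<Sum>\<alpha>\<in>low_exponents q d. \<Prod>l<d. t ^ \<alpha> l)"
  proof (rule sum_mono)
    fix \<alpha> assume "\<alpha> \<in> low_exponents q d"
    then have "3 * (\<Sum>l<d. \<alpha> l) \<le> (q - 1) * d" by (simp add: low_exponents_def)
    then have "real (3 * (\<Sum>l<d. \<alpha> l)) \<le> real ((q - 1) * d)" by (rule of_nat_mono)
    then have "real (\<Sum>l<d. \<alpha> l) \<le> D" using q by (simp add: D_def of_nat_diff)
    then have "t powr D \<le> t powr real (\<Sum>l<d. \<alpha> l)" using t by (intro powr_mono') auto
    also have "\<dots> = (\<Prod>l<d. t ^ \<alpha> l)" using t by (subst powr_realpow) (auto simp: power_sum)
    finally show "t powr D \<le> (\<Prod>l<d. t ^ \<alpha> l)" .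
  qed
  also have "\<dots> \<le> (\<Sum>\<alpha>\<in>PiE {..<d} (\<lambda>_. {..<q}). \<Prod>l<d. t ^ \<alpha> l)"
  proof (rule sum_mono2)
    show "finite (PiE {..<d} (\<lambda>_. {..<q}))" by (rule finite_PiE) simp_all
    show "low_exponents q d \<subseteq> PiE {..<d} (\<lambda>_. {..<q})" unfolding low_exponents_def by (rule Collect_restrict)
    show "0 \<le> (\<Prod>l<d. t ^ \<alpha> l)" for \<alpha> :: "nat \<Rightarrow> nat" using t by (intro prod_nonneg) simp
  qed
  also have "\<dots> = (\<Prod>l<d. \<Sum>j<q. t ^ j)" by (rule prod_sum_PiE[symmetric]) auto
  also have "\<dots> = (\<Sum>j<q. t ^ j) ^ d" by simp
  finally have "real (card (low_exponents q d)) * t powr D \<le> (\<Sum>j<q. t ^ j) ^ d" .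
  moreover have "t powr D = (t powr ((real q - 1) / 3)) ^ d"
    unfolding D_def powr_powr[symmetric] using t by (subst powr_realpow) simp_all
  ultimately show ?thesis using t by (simp add: power_divide field_simps)
qed

subsection \<open>The exponent\<close>

abbreviation rate :: "nat \<Rightarrow> real \<Rightarrow> real" where
  "rate p t \<equiv> (\<Sum>j<p. t ^ j) / t powr ((real p - 1) / 3)"

text \<open>Pairing t^j with t^(p - 1 - j) gives the constant product t^(p - 1), so AM-GM applies to
  each pair.\<close>

lemma geometric_sum_ge_sqrt:
  fixes t :: real
  assumes "0 < t"
  shows "(\<Sum>j<p. t ^ j) \<ge> real p * sqrt (t ^ (p - 1))"
proof -
  have "2 * (real p * sqrt (t ^ (p - 1))) = (\<Sum>j<p. 2 * sqrt (t ^ (p - 1)))" by simp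
  also have "\<dots> \<le> (\<Sum>j<p. t ^ j + t ^ (p - Suc j))"
  proof (rule sum_mono)
    fix j assume "j \<in> {..<p}"
    then have "t ^ (p - 1) = t ^ j * t ^ (p - Suc j)" by (simp flip: power_add)
    then have "2 * sqrt (t ^ (p - 1)) = 2 * sqrt (t ^ j) * sqrt (t ^ (p - Suc j))"
      by (simp add: real_sqrt_mult)
    also have "\<dots> \<le> sqrt (t ^ j) ^ 2 + sqrt (t ^ (p - Suc j)) ^ 2" by (rule sum_squares_bound)
    finally show "2 * sqrt (t ^ (p - 1)) \<le> t ^ j + t ^ (p - Suc j)" using assms by simp
  qed
  also have "\<dots> = (\<Sum>j<p. t ^ j) + (\<Sum>j<p. t ^ j)"
    by (simp add: sum.distrib sum.nat_diff_reindex[of "\<lambda>j. t ^ j"])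
  finally show ?thesis by simp
qed

text \<open>The cube of the rate is S^3 / t^(p - 1), S being the geometric sum; S^2 \<ge> p^2 t^(p -
  1) and S \<ge> 1 make it at least p^2. This yields \<open>c_p3 p\<close> \<le> 1/3, inside the
  range up to 1/2 that merging roles requires.\<close>

lemma rate_ge:
  assumes "p \<ge> 2" "0 < t" "t < 1"
  shows "rate p t \<ge> real p powr (2 / 3)"
proof -
  define S where "S = (\<Sum>j<p. t ^ j)"
  have "(\<Sum>j\<in>{0}. t ^ j) \<le> S" unfolding S_def using assms by (intro sum_mono2) auto
  then have S1: "S \<ge> 1" by simp
  have sq: "S ^ 2 \<ge> (real p * sqrt (t ^ (p - 1))) ^ 2"
    unfolding S_def using assms by (intro power_mono geometric_sum_ge_sqrt) auto
  have "real p ^ 2 * t ^ (p - 1) = (real p * sqrt (t ^ (p - 1))) ^ 2"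
    using assms by (simp add: power_mult_distrib)
  also have "\<dots> \<le> S ^ 2 * S" using sq S1 mult_mono[of "(real p * sqrt (t ^ (p - 1))) ^ 2" "S ^ 2" 1 S] by simp
  also have "\<dots> = S ^ 3" by (simp only: power2_eq_square power3_eq_cube)
  finally have "real p ^ 2 \<le> S ^ 3 / t ^ (p - 1)" using assms by (subst pos_le_divide_eq) auto
  moreover have "t ^ (p - 1) = (t powr ((real p - 1) / 3)) ^ 3"
  proof -
    have "(t powr ((real p - 1) / 3)) ^ 3 = t powr real (p - 1)"
      using assms by (simp add: powr_power of_nat_diff diff_divide_distrib)
    also have "\<dots> = t ^ (p - 1)" using assms by (intro powr_realpow)
    finally show ?thesis by simp
  qed
  moreover have "S ^ 3 / (t powr ((real p - 1) / 3)) ^ 3 = rate p t ^ 3" by (simp add: S_def power_divide)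
  moreover have "real p ^ 2 = (real p powr (2 / 3)) ^ 3" using assms by (simp add: powr_power powr_numeral)
  ultimately have "(real p powr (2 / 3)) ^ 3 \<le> rate p t ^ 3" by (simp only:)
  moreover have "0 \<le> rate p t" using S1 by (simp add: S_def)
  ultimately show ?thesis by (simp add: power_mono_iff)
qed

text \<open>At t = 1 the numerator equals p times the denominator, and their slopes are p (p - 1)/2
  and p (p - 1)/3. The numerator is steeper, hence smaller just to the left of 1. This is what makes
  \<open>c_p3 p\<close> positive.\<close>

lemma rate_lt:
  assumes "p \<ge> 2"
  obtains t where "0 < t" "t < 1" "rate p t < real p"
proof -
  define h where "h t = (\<Sum>j<p. t ^ j) - real p * t powr ((real p - 1) / 3)" for t :: real
  have sum: "(\<Sum>j<p. real j) = real p * (real p - 1) / 2"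
    by (induction p) (auto simp: field_simps)
  have d1: "((\<lambda>t. \<Sum>j<p. t ^ j) has_real_derivative (\<Sum>j<p. real j)) (at 1)"
    by (auto intro!: derivative_eq_intros)
  have d2: "((\<lambda>t. real p * t powr ((real p - 1) / 3)) has_real_derivative real p * ((real p - 1) / 3)) (at 1)"
    by (auto intro!: derivative_eq_intros)
  have "(h has_real_derivative (real p * (real p - 1) / 2 - real p * ((real p - 1) / 3))) (at 1)"
    unfolding h_def using DERIV_diff[OF d1 d2] unfolding sum .
  moreover have "real p * (real p - 1) / 2 - real p * ((real p - 1) / 3) > 0"
    using assms by (simp add: field_simps)
  ultimately obtain e where e: "e > 0" "\<And>s. s > 0 \<Longrightarrow> s < e \<Longrightarrow> h (1 - s) < h 1"
    using DERIV_pos_inc_left by blast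
  define s where "s = min (e / 2) (1 / 2)"
  have s: "0 < s" "s < e" "s < 1" using e by (auto simp: s_def)
  have "h 1 = 0" by (simp add: h_def)
  then have "h (1 - s) < 0" using e(2) s by metis
  then have "rate p (1 - s) < real p" using s by (simp add: h_def divide_less_eq)
  then show ?thesis using that[of "1 - s"] s by simp
qed

lemma bdd_below_rate:
  assumes "p \<ge> 2"
  shows "bdd_below (rate p ` {0<..<1})"
  using rate_ge[OF assms] by (intro bdd_belowI[of _ "real p powr (2 / 3)"]) auto

lemma INF_rate_ge:
  assumes "p \<ge> 2"
  shows "real p powr (2 / 3) \<le> (INF t\<in>{0<..<1::real}. rate p t)"
  using rate_ge[OF assms] by (intro cINF_greatest) auto

lemma INF_rate_less:
  assumes "p \<ge> 2"
  shows "(INF t\<in>{0<..<1::real}. rate p t) < real p"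
proof -
  obtain t where t: "0 < t" "t < 1" "rate p t < real p" using rate_lt[OF assms] .
  then have "(INF t\<in>{0<..<1::real}. rate p t) \<le> rate p t"
    using bdd_below_rate[OF assms] by (intro cINF_lower) auto
  then show ?thesis using t by simp
qed

lemma INF_rate_pos:
  assumes "p \<ge> 2"
  shows "0 < (INF t\<in>{0<..<1::real}. rate p t)"
proof -
  have "0 < real p powr (2 / 3)" using assms by simp
  then show ?thesis using INF_rate_ge[OF assms] by linarith
qed

lemma c_p3_pos:
  assumes "p \<ge> 2"
  shows "0 < c_p3 p"
proof -
  have "log (real p) (INF t\<in>{0<..<1::real}. rate p t) < log (real p) (real p)"
    using assms INF_rate_pos[OF assms] INF_rate_less[OF assms] by (subst log_less_cancel_iff) auto
  then show ?thesis using assms by (simp add: c_p3_def)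
qed

lemma c_p3_le:
  assumes "p \<ge> 2"
  shows "c_p3 p \<le> 1 / 3"
proof -
  have "log (real p) (real p powr (2 / 3)) \<le> log (real p) (INF t\<in>{0<..<1::real}. rate p t)"
    using assms INF_rate_pos[OF assms] INF_rate_ge[OF assms] by (subst log_le_cancel_iff) auto
  then show ?thesis using assms by (simp add: c_p3_def)
qed

text \<open>Taking d-th roots isolates the rate, so the infimum over t can be taken whether or not
  it is attained; this leaves d = 0 as a separate case.\<close>

lemma card_low_exponents_le_powr:
  assumes "p \<ge> 2"
  shows "real (card (low_exponents p d)) \<le> (real p powr (1 - c_p3 p)) ^ d"
proof -
  define R where "R = (INF t\<in>{0<..<1::real}. rate p t)"
  have "real p powr (1 - c_p3 p) = R"
    using assms INF_rate_pos[OF assms] by (simp add: R_def c_p3_def)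
  moreover have "real (card (low_exponents p d)) \<le> R ^ d"
  proof (cases "d = 0")
    case True
    then show ?thesis using card_low_exponents_le[of "1/2" p d] assms by simp
  next
    case False
    have "root d (real (card (low_exponents p d))) \<le> rate p t" if "0 < t" "t < 1" for t
    proof -
      have "root d (real (card (low_exponents p d))) \<le> root d (rate p t ^ d)"
        using card_low_exponents_le[OF that, of p d] assms False by (intro real_root_le_mono) auto
      also have "\<dots> = rate p t" using False that by (intro real_root_power_cancel) (auto intro!: divide_nonneg_nonneg sum_nonneg)
      finally show ?thesis .
    qed
    then have "root d (real (card (low_exponents p d))) \<le> R"
      unfolding R_def by (intro cINF_greatest) auto
    then have "root d (real (card (low_exponents p d))) ^ d \<le> R ^ d" using False by (intro power_mono) auto
    then show ?thesis using False by simp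
  qed
  ultimately show ?thesis by simp
qed

subsection \<open>Isolated triangles\<close>

text \<open>A triple with sum zero is encoded by its first two entries.\<close>

definition entry :: "nat \<Rightarrow> 'v::ab_group_add \<times> 'v \<Rightarrow> 'v" where
  "entry j c = (if j = 0 then fst c else if j = 1 then snd c else - fst c - snd c)"

definition entries :: "nat \<Rightarrow> 'i set \<Rightarrow> ('i \<Rightarrow> 'v::ab_group_add \<times> 'v) \<Rightarrow> 'i \<Rightarrow> 'v" where
  "entries j \<Omega> z = (\<lambda>\<omega>\<in>\<Omega>. entry j (z \<omega>))"

lemma entry_simps [simp]: "entry 0 c = fst c" "entry (Suc 0) c = snd c" "entry 2 c = - fst c - snd c"
  by (simp_all add: entry_def)

lemma less_3_cases: "j < (3::nat) \<longleftrightarrow> j = 0 \<or> j = 1 \<or> j = 2" by auto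

lemma entry_add: "entry j (c + c') = entry j c + entry j c'"
  by (auto simp: entry_def)

lemma entry_diff: "entry j (c - c') = entry j c - entry j c'"
  by (auto simp: entry_def)

lemma entries_eq_iff: "entries j \<Omega> z = entries j \<Omega> z' \<longleftrightarrow> (\<forall>\<omega>\<in>\<Omega>. entry j (z \<omega>) = entry j (z' \<omega>))"
  by (auto simp: entries_def fun_eq_iff)

text \<open>Two entries determine a triple with sum zero, so with role \<open>j\<close> fixed one
  further role is an injective code.\<close>

lemma card_matching_entries_le:
  assumes "finite \<Omega>"
  shows "card {s' \<in> PiE \<Omega> (\<lambda>_. UNIV). entries j \<Omega> s' = entries j \<Omega> (s :: 'i \<Rightarrow> 'v::{ab_group_add,finite} \<times> 'v)}
    \<le> CARD('v) ^ card \<Omega>"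
proof -
  define i :: nat where "i = (if j = 0 then 1 else 0)"
  have "inj_on (entries i \<Omega>) {s' \<in> PiE \<Omega> (\<lambda>_. UNIV). entries j \<Omega> s' = entries j \<Omega> s}"
  proof (rule inj_onI)
    fix x y assume xy: "x \<in> {s' \<in> PiE \<Omega> (\<lambda>_. UNIV). entries j \<Omega> s' = entries j \<Omega> s}"
      "y \<in> {s' \<in> PiE \<Omega> (\<lambda>_. UNIV). entries j \<Omega> s' = entries j \<Omega> s}" "entries i \<Omega> x = entries i \<Omega> y"
    show "x = y"
    proof (rule PiE_ext[where s = "\<lambda>_. UNIV"])
      fix \<omega> assume "\<omega> \<in> \<Omega>"
      then have "entry i (x \<omega>) = entry i (y \<omega>)" "entry j (x \<omega>) = entry j (y \<omega>)"
        using xy by (auto simp: entries_eq_iff)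
      then show "x \<omega> = y \<omega>" by (auto simp: i_def entry_def prod_eq_iff split: if_splits)
    qed (use xy in auto)
  qed
  moreover have "entries i \<Omega> ` {s' \<in> PiE \<Omega> (\<lambda>_. UNIV). entries j \<Omega> s' = entries j \<Omega> s} \<subseteq> PiE \<Omega> (\<lambda>_. UNIV)"
    by (auto simp: entries_def)
  ultimately have "card {s' \<in> PiE \<Omega> (\<lambda>_. UNIV). entries j \<Omega> s' = entries j \<Omega> s} \<le> card (PiE \<Omega> (\<lambda>_. UNIV :: 'v set))"
    using assms by (intro card_inj_on_le finite_PiE) auto
  also have "\<dots> = CARD('v) ^ card \<Omega>" using assms by (simp add: card_PiE)
  finally show ?thesis .
qed

section \<open>Random affine maps and isolation\<close>

text \<open>The image of \<open>u\<close> under the linear map from F^d to (F^n)^\<Omega> with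
  columns \<open>A l\<close>, evaluated at \<omega>. Independent uniform columns make it a random
  linear map.\<close>

definition combination :: "nat \<Rightarrow> (nat \<Rightarrow> 'i \<Rightarrow> 'a::field ^ 'n) \<Rightarrow> (nat \<Rightarrow> 'a) \<Rightarrow> 'i \<Rightarrow> 'a ^ 'n" where
  "combination d A u \<omega> = (\<Sum>l<d. u l *s A l \<omega>)"

lemma combination_diff: "combination d A (\<lambda>l. u l - v l) \<omega> = combination d A u \<omega> - combination d A v \<omega>"
  by (simp add: combination_def vec.scale_left_diff_distrib sum_subtractf)

lemma entry_combination:
  "entry j (combination d A (\<lambda>l. fst (s l)) \<omega>, combination d A (\<lambda>l. snd (s l)) \<omega>)
    = combination d A (\<lambda>l. entry j (s l)) \<omega>"
  by (simp add: entry_def combination_def vec.scale_left_diff_distrib sum_subtractf sum_negf)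

text \<open>A nonzero \<open>u\<close> has a uniformly distributed image: the column at a position
  where \<open>u\<close> does not vanish is determined by the target and the other columns.\<close>

lemma card_combination_fibre:
  fixes t :: "'i \<Rightarrow> 'a::{field,finite} ^ 'n"
  assumes \<Omega>: "finite \<Omega>" and l0: "l0 < d" "u l0 \<noteq> 0"
  shows "card {A \<in> PiE {..<d} (\<lambda>_. PiE \<Omega> (\<lambda>_. UNIV)). \<forall>\<omega>\<in>\<Omega>. combination d A u \<omega> = t \<omega>} * CARD('a ^ 'n) ^ card \<Omega>
    \<le> (CARD('a ^ 'n) ^ card \<Omega>) ^ d" (is "card ?A * ?N \<le> _")
proof -
  let ?D = "{..<d} - {l0}"
  have "inj_on (\<lambda>A. restrict A ?D) ?A"
  proof (rule inj_onI)
    fix A B assume AB: "A \<in> ?A" "B \<in> ?A" "restrict A ?D = restrict B ?D"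
    have off: "A l = B l" if "l < d" "l \<noteq> l0" for l
      using fun_cong[OF AB(3), of l] that by simp
    show "A = B"
    proof (rule PiE_ext[where s = "\<lambda>_. PiE \<Omega> (\<lambda>_. UNIV)"])
      fix l assume l: "l \<in> {..<d}"
      show "A l = B l"
      proof (cases "l = l0")
        case True
        have "A l0 = B l0"
        proof (rule PiE_ext[where s = "\<lambda>_. UNIV"])
          fix \<omega> assume \<omega>: "\<omega> \<in> \<Omega>"
          have "u l0 *s A l0 \<omega> + (\<Sum>l\<in>?D. u l *s A l \<omega>) = u l0 *s B l0 \<omega> + (\<Sum>l\<in>?D. u l *s B l \<omega>)"
            using AB(1,2) \<omega> l0(1) by (simp add: combination_def sum.remove[of "{..<d}" l0])
          also have "(\<Sum>l\<in>?D. u l *s B l \<omega>) = (\<Sum>l\<in>?D. u l *s A l \<omega>)"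
            using off by (intro sum.cong) auto
          finally show "A l0 \<omega> = B l0 \<omega>" using l0(2) by (simp add: vector_mul_lcancel)
        qed (use AB l0 in \<open>auto simp: PiE_iff\<close>)
        with True show ?thesis by simp
      qed (use off l in auto)
    qed (use AB in auto)
  qed
  moreover have "(\<lambda>A. restrict A ?D) ` ?A \<subseteq> PiE ?D (\<lambda>_. PiE \<Omega> (\<lambda>_. UNIV))"
    by (auto simp: PiE_iff extensional_def)
  ultimately have "card ?A \<le> card (PiE ?D (\<lambda>_. PiE \<Omega> (\<lambda>_. UNIV :: ('a ^ 'n) set)))"
    using \<Omega> by (intro card_inj_on_le finite_PiE) auto
  also have "\<dots> = ?N ^ (d - 1)" using \<Omega> l0(1) by (simp add: card_PiE)
  finally have "card ?A * ?N \<le> ?N ^ (d - 1) * ?N" by simp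
  also have "\<dots> = ?N ^ d" using l0(1) by (cases d) (simp_all add: mult.commute)
  finally show ?thesis .
qed

lemma card_UN_le_mult:
  assumes "finite I" "\<And>i. i \<in> I \<Longrightarrow> real (card (F i)) \<le> b"
  shows "real (card (\<Union>i\<in>I. F i)) \<le> real (card I) * b"
proof -
  have "real (card (\<Union>i\<in>I. F i)) \<le> real (\<Sum>i\<in>I. card (F i))" using card_UN_le[OF assms(1)] by (rule of_nat_mono)
  also have "\<dots> \<le> (\<Sum>i\<in>I. b)" unfolding of_nat_sum using assms by (intro sum_mono) auto
  finally show ?thesis by simp
qed

text \<open>Average over the linear part \<open>A\<close> and the translation by a triangle
  \<open>b\<close>. A source triangle mapped into \<open>E\<close> has on average at most 3 q^d
  \<Delta> / NN conflicts, which is at most 1/2 by \<open>small\<close>. Hence the isolated sources,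
  a tricoloured sum-free set for every choice of the map, number on average at least |E| q^(2d) / (2
  NN^2).\<close>

theorem isolated_cycles_bound:
  fixes Y :: "nat \<Rightarrow> ('i \<Rightarrow> 'a::{field,finite} ^ 'n) set"
  assumes \<Omega>: "finite \<Omega>"
    and \<Gamma>: "\<Gamma> = {z \<in> PiE \<Omega> (\<lambda>_. UNIV). \<forall>j<3. entries j \<Omega> z \<in> Y j}"
    and E: "E \<subseteq> \<Gamma>"
    and deg: "\<And>z j. z \<in> E \<Longrightarrow> j < 3 \<Longrightarrow> real (card {z' \<in> \<Gamma>. entries j \<Omega> z' = entries j \<Omega> z}) \<le> \<Delta>"
    and small: "6 * \<Delta> * real CARD('a) ^ d \<le> real CARD('a ^ 'n) ^ card \<Omega>"
  shows "real (card E) * real CARD('a) ^ (2 * d)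
    \<le> 6 * real (card (low_exponents CARD('a) d)) * (real CARD('a ^ 'n) ^ card \<Omega>)\<^sup>2"
proof (cases "E = {}")
  case nonempty: False
  define q where "q = real CARD('a)"
  define NN where "NN = real CARD('a ^ 'n) ^ card \<Omega>"
  define U where "U = PiE {..<d} (\<lambda>_. UNIV :: ('a \<times> 'a) set)"
  define AA where "AA = PiE {..<d} (\<lambda>_. PiE \<Omega> (\<lambda>_. UNIV :: ('a ^ 'n) set))"
  define BB where "BB = PiE \<Omega> (\<lambda>_. UNIV :: (('a ^ 'n) \<times> ('a ^ 'n)) set)"
  have "\<Gamma> \<subseteq> BB" by (auto simp: \<Gamma> BB_def)
  moreover have fin: "finite U" "finite AA" "finite BB"
    unfolding U_def AA_def BB_def using \<Omega> by (auto intro!: finite_PiE)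
  ultimately have "finite \<Gamma>" by (blast intro: finite_subset)
  with E have fin: "finite U" "finite AA" "finite BB" "finite \<Gamma>" "finite E"
    using fin by (auto intro: finite_subset)
  have cards: "real (card U) = q ^ (2 * d)" "real (card AA) = NN ^ d" "real (card BB) = NN\<^sup>2"
    using \<Omega> by (simp_all add: U_def AA_def BB_def card_PiE q_def NN_def power_mult power2_eq_square
      power_mult_distrib prod_constant flip: of_nat_power)
  have NNpos: "NN > 0" by (simp add: NN_def)
  define lin where "lin A s \<omega> = (combination d A (\<lambda>l. fst (s l)) \<omega>, combination d A (\<lambda>l. snd (s l)) \<omega>)"
    for A :: "nat \<Rightarrow> 'i \<Rightarrow> 'a ^ 'n" and s :: "nat \<Rightarrow> 'a \<times> 'a" and \<omega>
  define img where "img A b s = (\<lambda>\<omega>\<in>\<Omega>. b \<omega> + lin A s \<omega>)" for A and b :: "'i \<Rightarrow> ('a ^ 'n) \<times> ('a ^ 'n)" and s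
  have entry_img: "entry j (img A b s \<omega>) = entry j (b \<omega>) + combination d A (\<lambda>l. entry j (s l)) \<omega>"
    if "\<omega> \<in> \<Omega>" for j A b s \<omega>
    using that by (simp add: img_def entry_add lin_def entry_combination)
  have img_BB: "img A b s \<in> BB" for A b s by (simp add: img_def BB_def)
  have entries_img: "entries j \<Omega> (img A b s) = entries j \<Omega> (img A b s')"
    if "entries j {..<d} s = entries j {..<d} s'" for j A b s s'
    using that by (auto simp: entries_eq_iff entry_img combination_def intro!: sum.cong)
  \<comment> \<open>Conflicts are taken with all triangles of \<Gamma>, not only with those of
    \<open>E\<close>: the mixed triangle formed below is only known to map into \<Gamma>.\<close>
  define conf where "conf A b s \<longleftrightarrow>
    (\<exists>s'\<in>U. s' \<noteq> s \<and> img A b s' \<in> \<Gamma> \<and> (\<exists>j<3. entries j {..<d} s' = entries j {..<d} s))" for A b s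
  define S where "S A b = {s \<in> U. img A b s \<in> E \<and> \<not> conf A b s}" for A b
  define M where "M = real (card (low_exponents CARD('a) d))"
  have S_bound: "real (card (S A b)) \<le> 3 * M" for A b
  proof -
    have "card (S A b) \<le> 3 * card (low_exponents CARD('a) d)"
    proof (rule tricoloured_sum_free_bound)
      show "finite (S A b)" using fin by (simp add: S_def)
      fix s0 s1 s2 assume s: "s0 \<in> S A b" "s1 \<in> S A b" "s2 \<in> S A b"
      show "(\<forall>l<d. entry 0 (s0 l) + entry 1 (s1 l) + entry 2 (s2 l) = 0) \<longleftrightarrow> s0 = s1 \<and> s1 = s2"
      proof
        assume sum0: "\<forall>l<d. entry 0 (s0 l) + entry 1 (s1 l) + entry 2 (s2 l) = 0"
        \<comment> \<open>The mixed triangle, with entry 0 of \<open>s0\<close>, entry 1 of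
          \<open>s1\<close> and therefore entry 2 of \<open>s2\<close>. The entries of its image lie
          in the sets \<open>Y j\<close>, so the image is in \<Gamma>, and isolation identifies the
          mixed triangle with all three.\<close>
        define s where "s = (\<lambda>l\<in>{..<d}. (fst (s0 l), snd (s1 l)))"
        have sU: "s \<in> U" by (simp add: s_def U_def)
        have e0: "entries 0 {..<d} s = entries 0 {..<d} s0"
          and e1: "entries 1 {..<d} s = entries 1 {..<d} s1"
          by (simp_all add: entries_eq_iff s_def)
        have e2: "entries 2 {..<d} s = entries 2 {..<d} s2"
          using sum0 by (simp add: entries_eq_iff s_def) (simp add: eq_neg_iff_add_eq_0 algebra_simps)
        have "entries j \<Omega> (img A b s) \<in> Y j" if "j < 3" for j
        proof -
          have "img A b s0 \<in> \<Gamma>" "img A b s1 \<in> \<Gamma>" "img A b s2 \<in> \<Gamma>" using s E by (auto simp: S_def)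
          then show ?thesis
            using that entries_img[OF e0, of A b] entries_img[OF e1, of A b] entries_img[OF e2, of A b]
            by (auto simp: \<Gamma> less_3_cases)
        qed
        then have "img A b s \<in> \<Gamma>" using img_BB[of A b s] by (simp add: \<Gamma> BB_def)
        then have "s = s'" if "s' \<in> S A b" "j < 3" "entries j {..<d} s = entries j {..<d} s'" for s' j
          using that sU by (auto simp: S_def conf_def)
        from this[OF s(1) _ e0] this[OF s(2) _ e1] this[OF s(3) _ e2] show "s0 = s1 \<and> s1 = s2" by simp
      qed simp
    qed
    then have "real (card (S A b)) \<le> real (3 * card (low_exponents CARD('a) d))" by (rule of_nat_mono)
    then show ?thesis by (simp add: M_def)
  qed
  define G where "G = {(A, b, s). A \<in> AA \<and> b \<in> BB \<and> s \<in> U \<and> img A b s \<in> E}"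
  define C where "C = {(A, b, s). A \<in> AA \<and> b \<in> BB \<and> s \<in> U \<and> img A b s \<in> E \<and> conf A b s}"
  have "G \<subseteq> AA \<times> BB \<times> U" by (auto simp: G_def)
  then have finG: "finite G" by (rule finite_subset) (use fin in auto)
  have CG: "C \<subseteq> G" by (auto simp: C_def G_def)
  have G_upper: "real (card (G - C)) \<le> NN ^ d * NN\<^sup>2 * (3 * M)"
  proof -
    have "G - C = (\<Union>(A, b)\<in>AA \<times> BB. {A} \<times> {b} \<times> S A b)"
      by (auto simp: G_def C_def S_def)
    moreover have "real (card (\<Union>(A, b)\<in>AA \<times> BB. {A} \<times> {b} \<times> S A b)) \<le> real (card (AA \<times> BB)) * (3 * M)"
      using fin S_bound by (intro card_UN_le_mult) (auto simp: card_cartesian_product)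
    ultimately show ?thesis by (simp add: card_cartesian_product cards)
  qed
  have G_lower: "NN ^ d * real (card E) * q ^ (2 * d) \<le> real (card G)"
  proof -
    have "card (AA \<times> E \<times> U) \<le> card G"
    proof (rule card_inj_on_le)
      \<comment> \<open>For given \<open>A\<close>, \<open>s\<close> and target \<open>z\<close>
        there is a translation sending \<open>s\<close> to \<open>z\<close>.\<close>
      let ?g = "\<lambda>(A, z, s). (A, \<lambda>\<omega>\<in>\<Omega>. z \<omega> - lin A s \<omega>, s)"
      have "z = z'" if "z \<in> E" "z' \<in> E" "(\<lambda>\<omega>\<in>\<Omega>. z \<omega> - lin A s \<omega>) = (\<lambda>\<omega>\<in>\<Omega>. z' \<omega> - lin A s \<omega>)" for z z' A s
      proof (rule PiE_ext)
        show "z \<in> PiE \<Omega> (\<lambda>_. UNIV)" "z' \<in> PiE \<Omega> (\<lambda>_. UNIV)" using that E by (auto simp: \<Gamma>)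
        fix \<omega> assume "\<omega> \<in> \<Omega>"
        then show "z \<omega> = z' \<omega>" using fun_cong[OF that(3), of \<omega>] by simp
      qed
      then show "inj_on ?g (AA \<times> E \<times> U)" by (auto intro!: inj_onI)
      have "img A (\<lambda>\<omega>\<in>\<Omega>. z \<omega> - lin A s \<omega>) s = z" if "z \<in> E" for A z s
        using that E by (auto simp: img_def \<Gamma> fun_eq_iff PiE_iff extensional_def)
      then show "?g ` (AA \<times> E \<times> U) \<subseteq> G" by (auto simp: G_def BB_def)
      show "finite G" by (rule finG)
    qed
    then have "real (card (AA \<times> E \<times> U)) \<le> real (card G)" by (rule of_nat_mono)
    then show ?thesis by (simp add: card_cartesian_product cards mult_ac)
  qed
  have \<Delta>: "\<Delta> \<ge> 0"
  proof -
    obtain z where "z \<in> E" using nonempty by blast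
    from deg[OF this, of 0] show ?thesis by linarith
  qed
  \<comment> \<open>Union bound over the source \<open>s\<close>, its image \<open>z\<close>, the
    shared role, the conflicting source \<open>s'\<close> (at most q^d) and its image
    \<open>z'\<close> (at most \<Delta>). The translation is determined by \<open>z\<close>, so only
    the linear parts sending s' - s to z' - z are left to count.\<close>
  have C_upper: "real (card C) \<le> q ^ (2 * d) * (real (card E) * (3 * (q ^ d * (\<Delta> * (NN ^ d / NN)))))"
  proof -
    define near where "near j s = {s' \<in> U. s' \<noteq> s \<and> entries j {..<d} s' = entries j {..<d} s}" for j s
    define nb where "nb j z = {z' \<in> \<Gamma>. entries j \<Omega> z' = entries j \<Omega> z}" for j z
    define AS where "AS s s' z z' = {A \<in> AA. \<forall>\<omega>\<in>\<Omega>. lin A s' \<omega> - lin A s \<omega> = z' \<omega> - z \<omega>}" for s s' z z'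
    have AS: "real (card (AS s s' z z')) \<le> NN ^ d / NN" if "s \<in> U" "s' \<in> U" "s' \<noteq> s" for s s' z z'
    proof -
      have "\<exists>l<d. s' l \<noteq> s l"
        using PiE_ext[of s' "{..<d}" "\<lambda>_. UNIV" s] that by (auto simp: U_def)
      then obtain l where l: "l < d" "s' l \<noteq> s l" by blast
      \<comment> \<open>The condition on one nonzero component of the difference already has
        probability at most 1 / NN.\<close>
      have "entry 0 (s' l) - entry 0 (s l) \<noteq> 0 \<or> entry 1 (s' l) - entry 1 (s l) \<noteq> 0"
        using l(2) by (simp add: prod_eq_iff)
      then obtain i :: nat where i: "entry i (s' l) - entry i (s l) \<noteq> 0" by blast
      let ?B = "{A \<in> AA. \<forall>\<omega>\<in>\<Omega>. combination d A (\<lambda>l. entry i (s' l) - entry i (s l)) \<omega> = entry i (z' \<omega> - z \<omega>)}"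
      have "combination d A (\<lambda>l. entry i (s' l) - entry i (s l)) \<omega> = entry i (lin A s' \<omega> - lin A s \<omega>)" for A \<omega>
        by (simp add: combination_diff entry_diff lin_def entry_combination del: diff_Pair)
      then have "AS s s' z z' \<subseteq> ?B" by (auto simp: AS_def)
      then have "card (AS s s' z z') \<le> card ?B" using fin by (intro card_mono) auto
      then have "card (AS s s' z z') * CARD('a ^ 'n) ^ card \<Omega> \<le> card ?B * CARD('a ^ 'n) ^ card \<Omega>"
        by (rule mult_right_mono) simp
      also have "\<dots> \<le> (CARD('a ^ 'n) ^ card \<Omega>) ^ d"
        unfolding AA_def 
        by (rule card_combination_fibre[where u = "\<lambda>l. entry i (s' l) - entry i (s l)", OF \<Omega> l(1) i])
      finally have "real (card (AS s s' z z') * CARD('a ^ 'n) ^ card \<Omega>) \<le> real ((CARD('a ^ 'n) ^ card \<Omega>) ^ d)"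
        by (rule of_nat_mono)
      then have "real (card (AS s s' z z')) * NN \<le> NN ^ d" by (simp add: NN_def)
      then show ?thesis using NNpos by (simp add: field_simps)
    qed
    let ?f = "\<lambda>(A, b, s). (A, img A b s, s)"
    have "inj_on ?f C"
    proof -
      have "b = b'" if "b \<in> BB" "b' \<in> BB" "img A b s = img A b' s" for b b' A s
      proof (rule PiE_ext)
        show "b \<in> PiE \<Omega> (\<lambda>_. UNIV)" "b' \<in> PiE \<Omega> (\<lambda>_. UNIV)" using that by (auto simp: BB_def)
        fix \<omega> assume "\<omega> \<in> \<Omega>"
        then show "b \<omega> = b' \<omega>" using fun_cong[OF that(3), of \<omega>] by (simp add: img_def)
      qed
      then show ?thesis by (auto intro!: inj_onI simp: C_def)
    qed
    then have "card C = card (?f ` C)" by (simp add: card_image)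
    moreover have sub: "?f ` C \<subseteq> (\<Union>s\<in>U. \<Union>z\<in>E. \<Union>j\<in>{..<3}. \<Union>s'\<in>near j s. \<Union>z'\<in>nb j z. AS s s' z z' \<times> {z} \<times> {s})"
    proof (clarify)
      fix A b s assume "(A, b, s) \<in> C"
      then have A: "A \<in> AA" "b \<in> BB" "s \<in> U" "img A b s \<in> E" and "conf A b s" by (auto simp: C_def)
      then obtain s' j where s': "s' \<in> U" "s' \<noteq> s" "img A b s' \<in> \<Gamma>" "j < 3"
        "entries j {..<d} s' = entries j {..<d} s" by (auto simp: conf_def)
      have "A \<in> AS s s' (img A b s) (img A b s')" using A by (simp add: AS_def img_def)
      moreover have "s' \<in> near j s" using s' by (simp add: near_def)
      moreover have "img A b s' \<in> nb j (img A b s)" using s' entries_img[OF s'(5)] by (simp add: nb_def)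
      ultimately show "(A, img A b s, s) \<in> (\<Union>s\<in>U. \<Union>z\<in>E. \<Union>j\<in>{..<3}. \<Union>s'\<in>near j s. \<Union>z'\<in>nb j z. AS s s' z z' \<times> {z} \<times> {s})"
        using A s'(4) by blast
    qed
    have finnear: "finite (near j s)" for j s using fin by (simp add: near_def)
    have finnb: "finite (nb j z)" for j z using fin by (simp add: nb_def)
    have finAS: "finite (AS s s' z z')" for s s' z z' using fin by (simp add: AS_def)
    have near: "real (card (near j s)) \<le> q ^ d" for j s
    proof -
      have "card (near j s) \<le> card {s' \<in> U. entries j {..<d} s' = entries j {..<d} s}"
        using fin by (intro card_mono) (auto simp: near_def)
      also have "\<dots> \<le> CARD('a) ^ d" using card_matching_entries_le[of "{..<d}" j s] by (simp add: U_def)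
      finally have "real (card (near j s)) \<le> real (CARD('a) ^ d)" by (rule of_nat_mono)
      then show ?thesis by (simp add: q_def)
    qed
    have nn: "NN ^ d / NN \<ge> 0" "q ^ d \<ge> 0" using NNpos by (auto simp: q_def)
    have l5: "real (card (AS s s' z z' \<times> {z} \<times> {s})) \<le> NN ^ d / NN" if "s \<in> U" "s' \<in> near j s" for s s' z z' j
      using AS[of s s' z z'] that by (simp add: card_cartesian_product near_def)
    have l4: "real (card (\<Union>z'\<in>nb j z. AS s s' z z' \<times> {z} \<times> {s})) \<le> \<Delta> * (NN ^ d / NN)"
      if "s \<in> U" "s' \<in> near j s" "z \<in> E" "j < 3" for s s' z j
    proof -
      have "real (card (\<Union>z'\<in>nb j z. AS s s' z z' \<times> {z} \<times> {s})) \<le> real (card (nb j z)) * (NN ^ d / NN)"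
        using l5 that finnb by (intro card_UN_le_mult) auto
      also have "\<dots> \<le> \<Delta> * (NN ^ d / NN)" using deg[OF that(3,4)] nn by (intro mult_right_mono) (auto simp: nb_def)
      finally show ?thesis .
    qed
    have l3: "real (card (\<Union>s'\<in>near j s. \<Union>z'\<in>nb j z. AS s s' z z' \<times> {z} \<times> {s})) \<le> q ^ d * (\<Delta> * (NN ^ d / NN))"
      if "s \<in> U" "z \<in> E" "j < 3" for s z j
    proof -
      have "real (card (\<Union>s'\<in>near j s. \<Union>z'\<in>nb j z. AS s s' z z' \<times> {z} \<times> {s})) \<le> real (card (near j s)) * (\<Delta> * (NN ^ d / NN))"
        using l4 that finnear by (intro card_UN_le_mult) auto
      also have "\<dots> \<le> q ^ d * (\<Delta> * (NN ^ d / NN))" using near nn \<Delta> by (intro mult_right_mono mult_nonneg_nonneg)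
      finally show ?thesis .
    qed
    have l2: "real (card (\<Union>j\<in>{..<3}. \<Union>s'\<in>near j s. \<Union>z'\<in>nb j z. AS s s' z z' \<times> {z} \<times> {s})) \<le> 3 * (q ^ d * (\<Delta> * (NN ^ d / NN)))"
      if "s \<in> U" "z \<in> E" for s z
    proof -
      have "real (card (\<Union>j\<in>{..<3}. \<Union>s'\<in>near j s. \<Union>z'\<in>nb j z. AS s s' z z' \<times> {z} \<times> {s}))
          \<le> real (card {..<3::nat}) * (q ^ d * (\<Delta> * (NN ^ d / NN)))"
        using l3[OF that] by (intro card_UN_le_mult) auto
      then show ?thesis by simp
    qed
    have l1: "real (card (\<Union>s\<in>U. \<Union>z\<in>E. \<Union>j\<in>{..<3}. \<Union>s'\<in>near j s. \<Union>z'\<in>nb j z. AS s s' z z' \<times> {z} \<times> {s}))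
       \<le> real (card U) * (real (card E) * (3 * (q ^ d * (\<Delta> * (NN ^ d / NN)))))"
      using l2 fin by (intro card_UN_le_mult) auto
    have "card (?f ` C) \<le> card (\<Union>s\<in>U. \<Union>z\<in>E. \<Union>j\<in>{..<3}. \<Union>s'\<in>near j s. \<Union>z'\<in>nb j z. AS s s' z z' \<times> {z} \<times> {s})"
      using fin finnear finnb finAS by (intro card_mono[OF _ sub]) auto
    with l1 \<open>card C = card (?f ` C)\<close> show ?thesis by (simp add: cards)
  qed
  \<comment> \<open>6 is 2 times 3 roles: conflicts use up at most half of the lower bound for
    \<open>G\<close>.\<close>
  have "6 * (\<Delta> * q ^ d / NN) \<le> 1" using small NNpos by (simp add: q_def NN_def)
  then have le: "q ^ (2 * d) * real (card E) * NN ^ d * (6 * (\<Delta> * q ^ d / NN)) \<le> q ^ (2 * d) * real (card E) * NN ^ d * 1"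
    using NNpos by (intro mult_left_mono) (auto simp: q_def)
  have "2 * real (card C) \<le> NN ^ d * real (card E) * q ^ (2 * d)"
  proof -
    have "2 * real (card C) \<le> 2 * (q ^ (2 * d) * (real (card E) * (3 * (q ^ d * (\<Delta> * (NN ^ d / NN))))))"
      using C_upper by linarith
    also have "\<dots> = q ^ (2 * d) * real (card E) * NN ^ d * (6 * (\<Delta> * q ^ d / NN))" by simp
    also have "\<dots> \<le> q ^ (2 * d) * real (card E) * NN ^ d * 1" by (rule le)
    finally show ?thesis by (simp add: mult_ac)
  qed
  moreover have "real (card (G - C)) = real (card G) - real (card C)"
    using card_Diff_subset[OF finite_subset[OF CG finG] CG] card_mono[OF finG CG] by simp
  ultimately have "NN ^ d * real (card E) * q ^ (2 * d) \<le> 2 * (NN ^ d * NN\<^sup>2 * (3 * M))"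
    using G_lower G_upper by linarith
  then have "NN ^ d * (real (card E) * q ^ (2 * d)) \<le> NN ^ d * (6 * M * NN\<^sup>2)" by (simp add: mult_ac)
  then show ?thesis using NNpos by (simp add: q_def NN_def M_def)
qed simp

subsection \<open>Concentration\<close>

lemma exp_le_quadratic:
  fixes x :: real
  assumes "\<bar>x\<bar> \<le> 1"
  shows "exp x \<le> 1 + x + x\<^sup>2"
proof (cases "x \<ge> 0")
  case True
  then show ?thesis using assms exp_bound by simp
next
  case False
  define y where "y = - x"
  have y: "0 < y" "y \<le> 1" using False assms by (auto simp: y_def)
  have "1 \<le> 1 + y ^ 3" using y by simp
  also have "\<dots> = (1 + y) * (1 - y + y\<^sup>2)" by (simp add: algebra_simps power2_eq_square power3_eq_cube)
  also have "\<dots> \<le> exp y * (1 - y + y\<^sup>2)" using y by (intro mult_right_mono exp_ge_add_one_self) auto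
  finally have "exp (- y) * 1 \<le> exp (- y) * (exp y * (1 - y + y\<^sup>2))" by (intro mult_left_mono) auto
  also have "\<dots> = 1 - y + y\<^sup>2" by (simp flip: mult.assoc exp_add)
  finally show ?thesis by (simp add: y_def)
qed

lemma exp_moment_le:
  fixes w \<phi> :: "'c::finite \<Rightarrow> real"
  assumes w: "\<And>c. w c \<ge> 0" "(\<Sum>c\<in>UNIV. w c) = 1"
    and \<phi>: "(\<Sum>c\<in>UNIV. w c * \<phi> c) = 0" "\<And>c. \<bar>\<phi> c\<bar> \<le> B"
    and s: "0 < s" "s * B \<le> 1"
  shows "(\<Sum>c\<in>UNIV. w c * exp (s * \<phi> c)) \<le> exp (s\<^sup>2 * B\<^sup>2)"
proof -
  have "(\<Sum>c\<in>UNIV. w c * exp (s * \<phi> c)) \<le> (\<Sum>c\<in>UNIV. w c + s * (w c * \<phi> c) + w c * (s\<^sup>2 * B\<^sup>2))"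
  proof (rule sum_mono)
    fix c
    have "\<bar>s * \<phi> c\<bar> \<le> s * B" using s \<phi>(2)[of c] by (simp add: abs_mult)
    then have "\<bar>s * \<phi> c\<bar> \<le> 1" and sq: "(s * \<phi> c)\<^sup>2 \<le> (s * B)\<^sup>2"
      using s by (auto simp: power2_le_iff_abs_le intro: power_mono)
    then have "exp (s * \<phi> c) \<le> 1 + s * \<phi> c + (s * B)\<^sup>2" using exp_le_quadratic[of "s * \<phi> c"] by linarith
    then have "w c * exp (s * \<phi> c) \<le> w c * (1 + s * \<phi> c + (s * B)\<^sup>2)" using w by (intro mult_left_mono)
    then show "w c * exp (s * \<phi> c) \<le> w c + s * (w c * \<phi> c) + w c * (s\<^sup>2 * B\<^sup>2)"
      by (simp add: algebra_simps power_mult_distrib)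
  qed
  also have "\<dots> = 1 + s\<^sup>2 * B\<^sup>2"
    using w(2) \<phi>(1) by (simp add: sum.distrib flip: sum_distrib_left sum_distrib_right)
  also have "\<dots> \<le> exp (s\<^sup>2 * B\<^sup>2)" by (rule exp_ge_add_one_self)
  finally show ?thesis .
qed

text \<open>Independent coordinates with laws that may differ, as they will carry rotated weights.
  The parameter \<open>s\<close> stays free, to be tuned to the deviation.\<close>

lemma chernoff_product:
  fixes w \<phi> :: "'i \<Rightarrow> 'c::finite \<Rightarrow> real"
  assumes \<Omega>: "finite \<Omega>"
    and w: "\<And>\<omega> c. \<omega> \<in> \<Omega> \<Longrightarrow> w \<omega> c \<ge> 0" "\<And>\<omega>. \<omega> \<in> \<Omega> \<Longrightarrow> (\<Sum>c\<in>UNIV. w \<omega> c) = 1"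
    and \<phi>: "\<And>\<omega>. \<omega> \<in> \<Omega> \<Longrightarrow> (\<Sum>c\<in>UNIV. w \<omega> c * \<phi> \<omega> c) = 0" "\<And>\<omega> c. \<omega> \<in> \<Omega> \<Longrightarrow> \<bar>\<phi> \<omega> c\<bar> \<le> B"
    and s: "0 < s" "s * B \<le> 1"
  shows "(\<Sum>z\<in>{z \<in> PiE \<Omega> (\<lambda>_. UNIV). (\<Sum>\<omega>\<in>\<Omega>. \<phi> \<omega> (z \<omega>)) > \<xi>}. \<Prod>\<omega>\<in>\<Omega>. w \<omega> (z \<omega>))
    \<le> exp (real (card \<Omega>) * (s\<^sup>2 * B\<^sup>2) - s * \<xi>)"
proof -
  let ?Z = "PiE \<Omega> (\<lambda>_. UNIV :: 'c set)"
  have fin: "finite ?Z" using \<Omega> by (intro finite_PiE) auto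
  have nn: "(\<Prod>\<omega>\<in>\<Omega>. w \<omega> (z \<omega>)) \<ge> 0" for z using w by (intro prod_nonneg) auto
  have "(\<Sum>z\<in>{z \<in> ?Z. (\<Sum>\<omega>\<in>\<Omega>. \<phi> \<omega> (z \<omega>)) > \<xi>}. \<Prod>\<omega>\<in>\<Omega>. w \<omega> (z \<omega>))
    \<le> (\<Sum>z\<in>{z \<in> ?Z. (\<Sum>\<omega>\<in>\<Omega>. \<phi> \<omega> (z \<omega>)) > \<xi>}. (\<Prod>\<omega>\<in>\<Omega>. w \<omega> (z \<omega>)) * exp (s * ((\<Sum>\<omega>\<in>\<Omega>. \<phi> \<omega> (z \<omega>)) - \<xi>)))"
  proof (rule sum_mono)
    fix z assume "z \<in> {z \<in> ?Z. (\<Sum>\<omega>\<in>\<Omega>. \<phi> \<omega> (z \<omega>)) > \<xi>}"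
    then have "1 \<le> exp (s * ((\<Sum>\<omega>\<in>\<Omega>. \<phi> \<omega> (z \<omega>)) - \<xi>))" using s by simp
    then show "(\<Prod>\<omega>\<in>\<Omega>. w \<omega> (z \<omega>)) \<le> (\<Prod>\<omega>\<in>\<Omega>. w \<omega> (z \<omega>)) * exp (s * ((\<Sum>\<omega>\<in>\<Omega>. \<phi> \<omega> (z \<omega>)) - \<xi>))"
      using nn[of z] mult_left_mono[of 1 _ "\<Prod>\<omega>\<in>\<Omega>. w \<omega> (z \<omega>)"] by fastforce
  qed
  also have "\<dots> \<le> (\<Sum>z\<in>?Z. (\<Prod>\<omega>\<in>\<Omega>. w \<omega> (z \<omega>)) * exp (s * ((\<Sum>\<omega>\<in>\<Omega>. \<phi> \<omega> (z \<omega>)) - \<xi>)))"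
    by (rule sum_mono2[OF fin]) (use nn in auto)
  also have "\<dots> = (\<Sum>z\<in>?Z. exp (- (s * \<xi>)) * (\<Prod>\<omega>\<in>\<Omega>. w \<omega> (z \<omega>) * exp (s * \<phi> \<omega> (z \<omega>))))"
  proof (rule sum.cong)
    fix z
    have "exp (s * ((\<Sum>\<omega>\<in>\<Omega>. \<phi> \<omega> (z \<omega>)) - \<xi>)) = exp (- (s * \<xi>)) * (\<Prod>\<omega>\<in>\<Omega>. exp (s * \<phi> \<omega> (z \<omega>)))"
      using \<Omega> by (simp add: right_diff_distrib exp_diff exp_minus exp_sum sum_distrib_left field_simps)
    then show "(\<Prod>\<omega>\<in>\<Omega>. w \<omega> (z \<omega>)) * exp (s * ((\<Sum>\<omega>\<in>\<Omega>. \<phi> \<omega> (z \<omega>)) - \<xi>))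
      = exp (- (s * \<xi>)) * (\<Prod>\<omega>\<in>\<Omega>. w \<omega> (z \<omega>) * exp (s * \<phi> \<omega> (z \<omega>)))"
      by (simp add: prod.distrib)
  qed simp
  also have "\<dots> = exp (- (s * \<xi>)) * (\<Prod>\<omega>\<in>\<Omega>. \<Sum>c\<in>UNIV. w \<omega> c * exp (s * \<phi> \<omega> c))"
    using \<Omega> by (subst prod_sum_PiE) (auto simp: sum_distrib_left)
  also have "\<dots> \<le> exp (- (s * \<xi>)) * (\<Prod>\<omega>\<in>\<Omega>. exp (s\<^sup>2 * B\<^sup>2))"
  proof (intro mult_left_mono prod_mono conjI)
    fix \<omega> assume \<omega>: "\<omega> \<in> \<Omega>"
    show "0 \<le> (\<Sum>c\<in>UNIV. w \<omega> c * exp (s * \<phi> \<omega> c))" using w(1)[OF \<omega>] by (intro sum_nonneg) auto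
    show "(\<Sum>c\<in>UNIV. w \<omega> c * exp (s * \<phi> \<omega> c)) \<le> exp (s\<^sup>2 * B\<^sup>2)"
      using w[OF \<omega>] \<phi>[OF \<omega>] s by (rule exp_moment_le)
  qed simp
  also have "\<dots> = exp (real (card \<Omega>) * (s\<^sup>2 * B\<^sup>2) - s * \<xi>)"
    by (simp add: exp_diff exp_minus field_simps flip: exp_of_nat_mult)
  finally show ?thesis .
qed

text \<open>One-sided union bound over the statistics in \<open>K\<close>. Centring can double the
  bound \<open>B\<close>, hence 2 * \<open>B\<close>.\<close>

lemma simultaneous_typicality:
  fixes w :: "'i \<Rightarrow> 'c::finite \<Rightarrow> real" and \<psi> :: "'k \<Rightarrow> 'i \<Rightarrow> 'c \<Rightarrow> real"
  assumes \<Omega>: "finite \<Omega>" and K: "finite K"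
    and w: "\<And>\<omega> c. \<omega> \<in> \<Omega> \<Longrightarrow> w \<omega> c \<ge> 0" "\<And>\<omega>. \<omega> \<in> \<Omega> \<Longrightarrow> (\<Sum>c\<in>UNIV. w \<omega> c) = 1"
    and \<mu>: "\<And>k \<omega>. k \<in> K \<Longrightarrow> \<omega> \<in> \<Omega> \<Longrightarrow> \<mu> k \<omega> = (\<Sum>c\<in>UNIV. w \<omega> c * \<psi> k \<omega> c)"
    and B: "\<And>k \<omega> c. k \<in> K \<Longrightarrow> \<omega> \<in> \<Omega> \<Longrightarrow> \<bar>\<psi> k \<omega> c\<bar> \<le> B"
    and s: "0 < s" "s * (2 * B) \<le> 1"
    and small: "real (card K) * exp (real (card \<Omega>) * (s\<^sup>2 * (2 * B)\<^sup>2) - s * \<xi>) \<le> 1 / 2"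
  shows "(\<Sum>z\<in>{z \<in> PiE \<Omega> (\<lambda>_. UNIV). \<forall>k\<in>K. (\<Sum>\<omega>\<in>\<Omega>. \<psi> k \<omega> (z \<omega>)) \<le> (\<Sum>\<omega>\<in>\<Omega>. \<mu> k \<omega>) + \<xi>}.
      \<Prod>\<omega>\<in>\<Omega>. w \<omega> (z \<omega>)) \<ge> 1 / 2" (is "sum ?w ?G \<ge> _")
proof -
  let ?Z = "PiE \<Omega> (\<lambda>_. UNIV :: 'c set)"
  define bad where "bad k = {z \<in> ?Z. (\<Sum>\<omega>\<in>\<Omega>. \<psi> k \<omega> (z \<omega>) - \<mu> k \<omega>) > \<xi>}" for k
  have fin: "finite ?Z" using \<Omega> by (intro finite_PiE) auto
  have finbad: "finite (bad k)" for k using fin by (simp add: bad_def)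
  have nn: "?w z \<ge> 0" for z using w by (intro prod_nonneg) auto
  have "sum ?w (bad k) \<le> exp (real (card \<Omega>) * (s\<^sup>2 * (2 * B)\<^sup>2) - s * \<xi>)" if k: "k \<in> K" for k
    unfolding bad_def
  proof (rule chernoff_product[OF \<Omega> w])
    fix \<omega> assume \<omega>: "\<omega> \<in> \<Omega>"
    show "(\<Sum>c\<in>UNIV. w \<omega> c * (\<psi> k \<omega> c - \<mu> k \<omega>)) = 0"
      using w(2)[OF \<omega>] \<mu>[OF k \<omega>] by (simp add: right_diff_distrib sum_subtractf flip: sum_distrib_right)
    have "\<bar>\<mu> k \<omega>\<bar> \<le> (\<Sum>c\<in>UNIV. \<bar>w \<omega> c * \<psi> k \<omega> c\<bar>)" unfolding \<mu>[OF k \<omega>] by (rule sum_abs)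
    also have "\<dots> \<le> (\<Sum>c\<in>UNIV. w \<omega> c * B)"
      using w(1)[OF \<omega>] B[OF k \<omega>] by (intro sum_mono) (auto simp: abs_mult intro!: mult_left_mono)
    also have "\<dots> = B" using w(2)[OF \<omega>] by (simp flip: sum_distrib_right)
    finally show "\<bar>\<psi> k \<omega> c - \<mu> k \<omega>\<bar> \<le> 2 * B" for c using B[OF k \<omega>, of c] by linarith
  qed (use s in auto)
  then have "(\<Sum>k\<in>K. sum ?w (bad k)) \<le> (\<Sum>k\<in>K. exp (real (card \<Omega>) * (s\<^sup>2 * (2 * B)\<^sup>2) - s * \<xi>))"
    by (rule sum_mono)
  with small have small': "(\<Sum>k\<in>K. sum ?w (bad k)) \<le> 1 / 2" by simp
  have "1 = (\<Prod>\<omega>\<in>\<Omega>. \<Sum>c\<in>UNIV. w \<omega> c)" using w(2) by simp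
  also have "\<dots> = sum ?w ?Z" using \<Omega> by (intro prod_sum_PiE) auto
  also have "\<dots> \<le> sum ?w (?G \<union> (\<Union>k\<in>K. bad k))"
  proof (rule sum_mono2)
    show "?Z \<subseteq> ?G \<union> (\<Union>k\<in>K. bad k)" by (auto simp: bad_def sum_subtractf not_le)
  qed (use fin finbad K nn in auto)
  also have "\<dots> \<le> sum ?w ?G + sum ?w (\<Union>k\<in>K. bad k)"
    using fin finbad K nn by (subst sum.union_inter[symmetric]) (auto intro!: sum_nonneg)
  also have "sum ?w (\<Union>k\<in>K. bad k) \<le> (\<Sum>k\<in>K. sum ?w (bad k))"
    using K
  proof (induction K rule: finite_induct)
    case (insert k K)
    have "sum ?w (bad k \<union> (\<Union>k\<in>K. bad k)) \<le> sum ?w (bad k) + sum ?w (\<Union>k\<in>K. bad k)"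
      using insert finbad nn by (subst sum.union_inter[symmetric]) (auto intro!: sum_nonneg)
    with insert show ?case by simp
  qed simp
  finally show ?thesis using small' by simp
qed

subsection \<open>Entropy of triangles\<close>

definition entropy :: "('c::finite \<Rightarrow> real) \<Rightarrow> real" where
  "entropy P = - (\<Sum>x\<in>UNIV. P x * ln (P x))"

definition cycle_weight :: "(nat \<Rightarrow> 'v::ab_group_add \<Rightarrow> real) \<Rightarrow> 'v \<times> 'v \<Rightarrow> real" where
  "cycle_weight g c = (\<Prod>j<3. g j (entry j c))"

definition cycle_marginal :: "(nat \<Rightarrow> 'v::{ab_group_add,finite} \<Rightarrow> real) \<Rightarrow> nat \<Rightarrow> 'v \<Rightarrow> real" where
  "cycle_marginal g j x = (\<Sum>c | entry j c = x. cycle_weight g c)"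

lemma cycle_weight_nonneg: "(\<And>j x. g j x \<ge> 0) \<Longrightarrow> cycle_weight g c \<ge> 0"
  by (simp add: cycle_weight_def prod_nonneg)

lemma sum_cycle_marginal:
  "(\<Sum>x\<in>UNIV. cycle_marginal g j x * \<phi> x) = (\<Sum>c\<in>UNIV. cycle_weight g c * \<phi> (entry j c))"
proof -
  have "(\<Sum>c\<in>UNIV. cycle_weight g c * \<phi> (entry j c))
      = (\<Sum>x\<in>UNIV. \<Sum>c\<in>{c. c \<in> UNIV \<and> entry j c = x}. cycle_weight g c * \<phi> (entry j c))"
    by (rule sum.group[symmetric]) auto
  also have "\<dots> = (\<Sum>x\<in>UNIV. cycle_marginal g j x * \<phi> x)"
    by (intro sum.cong refl) (simp add: cycle_marginal_def sum_distrib_right)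
  finally show ?thesis ..
qed

lemma entropy_cycle_marginal:
  "entropy (cycle_marginal g j) = - (\<Sum>c\<in>UNIV. cycle_weight g c * ln (cycle_marginal g j (entry j c)))"
  unfolding entropy_def sum_cycle_marginal ..

lemma cycle_weight_ln:
  assumes "\<And>j x. g j x \<ge> 0"
  shows "cycle_weight g c * ln (cycle_weight g c) = (\<Sum>j<3. cycle_weight g c * ln (g j (entry j c)))"
proof (cases "cycle_weight g c = 0")
  case False
  then have "\<forall>j<3. g j (entry j c) \<noteq> 0" by (auto simp: cycle_weight_def)
  then have "ln (cycle_weight g c) = (\<Sum>j<3. ln (g j (entry j c)))"
    unfolding cycle_weight_def using assms by (subst ln_prod) (auto simp: less_le)
  then show ?thesis by (simp add: sum_distrib_left)
qed simp

lemma entropy_cycle_weight: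
  assumes "\<And>j x. g j x \<ge> 0"
  shows "entropy (cycle_weight g) = - (\<Sum>j<3. \<Sum>c\<in>UNIV. cycle_weight g c * ln (g j (entry j c)))"
  unfolding entropy_def cycle_weight_ln[OF assms] by (subst sum.swap) simp

text \<open>\<open>E\<close> consists of typical triangles, at least about exp(h) many, and \<Gamma>
  of all triangles with typical entries. On \<Gamma> the product form gives probability at least
  exp(-h - 3\<xi>), while all triangles through an entry of a member of \<open>E\<close> together
  have mass at most exp(-h' + \<xi>). The quotient bounds the degrees for
  \<open>isolated_cycles_bound\<close>. One \<open>h'\<close> serves all roles, since the degrees
  must be small in each of them.\<close>

theorem typical_cycles_bound:
  fixes g :: "'i \<Rightarrow> nat \<Rightarrow> 'a::{field,finite} ^ 'n \<Rightarrow> real"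
  assumes \<Omega>: "finite \<Omega>"
    and g: "\<And>\<omega> j x. g \<omega> j x \<ge> 0"
    and total: "\<And>\<omega>. \<omega> \<in> \<Omega> \<Longrightarrow> (\<Sum>c\<in>UNIV. cycle_weight (g \<omega>) c) = 1"
    and B1: "\<And>\<omega> j x. \<omega> \<in> \<Omega> \<Longrightarrow> j < 3 \<Longrightarrow> \<bar>ln (g \<omega> j x)\<bar> \<le> B"
    and B2: "\<And>\<omega> j x. \<omega> \<in> \<Omega> \<Longrightarrow> j < 3 \<Longrightarrow> \<bar>ln (cycle_marginal (g \<omega>) j x)\<bar> \<le> B"
    and B3: "\<And>\<omega> c. \<omega> \<in> \<Omega> \<Longrightarrow> \<bar>ln (cycle_weight (g \<omega>) c)\<bar> \<le> B"
    and s: "0 < s" "s * (2 * B) \<le> 1"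
    and small: "7 * exp (real (card \<Omega>) * (s\<^sup>2 * (2 * B)\<^sup>2) - s * \<xi>) \<le> 1 / 2"
    and h: "h = (\<Sum>\<omega>\<in>\<Omega>. entropy (cycle_weight (g \<omega>)))"
    and h': "\<And>j. j < 3 \<Longrightarrow> h' \<le> (\<Sum>\<omega>\<in>\<Omega>. entropy (cycle_marginal (g \<omega>) j))"
    and d: "6 * exp (h - h' + 4 * \<xi>) * real CARD('a) ^ d \<le> real CARD('a ^ 'n) ^ card \<Omega>"
  shows "exp (h - \<xi>) * real CARD('a) ^ (2 * d)
    \<le> 12 * real (card (low_exponents CARD('a) d)) * (real CARD('a ^ 'n) ^ card \<Omega>)\<^sup>2"
proof -
  let ?Z = "PiE \<Omega> (\<lambda>_. UNIV :: (('a ^ 'n) \<times> ('a ^ 'n)) set)"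
  define w where "w \<omega> = cycle_weight (g \<omega>)" for \<omega>
  define P where "P \<omega> = cycle_marginal (g \<omega>)" for \<omega>
  define pr where "pr z = (\<Prod>\<omega>\<in>\<Omega>. w \<omega> (z \<omega>))" for z
  define e where "e j = (\<Sum>\<omega>\<in>\<Omega>. \<Sum>c\<in>UNIV. w \<omega> c * ln (g \<omega> j (entry j c)))" for j
  \<comment> \<open>Positivity is demanded separately: \<open>ln\<close> is total, and its value at
    0 says nothing about the weight.\<close>
  define Y where "Y j = {y. (\<forall>\<omega>\<in>\<Omega>. g \<omega> j (y \<omega>) > 0) \<and> (\<Sum>\<omega>\<in>\<Omega>. ln (g \<omega> j (y \<omega>))) \<ge> e j - \<xi>}" for j
  \<comment> \<open>Seven one-sided statistics: the log-weights of the entries must not be too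
    small, the log-marginals and the log-weight of the whole triangle not too large.\<close>
  define \<psi> where "\<psi> k \<omega> c = (if k < 3 then - ln (g \<omega> k (entry k c))
     else if k < 6 then ln (P \<omega> (k - 3) (entry (k - 3) c)) else ln (w \<omega> c))" for k \<omega> c
  define \<mu> where "\<mu> k \<omega> = (\<Sum>c\<in>UNIV. w \<omega> c * \<psi> k \<omega> c)" for k \<omega>
  define T where "T = {z \<in> ?Z. \<forall>k\<in>{..<7}. (\<Sum>\<omega>\<in>\<Omega>. \<psi> k \<omega> (z \<omega>)) \<le> (\<Sum>\<omega>\<in>\<Omega>. \<mu> k \<omega>) + \<xi>}"
  define E where "E = {z \<in> T. \<forall>\<omega>\<in>\<Omega>. w \<omega> (z \<omega>) > 0}"
  define \<Gamma> where "\<Gamma> = {z \<in> ?Z. \<forall>j<3. entries j \<Omega> z \<in> Y j}"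
  have fin: "finite ?Z" using \<Omega> by (intro finite_PiE) auto
  have fins: "finite T" "finite E" "finite \<Gamma>" using fin by (simp_all add: T_def E_def \<Gamma>_def)
  have wnn: "w \<omega> c \<ge> 0" for \<omega> c unfolding w_def using g by (rule cycle_weight_nonneg)
  have prnn: "pr z \<ge> 0" for z unfolding pr_def by (intro prod_nonneg) (simp add: wnn)
  have sum_e: "(\<Sum>j<3. e j) = - h"
  proof -
    have "(\<Sum>j<3. e j) = (\<Sum>\<omega>\<in>\<Omega>. \<Sum>j<3. \<Sum>c\<in>UNIV. w \<omega> c * ln (g \<omega> j (entry j c)))"
      unfolding e_def by (rule sum.swap)
    then show ?thesis by (simp add: h entropy_cycle_weight[OF g] w_def sum_negf)
  qed
  have \<mu>1: "(\<Sum>\<omega>\<in>\<Omega>. \<mu> j \<omega>) = - e j" if "j < 3" for j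
    using that by (simp add: \<mu>_def \<psi>_def e_def sum_negf)
  have \<mu>2: "(\<Sum>\<omega>\<in>\<Omega>. \<mu> (j + 3) \<omega>) \<le> - h'" if "j < 3" for j
    using h'[OF that] that by (simp add: \<mu>_def \<psi>_def w_def P_def entropy_cycle_marginal sum_negf)
  have \<mu>3: "(\<Sum>\<omega>\<in>\<Omega>. \<mu> 6 \<omega>) = - h"
    by (simp add: \<mu>_def \<psi>_def h entropy_def w_def sum_negf)
  have "sum pr T \<ge> 1 / 2"
    unfolding T_def pr_def
  proof (rule simultaneous_typicality[OF \<Omega>, where B = B and s = s])
    show "\<bar>\<psi> k \<omega> c\<bar> \<le> B" if "k \<in> {..<7}" "\<omega> \<in> \<Omega>" for k \<omega> c
      using that B1[of \<omega> k] B2[of \<omega> "k - 3"] B3[of \<omega>] by (auto simp: \<psi>_def P_def w_def)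
  qed (use wnn total s small in \<open>auto simp: \<mu>_def w_def\<close>)
  also have "sum pr T = sum pr E"
    using fins(1) \<Omega> wnn
    by (intro sum.mono_neutral_right) (auto simp: E_def pr_def less_le intro!: prod_zero)
  also have "\<dots> \<le> (\<Sum>z\<in>E. exp (- h + \<xi>))"
  proof (rule sum_mono)
    fix z assume z: "z \<in> E"
    then have "(\<Sum>\<omega>\<in>\<Omega>. \<psi> 6 \<omega> (z \<omega>)) \<le> (\<Sum>\<omega>\<in>\<Omega>. \<mu> 6 \<omega>) + \<xi>" by (simp add: E_def T_def)
    then have "(\<Sum>\<omega>\<in>\<Omega>. ln (w \<omega> (z \<omega>))) \<le> - h + \<xi>" unfolding \<mu>3 by (simp add: \<psi>_def)
    moreover have "pr z = exp (\<Sum>\<omega>\<in>\<Omega>. ln (w \<omega> (z \<omega>)))"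
      using z \<Omega> by (auto simp: pr_def E_def exp_sum intro!: prod.cong)
    ultimately show "pr z \<le> exp (- h + \<xi>)" by simp
  qed
  finally have "1 / 2 \<le> real (card E) * exp (- h + \<xi>)" by simp
  then have "1 / 2 * exp (h - \<xi>) \<le> real (card E) * exp (- h + \<xi>) * exp (h - \<xi>)" by (intro mult_right_mono) auto
  then have cardE: "exp (h - \<xi>) \<le> 2 * real (card E)" by (simp add: mult.assoc flip: exp_add)
  have E\<Gamma>: "E \<subseteq> \<Gamma>"
  proof
    fix z assume z: "z \<in> E"
    have "entries j \<Omega> z \<in> Y j" if j: "j < 3" for j
    proof -
      have "g \<omega> j (entry j (z \<omega>)) > 0" if "\<omega> \<in> \<Omega>" for \<omega>
      proof -
        have "w \<omega> (z \<omega>) > 0" using z that by (simp add: E_def)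
        then have "cycle_weight (g \<omega>) (z \<omega>) \<noteq> 0" by (simp add: w_def)
        then have "g \<omega> j (entry j (z \<omega>)) \<noteq> 0" using j by (auto simp: cycle_weight_def)
        then show ?thesis using g[of \<omega> j "entry j (z \<omega>)"] by simp
      qed
      moreover have "(\<Sum>\<omega>\<in>\<Omega>. \<psi> j \<omega> (z \<omega>)) \<le> (\<Sum>\<omega>\<in>\<Omega>. \<mu> j \<omega>) + \<xi>" using z j by (simp add: E_def T_def)
      then have "(\<Sum>\<omega>\<in>\<Omega>. ln (g \<omega> j (entry j (z \<omega>)))) \<ge> e j - \<xi>"
        using j by (simp add: \<mu>1 \<psi>_def sum_negf)
      ultimately show ?thesis by (simp add: Y_def entries_def)
    qed
    then show "z \<in> \<Gamma>" using z by (simp add: \<Gamma>_def E_def T_def)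
  qed
  have \<Gamma>_lower: "exp (- h - 3 * \<xi>) \<le> pr z" if z: "z \<in> \<Gamma>" for z
  proof -
    have pos: "g \<omega> j (entry j (z \<omega>)) > 0" if "\<omega> \<in> \<Omega>" "j < 3" for \<omega> j
      using z that by (auto simp: \<Gamma>_def Y_def entries_def)
    have "(\<Sum>j<3. e j - \<xi>) \<le> (\<Sum>j<3. \<Sum>\<omega>\<in>\<Omega>. ln (g \<omega> j (entry j (z \<omega>))))"
      using z by (intro sum_mono) (auto simp: \<Gamma>_def Y_def entries_def)
    then have "- h - 3 * \<xi> \<le> (\<Sum>j<3. \<Sum>\<omega>\<in>\<Omega>. ln (g \<omega> j (entry j (z \<omega>))))"
      using sum_e by (simp add: sum_subtractf)
    also have "\<dots> = (\<Sum>\<omega>\<in>\<Omega>. \<Sum>j<3. ln (g \<omega> j (entry j (z \<omega>))))" by (rule sum.swap)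
    finally have "exp (- h - 3 * \<xi>) \<le> exp (\<Sum>\<omega>\<in>\<Omega>. \<Sum>j<3. ln (g \<omega> j (entry j (z \<omega>))))" by simp
    also have "\<dots> = (\<Prod>\<omega>\<in>\<Omega>. \<Prod>j<3. exp (ln (g \<omega> j (entry j (z \<omega>)))))" using \<Omega> by (simp add: exp_sum)
    also have "\<dots> = pr z" unfolding pr_def w_def cycle_weight_def using pos by (intro prod.cong refl exp_ln) auto
    finally show ?thesis .
  qed
  have deg: "real (card {z' \<in> \<Gamma>. entries j \<Omega> z' = entries j \<Omega> z}) \<le> exp (h - h' + 4 * \<xi>)"
    if z: "z \<in> E" and j: "j < 3" for z j
  proof -
    let ?D = "{z' \<in> \<Gamma>. entries j \<Omega> z' = entries j \<Omega> z}"
    let ?F = "PiE \<Omega> (\<lambda>\<omega>. {c. entry j c = entry j (z \<omega>)})"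
    have "real (card ?D) * exp (- h - 3 * \<xi>) = (\<Sum>z'\<in>?D. exp (- h - 3 * \<xi>))" by simp
    also have "\<dots> \<le> (\<Sum>z'\<in>?D. pr z')" using \<Gamma>_lower by (intro sum_mono) simp
    also have "\<dots> \<le> (\<Sum>z'\<in>?F. pr z')"
    proof (rule sum_mono2)
      show "finite ?F" using \<Omega> by (intro finite_PiE) auto
      show "?D \<subseteq> ?F" by (auto simp: \<Gamma>_def entries_eq_iff PiE_iff extensional_def)
    qed (rule prnn)
    also have "\<dots> = (\<Prod>\<omega>\<in>\<Omega>. \<Sum>c | entry j c = entry j (z \<omega>). w \<omega> c)"
      unfolding pr_def using \<Omega> by (intro prod_sum_PiE[symmetric]) auto
    also have "\<dots> = (\<Prod>\<omega>\<in>\<Omega>. P \<omega> j (entry j (z \<omega>)))"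
      by (simp add: P_def cycle_marginal_def w_def)
    also have "\<dots> = exp (\<Sum>\<omega>\<in>\<Omega>. ln (P \<omega> j (entry j (z \<omega>))))"
    proof -
      have "P \<omega> j (entry j (z \<omega>)) > 0" if "\<omega> \<in> \<Omega>" for \<omega>
      proof -
        have "0 < w \<omega> (z \<omega>)" using z that by (simp add: E_def)
        also have "\<dots> \<le> P \<omega> j (entry j (z \<omega>))"
          unfolding P_def cycle_marginal_def w_def
          using wnn by (intro member_le_sum) (auto simp: w_def)
        finally show ?thesis .
      qed
      then show ?thesis using \<Omega> by (simp add: exp_sum)
    qed
    also have "\<dots> \<le> exp (- h' + \<xi>)"
    proof -
      have "(\<Sum>\<omega>\<in>\<Omega>. \<psi> (j + 3) \<omega> (z \<omega>)) \<le> (\<Sum>\<omega>\<in>\<Omega>. \<mu> (j + 3) \<omega>) + \<xi>" using z j by (simp add: E_def T_def)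
      also have "\<dots> \<le> - h' + \<xi>" using \<mu>2[OF j] by simp
      finally show ?thesis using j by (simp add: \<psi>_def)
    qed
    finally have "real (card ?D) * exp (- h - 3 * \<xi>) * exp (h + 3 * \<xi>) \<le> exp (- h' + \<xi>) * exp (h + 3 * \<xi>)"
      by (intro mult_right_mono) auto
    moreover have "exp (- h - 3 * \<xi>) * exp (h + 3 * \<xi>) = 1" by (simp flip: exp_add)
    moreover have "exp (- h' + \<xi>) * exp (h + 3 * \<xi>) = exp (h - h' + 4 * \<xi>)"
      unfolding exp_add[symmetric] by (simp add: algebra_simps)
    ultimately show ?thesis by (simp add: mult.assoc)
  qed
  have "real (card E) * real CARD('a) ^ (2 * d)
    \<le> 6 * real (card (low_exponents CARD('a) d)) * (real CARD('a ^ 'n) ^ card \<Omega>)\<^sup>2"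
    by (rule isolated_cycles_bound[OF \<Omega> \<Gamma>_def E\<Gamma> deg d])
  moreover have "exp (h - \<xi>) * real CARD('a) ^ (2 * d) \<le> 2 * real (card E) * real CARD('a) ^ (2 * d)"
    using cardE by (intro mult_right_mono) auto
  ultimately show ?thesis by linarith
qed

text \<open>Termwise from ln t \<le> t - 1. Left unnormalised, so that it covers any total mass and
  a comparison weight of smaller mass; \<open>Q\<close> may vanish where \<open>P\<close>
  does.\<close>

lemma gibbs:
  fixes P Q :: "'c \<Rightarrow> real"
  assumes "finite A"
    and "\<And>x. x \<in> A \<Longrightarrow> P x \<ge> 0" "\<And>x. x \<in> A \<Longrightarrow> Q x \<ge> 0"
    and "\<And>x. x \<in> A \<Longrightarrow> P x > 0 \<Longrightarrow> Q x > 0"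
    and "sum Q A \<le> sum P A"
  shows "(\<Sum>x\<in>A. P x * ln (Q x)) \<le> (\<Sum>x\<in>A. P x * ln (P x))"
proof -
  have "(\<Sum>x\<in>A. P x * ln (Q x) - P x * ln (P x)) \<le> (\<Sum>x\<in>A. Q x - P x)"
  proof (rule sum_mono)
    fix x assume x: "x \<in> A"
    show "P x * ln (Q x) - P x * ln (P x) \<le> Q x - P x"
    proof (cases "P x = 0")
      case False
      then have pos: "P x > 0" "Q x > 0" using assms x by (auto simp: less_le)
      have "P x * ln (Q x / P x) \<le> P x * (Q x / P x - 1)"
        using pos by (intro mult_left_mono ln_le_minus_one) auto
      then show ?thesis using pos by (simp add: ln_div right_diff_distrib)
    qed (use assms x in auto)
  qed
  then show ?thesis using assms by (simp add: sum_subtractf)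
qed

lemma entropy_le_ln_card:
  fixes P :: "'c::finite \<Rightarrow> real"
  assumes "\<And>x. P x \<ge> 0" "sum P UNIV = 1"
  shows "entropy P \<le> ln (real CARD('c))"
proof -
  have "(\<Sum>x\<in>UNIV. P x * ln (1 / real CARD('c))) \<le> (\<Sum>x\<in>UNIV. P x * ln (P x))"
    using assms by (intro gibbs) auto
  moreover have "(\<Sum>x\<in>UNIV. P x * ln (1 / real CARD('c))) = - ln (real CARD('c))"
    using assms by (simp only: sum_distrib_right[symmetric]) (simp add: ln_div)
  ultimately show ?thesis by (simp add: entropy_def)
qed

section \<open>Rotating the three roles\<close>

definition shift_roles :: "nat \<Rightarrow> (nat \<Rightarrow> 'b) \<Rightarrow> nat \<Rightarrow> 'b" where
  "shift_roles r f j = f ((j + r) mod 3)"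

definition rotate_cycle :: "'v::ab_group_add \<times> 'v \<Rightarrow> 'v \<times> 'v" where
  "rotate_cycle c = (entry 1 c, entry 2 c)"

lemma entry_rotate_cycle: "j < 3 \<Longrightarrow> entry j (rotate_cycle c) = entry (Suc j mod 3) c"
  by (auto simp: less_3_cases rotate_cycle_def entry_def)

lemma bij_rotate_cycle: "bij rotate_cycle"
  by (rule bij_betwI[where g = "\<lambda>c. (- fst c - snd c, fst c)"]) (auto simp: rotate_cycle_def)

lemma prod_less_3: "(\<Prod>j<(3::nat). G j) = G 0 * G 1 * (G 2 :: 'b::comm_monoid_mult)"
  by (simp only: numeral_3_eq_3 numeral_2_eq_2 One_nat_def prod.lessThan_Suc) simp

lemma cycle_weight_rotate: "cycle_weight (shift_roles (Suc 0) f) (rotate_cycle c) = cycle_weight f c"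
  by (simp add: cycle_weight_def prod_less_3 shift_roles_def entry_rotate_cycle mult_ac numeral_2_eq_2)

lemma sum_cycle_weight_rotate:
  "(\<Sum>c\<in>UNIV. \<phi> (cycle_weight (shift_roles (Suc 0) f) c)) = (\<Sum>c\<in>UNIV. \<phi> (cycle_weight f c))"
  using sum.reindex_bij_betw[OF bij_rotate_cycle, of "\<lambda>c. \<phi> (cycle_weight (shift_roles (Suc 0) f) c)"]
  by (simp add: cycle_weight_rotate)

lemma cycle_marginal_rotate:
  assumes "j < 3"
  shows "cycle_marginal (shift_roles (Suc 0) f) j x = cycle_marginal f (Suc j mod 3) x"
proof -
  have "bij_betw rotate_cycle {c. entry (Suc j mod 3) c = x} {c. entry j c = x}"
    unfolding bij_betw_def
  proof
    show "inj_on rotate_cycle {c. entry (Suc j mod 3) c = x}"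
      using bij_rotate_cycle by (auto simp: bij_def intro: inj_on_subset)
    show "rotate_cycle ` {c. entry (Suc j mod 3) c = x} = {c. entry j c = x}"
    proof (intro subset_antisym subsetI)
      fix c assume c: "c \<in> {c. entry j c = x}"
      obtain c' where "c = rotate_cycle c'" using surjD[OF bij_is_surj[OF bij_rotate_cycle], of c] by blast
      then show "c \<in> rotate_cycle ` {c. entry (Suc j mod 3) c = x}" using c entry_rotate_cycle[OF assms, of c'] by auto
    qed (use entry_rotate_cycle[OF assms] in auto)
  qed
  from sum.reindex_bij_betw[OF this, of "cycle_weight (shift_roles (Suc 0) f)"] show ?thesis
    by (simp add: cycle_marginal_def cycle_weight_rotate)
qed

lemma shift_roles_Suc: "shift_roles (Suc r) f = shift_roles (Suc 0) (shift_roles r f)"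
  by (auto simp: shift_roles_def fun_eq_iff mod_simps)

lemma shift_roles_0: "j < 3 \<Longrightarrow> shift_roles 0 f j = f j"
  by (simp add: shift_roles_def)

lemma sum_cycle_weight_rotate_iterated:
  "(\<Sum>c\<in>UNIV. \<phi> (cycle_weight (shift_roles r f) c)) = (\<Sum>c\<in>UNIV. \<phi> (cycle_weight f c))"
proof (induction r)
  case 0
  then show ?case by (simp add: cycle_weight_def shift_roles_0)
next
  case (Suc r)
  then show ?case unfolding shift_roles_Suc[of r f] sum_cycle_weight_rotate .
qed

text \<open>Lets a single bound on the logarithms of the cycle weights serve all rotations.\<close>

lemma cycle_weight_rotate_range: "\<exists>c'. cycle_weight (shift_roles r f) c = cycle_weight f c'"
proof (induction r arbitrary: c)
  case 0
  show ?case by (rule exI[of _ c]) (simp add: cycle_weight_def shift_roles_0)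
next
  case (Suc r)
  obtain c' where "c = rotate_cycle c'" using surjD[OF bij_is_surj[OF bij_rotate_cycle], of c] by blast
  then show ?case using Suc[of c'] unfolding shift_roles_Suc[of r f] by (simp only: cycle_weight_rotate)
qed

lemma cycle_marginal_rotate_iterated:
  assumes "j < 3"
  shows "cycle_marginal (shift_roles r f) j = cycle_marginal f ((j + r) mod 3)"
  using assms
proof (induction r arbitrary: j)
  case 0
  then show ?case by (auto simp: fun_eq_iff cycle_marginal_def cycle_weight_def shift_roles_0)
next
  case (Suc r)
  have "cycle_marginal (shift_roles (Suc r) f) j = cycle_marginal (shift_roles r f) (Suc j mod 3)"
    unfolding shift_roles_Suc[of r f] using cycle_marginal_rotate[OF Suc.prems] by (rule ext)
  also have "\<dots> = cycle_marginal f ((Suc j mod 3 + r) mod 3)" by (rule Suc.IH) simp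
  also have "(Suc j mod 3 + r) mod 3 = (j + Suc r) mod 3" by (simp add: mod_add_left_eq)
  finally show ?case .
qed

text \<open>Three consecutive numbers represent all residues. With \<open>H\<close> the marginal
  entropies, this gives all three roles the same entropy over the tensor power, whatever the
  starting role \<open>j\<close>.\<close>

lemma sum_mod_3:
  fixes H :: "nat \<Rightarrow> real"
  shows "(\<Sum>\<omega><3 * M. H ((j + \<omega>) mod 3)) = real M * (\<Sum>r<3. H r)"
proof (induction M)
  case (Suc M)
  define G where "G \<omega> = H ((j + \<omega>) mod 3)" for \<omega>
  have three: "(\<Sum>r<3. H r) = H 0 + H 1 + H 2"
    by (simp only: numeral_3_eq_3 numeral_2_eq_2 One_nat_def sum.lessThan_Suc) simp
  have "3 * Suc M = Suc (Suc (Suc (3 * M)))" by simp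
  then have "sum G {..<3 * Suc M} = sum G {..<3 * M} + (G (3 * M) + G (Suc (3 * M)) + G (Suc (Suc (3 * M))))"
    by (simp only: sum.lessThan_Suc add.assoc)
  moreover have "G (3 * M) + G (Suc (3 * M)) + G (Suc (Suc (3 * M))) = (\<Sum>r<3. H r)"
  proof -
    have shift: "(j + (i + 3 * M)) mod 3 = (j mod 3 + i) mod 3" for i
    proof -
      have "(j + (i + 3 * M)) mod 3 = (j + i + M * 3) mod 3" by (simp add: ac_simps)
      also have "\<dots> = (j mod 3 + i) mod 3" by (simp only: mod_mult_self1 mod_add_left_eq)
      finally show ?thesis .
    qed
    have "G (3 * M) = H ((j mod 3 + 0) mod 3)" "G (Suc (3 * M)) = H ((j mod 3 + 1) mod 3)"
      "G (Suc (Suc (3 * M))) = H ((j mod 3 + 2) mod 3)"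
      using shift[of 0] shift[of 1] shift[of 2] by (simp_all add: G_def)
    moreover have "j mod 3 < 3" by simp
    then have "j mod 3 = 0 \<or> j mod 3 = 1 \<or> j mod 3 = 2" by (simp only: less_3_cases)
    ultimately show ?thesis unfolding three by (elim disjE) (simp_all add: numeral_2_eq_2)
  qed
  ultimately show ?case using Suc.IH by (simp add: G_def distrib_right)
qed simp

text \<open>Compare exponents in \<open>typical_cycles_bound\<close> per coordinate, in the limit.
  With H the triangle entropy, T the sum of the marginal entropies and \<delta> = L - H + T/3 the
  room for d ln q, it reads H + 2\<delta> \<le> (1 - cc) \<delta> + 2L. That is \<open>X\<close>
  \<le> 0 below, a rearrangement of the claim.\<close>

theorem triangle_entropy_bound:
  fixes f :: "nat \<Rightarrow> 'a::{field,finite} ^ 'n \<Rightarrow> real"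
  assumes f: "\<And>j x. f j x \<ge> 0"
    and total: "(\<Sum>c\<in>UNIV. cycle_weight f c) = 1"
    and cc: "0 \<le> cc" "cc \<le> 1"
    and low: "\<And>d. real (card (low_exponents CARD('a) d)) \<le> (real CARD('a) powr (1 - cc)) ^ d"
    and L: "L = ln (real CARD('a ^ 'n))"
  shows "cc * (2 * L - entropy (cycle_weight f)) \<le> (1 + cc) * (L - (\<Sum>j<3. entropy (cycle_marginal f j)) / 3)"
proof -
  define H where "H = entropy (cycle_weight f)"
  define T where "T = (\<Sum>j<3. entropy (cycle_marginal f j))"
  define q where "q = real CARD('a)"
  have "card {0, 1::'a} \<le> CARD('a)" by (intro card_mono) auto
  then have q: "q \<ge> 2" by (simp add: q_def)
  have lq: "ln q > 0" using q by simp
  have expL: "real CARD('a ^ 'n) = exp L" by (simp add: L)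
  have H2L: "H \<le> 2 * L"
  proof -
    have "H \<le> ln (real CARD(('a ^ 'n) \<times> ('a ^ 'n)))"
      unfolding H_def using f total by (intro entropy_le_ln_card cycle_weight_nonneg)
    also have "\<dots> = 2 * L" by (simp add: L ln_mult)
    finally show ?thesis .
  qed
  define S where "S \<phi> = (\<Sum>j<3. \<Sum>x\<in>UNIV. \<bar>\<phi> j x\<bar>)" for \<phi> :: "nat \<Rightarrow> 'a ^ 'n \<Rightarrow> real"
  define S' where "S' = (\<Sum>c\<in>UNIV. \<bar>ln (cycle_weight f c)\<bar>)"
  \<comment> \<open>A crude common bound for all logarithms: there are finitely many arguments, and
    \<open>ln\<close> has some value at 0 too. The summand 1 keeps \<open>B\<close> away from
    0.\<close>
  define B where "B = 1 + S (\<lambda>j x. ln (f j x)) + S (\<lambda>j x. ln (cycle_marginal f j x)) + S'"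
  have S: "S \<phi> \<ge> 0" "S' \<ge> 0" for \<phi> by (auto simp: S_def S'_def intro!: sum_nonneg)
  have B: "B \<ge> 1" using S by (simp add: B_def)
  have S_ge: "\<bar>\<phi> j x\<bar> \<le> S \<phi>" if "j < 3" for \<phi> :: "nat \<Rightarrow> 'a ^ 'n \<Rightarrow> real" and j x
  proof -
    have "\<bar>\<phi> j x\<bar> \<le> (\<Sum>x\<in>UNIV. \<bar>\<phi> j x\<bar>)" by (rule member_le_sum) auto
    also have "\<dots> \<le> S \<phi>" unfolding S_def using that by (intro member_le_sum) (auto intro!: sum_nonneg)
    finally show ?thesis .
  qed
  have B1: "\<bar>ln (f j x)\<bar> \<le> B" if "j < 3" for j x
    by (rule order_trans[OF S_ge[OF that, of "\<lambda>j x. ln (f j x)"]]) (use S in \<open>simp add: B_def\<close>)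
  have B2: "\<bar>ln (cycle_marginal f j x)\<bar> \<le> B" if "j < 3" for j x
    by (rule order_trans[OF S_ge[OF that, of "\<lambda>j x. ln (cycle_marginal f j x)"]]) (use S in \<open>simp add: B_def\<close>)
  have B3: "\<bar>ln (cycle_weight f c)\<bar> \<le> B" for c
  proof -
    have "\<bar>ln (cycle_weight f c)\<bar> \<le> S'" unfolding S'_def by (rule member_le_sum) auto
    then show ?thesis using S(1)[of "\<lambda>j x. ln (f j x)"] S(1)[of "\<lambda>j x. ln (cycle_marginal f j x)"]
      unfolding B_def by linarith
  qed
  define X where "X = (H - 2 * L) + (1 + cc) * (L - H + T / 3)"
  define K where "K = ln 12 + (1 + cc) * (ln q + ln 6)"
  have "X \<le> 10 * \<eta>" if \<eta>: "\<eta> > 0" for \<eta> :: real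
  proof -
    \<comment> \<open>The first bound is required by the concentration estimate; the second makes
      its quadratic term at most half of the linear one.\<close>
    define s where "s = min (1 / (2 * B)) (\<eta> / (8 * B\<^sup>2))"
    have s: "s > 0" "s * (2 * B) \<le> 1" "s * (8 * B\<^sup>2) \<le> \<eta>"
      using \<eta> B by (auto simp: s_def min_def field_simps)
    \<comment> \<open>The first term pushes the exponent down to -13, enough for 7 exp(-13) \<le>
      1/2; the second absorbs the constant \<open>K\<close>; the 1 makes \<open>M\<close>
      positive.\<close>
    obtain M :: nat where M: "real M \<ge> 26 / (3 * s * \<eta>) + K / (3 * \<eta>) + 1"
      using real_arch_simple by blast
    have Kpos: "K \<ge> 0" using cc lq by (simp add: K_def)
    have Mpos: "M > 0" and M1: "real M \<ge> 26 / (3 * s * \<eta>)" and M2: "real M \<ge> K / (3 * \<eta>)"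
    proof -
      have "26 / (3 * s * \<eta>) \<ge> 0" "K / (3 * \<eta>) \<ge> 0" using s \<eta> Kpos by auto
      with M show "M > 0" "real M \<ge> 26 / (3 * s * \<eta>)" "real M \<ge> K / (3 * \<eta>)" by linarith+
    qed
    define \<Omega> where "\<Omega> = {..<3 * M}"
    define \<xi> where "\<xi> = 3 * real M * \<eta>"
    define g where "g \<omega> = shift_roles \<omega> f" for \<omega>
    have card\<Omega>: "real (card \<Omega>) = 3 * real M" by (simp add: \<Omega>_def)
    have small: "7 * exp (real (card \<Omega>) * (s\<^sup>2 * (2 * B)\<^sup>2) - s * \<xi>) \<le> 1 / 2"
    proof -
      have "real (card \<Omega>) * (s\<^sup>2 * (2 * B)\<^sup>2) - s * \<xi> = 3 * real M * s * ((s * (8 * B\<^sup>2)) / 2 - \<eta>)"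
        by (simp add: card\<Omega> \<xi>_def power2_eq_square algebra_simps)
      also have "\<dots> \<le> 3 * real M * s * (\<eta> / 2 - \<eta>)" using s by (intro mult_left_mono) auto
      also have "\<dots> \<le> - 13" using M1 s \<eta> by (simp add: field_simps)
      finally have "exp (real (card \<Omega>) * (s\<^sup>2 * (2 * B)\<^sup>2) - s * \<xi>) \<le> exp (- 13)" by simp
      also have "\<dots> \<le> 1 / 14" using exp_ge_add_one_self[of 13] by (simp add: exp_minus field_simps)
      finally show ?thesis by simp
    qed
    define h where "h = 3 * real M * H"
    define h' where "h' = real M * T"
    have hsum: "h = (\<Sum>\<omega>\<in>\<Omega>. entropy (cycle_weight (g \<omega>)))"
      by (simp add: h_def H_def g_def entropy_def sum_cycle_weight_rotate_iterated[where \<phi> = "\<lambda>w. w * ln w"] \<Omega>_def)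
    have h'sum: "h' = (\<Sum>\<omega>\<in>\<Omega>. entropy (cycle_marginal (g \<omega>) j))" if "j < 3" for j
      using that sum_mod_3[of "\<lambda>r. entropy (cycle_marginal f r)" j M]
      by (simp add: h'_def T_def g_def cycle_marginal_rotate_iterated \<Omega>_def)
    \<comment> \<open>The logarithm of the largest admissible value of q^d.\<close>
    define D where "D = 3 * real M * L - (h - h') - 4 * \<xi> - ln 6"
    have main: "(h - 6 * real M * L) + (1 + cc) * D \<le> \<xi> + ln 12 + (1 + cc) * ln q"
    proof (cases "D \<ge> 0")
      \<comment> \<open>With no room for any \<open>d\<close>, the inequality follows from
        \<open>H\<close> \<le> 2 * \<open>L\<close> alone.\<close>
      case False
      have "h - 6 * real M * L = 3 * real M * (H - 2 * L)" by (simp add: h_def algebra_simps)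
      also have "\<dots> \<le> 0" using H2L by (simp add: mult_le_0_iff)
      finally have "h - 6 * real M * L \<le> 0" .
      moreover have "(1 + cc) * D \<le> 0" using False cc by (simp add: mult_le_0_iff)
      moreover have "\<xi> \<ge> 0" "ln (12::real) \<ge> 0" "(1 + cc) * ln q \<ge> 0" using \<eta> cc lq by (auto simp: \<xi>_def)
      ultimately show ?thesis by linarith
    next
      case True
      \<comment> \<open>Rounding down loses at most one \<open>ln q\<close>, which is accounted for
        in \<open>K\<close>.\<close>
      define d where "d = nat \<lfloor>D / ln q\<rfloor>"
      have "real d \<le> D / ln q" "D / ln q \<le> real d + 1" using True lq by (auto simp: d_def)
      then have d: "real d * ln q \<le> D" "D \<le> real d * ln q + ln q" using lq by (auto simp: field_simps)
      have qd: "q ^ d = exp (real d * ln q)" using q by (simp add: exp_of_nat_mult)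
      have "6 * exp (h - h' + 4 * \<xi>) * q ^ d = exp (ln 6 + (h - h' + 4 * \<xi>) + real d * ln q)"
        by (simp add: exp_add qd)
      also have "\<dots> \<le> exp (3 * real M * L)" using d(1) by (simp add: D_def)
      also have "\<dots> = real CARD('a ^ 'n) ^ card \<Omega>" unfolding expL by (simp add: \<Omega>_def flip: exp_of_nat_mult)
      finally have small_d: "6 * exp (h - h' + 4 * \<xi>) * real CARD('a) ^ d \<le> real CARD('a ^ 'n) ^ card \<Omega>"
        by (simp add: q_def)
      have "exp (h - \<xi>) * real CARD('a) ^ (2 * d)
          \<le> 12 * real (card (low_exponents CARD('a) d)) * (real CARD('a ^ 'n) ^ card \<Omega>)\<^sup>2"
      proof (rule typical_cycles_bound[where g = g and B = B and s = s and h' = h'])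
        show "finite \<Omega>" by (simp add: \<Omega>_def)
        show "g \<omega> j x \<ge> 0" for \<omega> j x by (simp add: g_def shift_roles_def f)
        show "(\<Sum>c\<in>UNIV. cycle_weight (g \<omega>) c) = 1" for \<omega>
          using total sum_cycle_weight_rotate_iterated[of "\<lambda>w. w" \<omega> f] by (simp add: g_def)
        show "\<bar>ln (g \<omega> j x)\<bar> \<le> B" for \<omega> j x using B1[of "(j + \<omega>) mod 3" x] by (simp add: g_def shift_roles_def)
        show "\<bar>ln (cycle_marginal (g \<omega>) j x)\<bar> \<le> B" if "j < 3" for \<omega> j x
          using B2[of "(j + \<omega>) mod 3" x] that by (simp add: g_def cycle_marginal_rotate_iterated)
        show "\<bar>ln (cycle_weight (g \<omega>) c)\<bar> \<le> B" for \<omega> c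
          using cycle_weight_rotate_range[of \<omega> f c] B3 by (auto simp: g_def)
        show "h' \<le> (\<Sum>\<omega>\<in>\<Omega>. entropy (cycle_marginal (g \<omega>) j))" if "j < 3" for j using h'sum[OF that] by simp
      qed (use s small hsum small_d in auto)
      also have "\<dots> \<le> 12 * (q powr (1 - cc)) ^ d * (real CARD('a ^ 'n) ^ card \<Omega>)\<^sup>2"
        using low[of d] by (intro mult_right_mono mult_left_mono) (auto simp: q_def)
      also have "(real CARD('a ^ 'n) ^ card \<Omega>)\<^sup>2 = exp (6 * real M * L)"
        unfolding expL by (simp add: \<Omega>_def flip: exp_of_nat_mult exp_double)
      also have "(q powr (1 - cc)) ^ d = exp ((1 - cc) * real d * ln q)"
        using q by (simp add: powr_def mult_ac flip: exp_of_nat_mult)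
      also have "12 * exp ((1 - cc) * real d * ln q) * exp (6 * real M * L)
          = exp (ln 12 + (1 - cc) * real d * ln q + 6 * real M * L)" by (simp add: exp_add)
      also have "real CARD('a) ^ (2 * d) = exp (2 * (real d * ln q))"
        using qd by (simp add: power_mult power2_eq_square q_def power_mult_distrib flip: exp_add)
      finally have "h - \<xi> + 2 * (real d * ln q) \<le> ln 12 + (1 - cc) * real d * ln q + 6 * real M * L"
        by (simp flip: exp_add)
      then have "h - 6 * real M * L + (1 + cc) * (real d * ln q) \<le> \<xi> + ln 12" by (simp add: algebra_simps)
      moreover have "(1 + cc) * D \<le> (1 + cc) * (real d * ln q + ln q)" using d(2) cc by (intro mult_left_mono) auto
      ultimately show ?thesis by (simp add: algebra_simps)
    qed
    \<comment> \<open>Typicality costs 9\<xi> = 27 M \<eta> and \<open>K\<close> at most 3 M \<eta>,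
      together 3 M times 10\<eta>.\<close>
    have "3 * real M * X = (h - 6 * real M * L) + (1 + cc) * (3 * real M * L - (h - h'))"
      by (simp add: X_def h_def h'_def algebra_simps)
    also have "\<dots> \<le> \<xi> + K + (1 + cc) * (4 * \<xi>)" using main by (simp add: D_def K_def algebra_simps)
    also have "\<dots> \<le> \<xi> + K + 2 * (4 * \<xi>)" using cc \<eta> by (intro add_left_mono mult_right_mono) (auto simp: \<xi>_def)
    also have "\<dots> = 27 * real M * \<eta> + K" by (simp add: \<xi>_def)
    also have "K \<le> 3 * real M * \<eta>" using M2 \<eta> by (simp add: field_simps)
    finally have "3 * real M * X \<le> 3 * real M * (10 * \<eta>)" by simp
    then show "X \<le> 10 * \<eta>" using Mpos by simp
  qed
  \<comment> \<open>For \<eta> = X / 20 a positive \<open>X\<close> would be at most X / 2.\<close>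
  from this[of "X / 20"] have "X \<le> 0" by (cases "X > 0") auto
  then show ?thesis by (simp add: X_def H_def T_def algebra_simps)
qed

subsection \<open>Submodularity\<close>

lemma sum_UNIV_translate:
  fixes F :: "'v::{ab_group_add,finite} \<Rightarrow> 'b::comm_monoid_add"
  shows "(\<Sum>x\<in>UNIV. F (x - a)) = (\<Sum>x\<in>UNIV. F x)"
  by (rule sum.reindex_bij_witness[of _ "\<lambda>x. x + a" "\<lambda>x. x - a"]) auto

lemma sum_UNIV_uminus:
  fixes F :: "'v::{ab_group_add,finite} \<Rightarrow> 'b::comm_monoid_add"
  shows "(\<Sum>x\<in>UNIV. F (- x)) = (\<Sum>x\<in>UNIV. F x)"
  by (rule sum.reindex_bij_witness[of _ uminus uminus]) auto

lemma sum_UNIV_reflect: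
  fixes F :: "'v::{ab_group_add,finite} \<Rightarrow> 'b::comm_monoid_add"
  shows "(\<Sum>x\<in>UNIV. F (a - x)) = (\<Sum>x\<in>UNIV. F x)"
  by (rule sum.reindex_bij_witness[of _ "\<lambda>x. a - x" "\<lambda>x. a - x"]) auto

lemma entropy_uminus:
  fixes P :: "'v::{ab_group_add,finite} \<Rightarrow> real"
  shows "entropy (\<lambda>x. P (- x)) = entropy P"
  unfolding entropy_def using sum_UNIV_uminus[of "\<lambda>x. P x * ln (P x)"] by simp

definition convolve :: "('v::{ab_group_add,finite} \<Rightarrow> real) \<Rightarrow> ('v \<Rightarrow> real) \<Rightarrow> 'v \<Rightarrow> real" where
  "convolve g h w = (\<Sum>x\<in>UNIV. g x * h (w - x))"

lemma convolve_nonneg: "(\<And>x. g x \<ge> 0) \<Longrightarrow> (\<And>x. h x \<ge> 0) \<Longrightarrow> convolve g h w \<ge> 0"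
  by (simp add: convolve_def sum_nonneg)

lemma convolve_ge:
  assumes "\<And>x. g x \<ge> 0" "\<And>x. h x \<ge> 0"
  shows "g x * h (w - x) \<le> convolve g h w"
  unfolding convolve_def using assms by (intro member_le_sum) auto

lemma convolve_pos:
  assumes "\<And>x. g x \<ge> 0" "\<And>x. h x \<ge> 0" "g u > 0" "h v > 0"
  shows "convolve g h (u + v) > 0"
proof -
  have "0 < g u * h (u + v - u)" using assms by simp
  also have "\<dots> \<le> convolve g h (u + v)" by (rule convolve_ge[OF assms(1,2)])
  finally show ?thesis .
qed

lemma convolve_commute: "convolve g h = convolve h g"
proof
  fix w
  show "convolve g h w = convolve h g w"
    unfolding convolve_def using sum_UNIV_reflect[of "\<lambda>x. h x * g (w - x)" w] by (simp add: mult.commute)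
qed

lemma convolve_assoc: "convolve (convolve f g) h = convolve f (convolve g h)"
proof
  fix w
  have "convolve (convolve f g) h w = (\<Sum>y\<in>UNIV. \<Sum>x\<in>UNIV. f x * g (y - x) * h (w - y))"
    by (simp add: convolve_def sum_distrib_right)
  also have "\<dots> = (\<Sum>x\<in>UNIV. \<Sum>y\<in>UNIV. f x * g (y - x) * h (w - y))" by (rule sum.swap)
  also have "\<dots> = (\<Sum>x\<in>UNIV. \<Sum>y\<in>UNIV. f x * g y * h (w - x - y))"
  proof (rule sum.cong[OF refl])
    fix x
    show "(\<Sum>y\<in>UNIV. f x * g (y - x) * h (w - y)) = (\<Sum>y\<in>UNIV. f x * g y * h (w - x - y))"
      using sum_UNIV_translate[of "\<lambda>y. f x * g y * h (w - x - y)" x] by (simp add: algebra_simps)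
  qed
  also have "\<dots> = convolve f (convolve g h) w" by (simp add: convolve_def sum_distrib_left mult.assoc)
  finally show "convolve (convolve f g) h w = convolve f (convolve g h) w" .
qed

lemma convolve_left_commute: "convolve f (convolve g h) = convolve g (convolve f h)"
  by (metis convolve_assoc convolve_commute)

lemmas convolve_ac = convolve_assoc convolve_commute convolve_left_commute

section \<open>Submodularity for four summands with sum zero\<close>

definition quad_weight :: "('v::{ab_group_add,finite} \<Rightarrow> real) \<Rightarrow> ('v \<Rightarrow> real) \<Rightarrow> ('v \<Rightarrow> real) \<Rightarrow> ('v \<Rightarrow> real)
    \<Rightarrow> 'v \<Rightarrow> 'v \<Rightarrow> 'v \<Rightarrow> real" where
  "quad_weight g1 g2 g3 g4 a b c = g1 a * g2 b * g3 c * g4 (- a - b - c)"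

lemma quad_sum_first:
  "(\<Sum>a\<in>UNIV. \<Sum>b\<in>UNIV. \<Sum>c\<in>UNIV. quad_weight g1 g2 g3 g4 a b c * \<phi> a)
    = (\<Sum>a\<in>UNIV. g1 a * convolve g2 (convolve g3 g4) (- a) * \<phi> a)"
  by (simp add: quad_weight_def convolve_def sum_distrib_left sum_distrib_right mult_ac)

lemma quad_sum_pair:
  "(\<Sum>a\<in>UNIV. \<Sum>b\<in>UNIV. \<Sum>c\<in>UNIV. quad_weight g1 g2 g3 g4 a b c * \<phi> (a + b))
    = (\<Sum>w\<in>UNIV. convolve g1 g2 w * convolve g3 g4 (- w) * \<phi> w)"
proof -
  have "(\<Sum>a\<in>UNIV. \<Sum>b\<in>UNIV. \<Sum>c\<in>UNIV. quad_weight g1 g2 g3 g4 a b c * \<phi> (a + b))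
      = (\<Sum>a\<in>UNIV. \<Sum>b\<in>UNIV. g1 a * g2 b * convolve g3 g4 (- (a + b)) * \<phi> (a + b))"
    by (simp add: quad_weight_def convolve_def sum_distrib_left sum_distrib_right mult_ac)
  also have "\<dots> = (\<Sum>a\<in>UNIV. \<Sum>w\<in>UNIV. g1 a * g2 (w - a) * convolve g3 g4 (- w) * \<phi> w)"
  proof (rule sum.cong[OF refl])
    fix a
    show "(\<Sum>b\<in>UNIV. g1 a * g2 b * convolve g3 g4 (- (a + b)) * \<phi> (a + b))
        = (\<Sum>w\<in>UNIV. g1 a * g2 (w - a) * convolve g3 g4 (- w) * \<phi> w)"
      using sum_UNIV_translate[of "\<lambda>b. g1 a * g2 b * convolve g3 g4 (- (a + b)) * \<phi> (a + b)" a] by simp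
  qed
  also have "\<dots> = (\<Sum>w\<in>UNIV. \<Sum>a\<in>UNIV. g1 a * g2 (w - a) * convolve g3 g4 (- w) * \<phi> w)" by (rule sum.swap)
  also have "\<dots> = (\<Sum>w\<in>UNIV. convolve g1 g2 w * convolve g3 g4 (- w) * \<phi> w)"
    by (simp add: convolve_def[of g1 g2] sum_distrib_right)
  finally show ?thesis .
qed

lemma quad_sum_swap:
  "(\<Sum>a\<in>UNIV. \<Sum>b\<in>UNIV. \<Sum>c\<in>UNIV. quad_weight g1 g2 g3 g4 a b c * \<Phi> a b c)
    = (\<Sum>a\<in>UNIV. \<Sum>b\<in>UNIV. \<Sum>c\<in>UNIV. quad_weight g1 g3 g2 g4 a b c * \<Phi> a c b)"
proof (rule sum.cong[OF refl])
  fix a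
  have "(\<Sum>b\<in>UNIV. \<Sum>c\<in>UNIV. quad_weight g1 g2 g3 g4 a b c * \<Phi> a b c)
      = (\<Sum>c\<in>UNIV. \<Sum>b\<in>UNIV. quad_weight g1 g2 g3 g4 a b c * \<Phi> a b c)" by (rule sum.swap)
  then show "(\<Sum>b\<in>UNIV. \<Sum>c\<in>UNIV. quad_weight g1 g2 g3 g4 a b c * \<Phi> a b c)
      = (\<Sum>b\<in>UNIV. \<Sum>c\<in>UNIV. quad_weight g1 g3 g2 g4 a b c * \<Phi> a c b)"
    by (simp add: quad_weight_def algebra_simps)
qed

text \<open>Exchanges the first entry with the dependent one, so that facts about the first entry
  transfer to -a - b - c.\<close>

lemma quad_sum_reverse:
  "(\<Sum>a\<in>UNIV. \<Sum>b\<in>UNIV. \<Sum>c\<in>UNIV. quad_weight g1 g2 g3 g4 a b c * \<Phi> a b c)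
    = (\<Sum>a\<in>UNIV. \<Sum>b\<in>UNIV. \<Sum>c\<in>UNIV. quad_weight g4 g2 g3 g1 a b c * \<Phi> (- a - b - c) b c)"
proof -
  have rot: "(\<Sum>a\<in>UNIV. \<Sum>b\<in>UNIV. \<Sum>c\<in>UNIV. F a b c) = (\<Sum>b\<in>UNIV. \<Sum>c\<in>UNIV. \<Sum>a\<in>UNIV. F a b c)"
    for F :: "'a \<Rightarrow> 'a \<Rightarrow> 'a \<Rightarrow> real"
    by (subst sum.swap, rule sum.cong[OF refl], rule sum.swap)
  show ?thesis
  proof (rule trans[OF rot trans[OF _ rot[symmetric]]], rule sum.cong[OF refl], rule sum.cong[OF refl])
    fix b c
    show "(\<Sum>a\<in>UNIV. quad_weight g1 g2 g3 g4 a b c * \<Phi> a b c)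
      = (\<Sum>a\<in>UNIV. quad_weight g4 g2 g3 g1 a b c * \<Phi> (- a - b - c) b c)"
      by (rule sum.reindex_bij_witness[where i = "\<lambda>a. - a - b - c" and j = "\<lambda>a. - a - b - c"])
         (simp_all add: quad_weight_def mult_ac)
  qed
qed

lemma quad_pos:
  assumes "\<And>x. g1 x \<ge> 0" "\<And>x. g2 x \<ge> 0" "\<And>x. g3 x \<ge> 0" "\<And>x. g4 x \<ge> 0"
    and "quad_weight g1 g2 g3 g4 a b c > 0"
  shows "g1 a > 0" "g2 b > 0" "g3 c > 0" "g4 (- a - b - c) > 0"
proof -
  have "g1 a \<noteq> 0" "g2 b \<noteq> 0" "g3 c \<noteq> 0" "g4 (- a - b - c) \<noteq> 0"
    using assms(5) by (auto simp: quad_weight_def)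
  then show "g1 a > 0" "g2 b > 0" "g3 c > 0" "g4 (- a - b - c) > 0"
    using assms(1)[of a] assms(2)[of b] assms(3)[of c] assms(4)[of "- a - b - c"] by linarith+
qed

text \<open>For a product-form distribution on quadruples with sum zero this is the non-negativity of the
  mutual information of the second and third entry given the first.\<close>

lemma conditional_information_nonneg:
  assumes g: "\<And>x. g1 x \<ge> 0" "\<And>x. g2 x \<ge> 0" "\<And>x. g3 x \<ge> 0" "\<And>x. g4 x \<ge> 0"
  shows "(\<Sum>a\<in>UNIV. \<Sum>b\<in>UNIV. \<Sum>c\<in>UNIV. quad_weight g1 g2 g3 g4 a b c *
      (ln (convolve g3 g4 (- a - b)) + ln (convolve g2 g4 (- a - c))
        - ln (convolve g2 (convolve g3 g4) (- a)) - ln (g4 (- a - b - c)))) \<le> 0"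
proof -
  let ?J = "quad_weight g1 g2 g3 g4"
  \<comment> \<open>In terms of the marginals of \<open>?J\<close> this is P(a, b) P(a, c) / P(a),
    the coupling that makes b and c independent given a.\<close>
  define Q where "Q a b c = g1 a * g2 b * g3 c * convolve g3 g4 (- a - b) * convolve g2 g4 (- a - c)
      / convolve g2 (convolve g3 g4) (- a)" for a b c
  have cn: "convolve g3 g4 w \<ge> 0" "convolve g2 g4 w \<ge> 0" "convolve g2 (convolve g3 g4) w \<ge> 0" for w
    using g by (auto intro!: convolve_nonneg)
  have Jnn: "?J a b c \<ge> 0" for a b c using g by (simp add: quad_weight_def)
  have Qnn: "Q a b c \<ge> 0" for a b c using g cn by (simp add: Q_def)
  have pos: "g1 a > 0" "g2 b > 0" "g3 c > 0" "g4 (- a - b - c) > 0" "convolve g3 g4 (- a - b) > 0"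
      "convolve g2 g4 (- a - c) > 0" "convolve g2 (convolve g3 g4) (- a) > 0" if J: "?J a b c > 0" for a b c
  proof -
    show p: "g1 a > 0" "g2 b > 0" "g3 c > 0" "g4 (- a - b - c) > 0" using quad_pos[OF g J] by auto
    have "0 < g3 c * g4 (- a - b - c)" using p by simp
    also have "\<dots> \<le> convolve g3 g4 (- a - b)" using convolve_ge[of g3 g4 c "- a - b"] g by simp
    finally show q: "convolve g3 g4 (- a - b) > 0" .
    have "0 < g2 b * g4 (- a - b - c)" using p by simp
    also have "\<dots> \<le> convolve g2 g4 (- a - c)" using convolve_ge[of g2 g4 b "- a - c"] g by (simp add: algebra_simps)
    finally show "convolve g2 g4 (- a - c) > 0" .
    have "0 < g2 b * convolve g3 g4 (- a - b)" using p q by simp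
    also have "\<dots> \<le> convolve g2 (convolve g3 g4) (- a)" using convolve_ge[of g2 "convolve g3 g4" b "- a"] g cn by simp
    finally show "convolve g2 (convolve g3 g4) (- a) > 0" .
  qed
  have triple: "(\<Sum>a\<in>UNIV. \<Sum>b\<in>UNIV. \<Sum>c\<in>UNIV. F a b c) = (\<Sum>(a, b, c)\<in>UNIV \<times> UNIV \<times> UNIV. F a b c)"
    for F :: "'a \<Rightarrow> 'a \<Rightarrow> 'a \<Rightarrow> real"
    by (simp add: sum.cartesian_product)
  have "(\<Sum>a\<in>UNIV. \<Sum>b\<in>UNIV. \<Sum>c\<in>UNIV. Q a b c) =
      (\<Sum>a\<in>UNIV. g1 a / convolve g2 (convolve g3 g4) (- a) *
        ((\<Sum>b\<in>UNIV. g2 b * convolve g3 g4 (- a - b)) * (\<Sum>c\<in>UNIV. g3 c * convolve g2 g4 (- a - c))))"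
    by (simp add: Q_def sum_product sum_distrib_left sum_distrib_right mult_ac) (rule sum.cong[OF refl], rule sum.swap)
  also have "\<dots> = (\<Sum>a\<in>UNIV. g1 a / convolve g2 (convolve g3 g4) (- a) *
        (convolve g2 (convolve g3 g4) (- a) * convolve g3 (convolve g2 g4) (- a)))"
    by (simp only: convolve_def[of g2 "convolve g3 g4"] convolve_def[of g3 "convolve g2 g4"])
  also have "convolve g3 (convolve g2 g4) = convolve g2 (convolve g3 g4)"
    by (metis convolve_assoc convolve_commute)
  \<comment> \<open>A vanishing denominator is harmless: division by 0 yields 0, which is then also
    the value of the convolution on the right.\<close>
  also have "(\<Sum>a\<in>UNIV. g1 a / convolve g2 (convolve g3 g4) (- a) *
        (convolve g2 (convolve g3 g4) (- a) * convolve g2 (convolve g3 g4) (- a)))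
      = (\<Sum>a\<in>UNIV. g1 a * convolve g2 (convolve g3 g4) (- a) * 1)"
    by (intro sum.cong refl) auto
  also have "\<dots> = (\<Sum>a\<in>UNIV. \<Sum>b\<in>UNIV. \<Sum>c\<in>UNIV. ?J a b c * 1)"
    using quad_sum_first[of g1 g2 g3 g4 "\<lambda>_. 1"] by simp
  finally have total: "(\<Sum>a\<in>UNIV. \<Sum>b\<in>UNIV. \<Sum>c\<in>UNIV. Q a b c) = (\<Sum>a\<in>UNIV. \<Sum>b\<in>UNIV. \<Sum>c\<in>UNIV. ?J a b c)" by simp
  have "(\<Sum>(a, b, c)\<in>UNIV \<times> UNIV \<times> UNIV. ?J a b c * ln (Q a b c)) \<le> (\<Sum>(a, b, c)\<in>UNIV \<times> UNIV \<times> UNIV. ?J a b c * ln (?J a b c))"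
    using gibbs[of "UNIV \<times> UNIV \<times> UNIV" "\<lambda>(a, b, c). ?J a b c" "\<lambda>(a, b, c). Q a b c"] Jnn Qnn pos total
    by (auto simp: triple split_def) (simp add: Q_def)
  then have "(\<Sum>a\<in>UNIV. \<Sum>b\<in>UNIV. \<Sum>c\<in>UNIV. ?J a b c * ln (Q a b c)) \<le> (\<Sum>a\<in>UNIV. \<Sum>b\<in>UNIV. \<Sum>c\<in>UNIV. ?J a b c * ln (?J a b c))"
    by (simp only: triple)
  then have "(\<Sum>a\<in>UNIV. \<Sum>b\<in>UNIV. \<Sum>c\<in>UNIV. ?J a b c * (ln (Q a b c) - ln (?J a b c))) \<le> 0"
    by (simp add: right_diff_distrib sum_subtractf)
  also have "(\<Sum>a\<in>UNIV. \<Sum>b\<in>UNIV. \<Sum>c\<in>UNIV. ?J a b c * (ln (Q a b c) - ln (?J a b c))) =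
      (\<Sum>a\<in>UNIV. \<Sum>b\<in>UNIV. \<Sum>c\<in>UNIV. ?J a b c *
      (ln (convolve g3 g4 (- a - b)) + ln (convolve g2 g4 (- a - c))
        - ln (convolve g2 (convolve g3 g4) (- a)) - ln (g4 (- a - b - c))))"
  proof (intro sum.cong refl)
    fix a b c
    show "?J a b c * (ln (Q a b c) - ln (?J a b c)) = ?J a b c *
      (ln (convolve g3 g4 (- a - b)) + ln (convolve g2 g4 (- a - c))
        - ln (convolve g2 (convolve g3 g4) (- a)) - ln (g4 (- a - b - c)))"
    proof (cases "?J a b c > 0")
      case True
      show ?thesis using pos[OF True] by (simp add: Q_def quad_weight_def ln_mult ln_div)
    next
      case False
      then have "?J a b c = 0" using Jnn[of a b c] by linarith
      then show ?thesis by simp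
    qed
  qed
  finally show ?thesis .
qed

text \<open>For total mass 1 and a + b + c + d = 0 this says H(a) + H(a + b + c) \<le> H(a + b) +
  H(a + c). It is the sum of I(b; c | a) \<ge> 0 and I(b; c | d) \<ge> 0: for product forms every
  law involved is a product of convolutions, and the logarithms match up. It fails for general laws,
  for instance for non-constant a with b = c = -a.\<close>

lemma entropy_sum_submodular:
  fixes g1 :: "'v::{ab_group_add,finite} \<Rightarrow> real"
  assumes g: "\<And>x. g1 x \<ge> 0" "\<And>x. g2 x \<ge> 0" "\<And>x. g3 x \<ge> 0" "\<And>x. g4 x \<ge> 0"
  shows "entropy (\<lambda>a. g1 a * convolve g2 (convolve g3 g4) (- a)) + entropy (\<lambda>d. g4 d * convolve g1 (convolve g2 g3) (- d))
    \<le> entropy (\<lambda>w. convolve g1 g2 w * convolve g3 g4 (- w)) + entropy (\<lambda>w. convolve g1 g3 w * convolve g2 g4 (- w))"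
proof -
  let ?J = "quad_weight g1 g2 g3 g4"
  let ?S = "\<lambda>F. \<Sum>a\<in>UNIV. \<Sum>b\<in>UNIV. \<Sum>c\<in>UNIV. ?J a b c * F a b c"
  define A where "A a = g1 a * convolve g2 (convolve g3 g4) (- a)" for a
  define D where "D d = g4 d * convolve g1 (convolve g2 g3) (- d)" for d
  define AB where "AB w = convolve g1 g2 w * convolve g3 g4 (- w)" for w
  define AC where "AC w = convolve g1 g3 w * convolve g2 g4 (- w)" for w
  have rev: "convolve g2 (convolve g3 g1) = convolve g1 (convolve g2 g3)"
    by (metis convolve_assoc convolve_commute)
  have eA: "entropy A = - ?S (\<lambda>a b c. ln (A a))"
    unfolding entropy_def using quad_sum_first[of g1 g2 g3 g4 "\<lambda>a. ln (A a)"] by (simp add: A_def)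
  have eAB: "entropy AB = - ?S (\<lambda>a b c. ln (AB (a + b)))"
    unfolding entropy_def using quad_sum_pair[of g1 g2 g3 g4 "\<lambda>w. ln (AB w)"] by (simp add: AB_def)
  have eAC: "entropy AC = - ?S (\<lambda>a b c. ln (AC (a + c)))"
    unfolding entropy_def using quad_sum_pair[of g1 g3 g2 g4 "\<lambda>w. ln (AC w)"]
      quad_sum_swap[of g1 g2 g3 g4 "\<lambda>a b c. ln (AC (a + c))"] by (simp add: AC_def)
  have eD: "entropy D = - ?S (\<lambda>a b c. ln (D (- a - b - c)))"
    unfolding entropy_def using quad_sum_first[of g4 g2 g3 g1 "\<lambda>a. ln (D a)"]
      quad_sum_reverse[of g1 g2 g3 g4 "\<lambda>a b c. ln (D (- a - b - c))"] by (simp add: D_def rev algebra_simps)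
  have i1: "?S (\<lambda>a b c. ln (convolve g3 g4 (- a - b)) + ln (convolve g2 g4 (- a - c))
        - ln (convolve g2 (convolve g3 g4) (- a)) - ln (g4 (- a - b - c))) \<le> 0"
    by (rule conditional_information_nonneg[OF g])
  have "(\<Sum>a\<in>UNIV. \<Sum>b\<in>UNIV. \<Sum>c\<in>UNIV. quad_weight g4 g2 g3 g1 a b c *
      (ln (convolve g3 g1 (- a - b)) + ln (convolve g2 g1 (- a - c))
        - ln (convolve g2 (convolve g3 g1) (- a)) - ln (g1 (- a - b - c)))) \<le> 0"
    by (rule conditional_information_nonneg[OF g(4,2,3,1)])
  then have i2: "?S (\<lambda>a b c. ln (convolve g1 g3 (a + c)) + ln (convolve g1 g2 (a + b))
        - ln (convolve g1 (convolve g2 g3) (a + b + c)) - ln (g1 a)) \<le> 0"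
    unfolding quad_sum_reverse[of g1 g2 g3 g4]
    by (simp add: convolve_ac algebra_simps)
  have "?S (\<lambda>a b c. ln (AB (a + b)) + ln (AC (a + c)) - ln (A a) - ln (D (- a - b - c))) =
    ?S (\<lambda>a b c. ln (convolve g3 g4 (- a - b)) + ln (convolve g2 g4 (- a - c))
        - ln (convolve g2 (convolve g3 g4) (- a)) - ln (g4 (- a - b - c))) +
    ?S (\<lambda>a b c. ln (convolve g1 g3 (a + c)) + ln (convolve g1 g2 (a + b))
        - ln (convolve g1 (convolve g2 g3) (a + b + c)) - ln (g1 a))"
    unfolding sum.distrib[symmetric] distrib_left[symmetric]
  proof (intro sum.cong refl)
    fix a b c
    show "?J a b c * (ln (AB (a + b)) + ln (AC (a + c)) - ln (A a) - ln (D (- a - b - c))) =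
      ?J a b c * (ln (convolve g3 g4 (- a - b)) + ln (convolve g2 g4 (- a - c))
        - ln (convolve g2 (convolve g3 g4) (- a)) - ln (g4 (- a - b - c)) +
      (ln (convolve g1 g3 (a + c)) + ln (convolve g1 g2 (a + b))
        - ln (convolve g1 (convolve g2 g3) (a + b + c)) - ln (g1 a)))"
    proof (cases "?J a b c > 0")
      case True
      note p = quad_pos[OF g True]
      have "convolve g1 g2 (a + b) > 0" "convolve g1 g3 (a + c) > 0" "convolve g3 g4 (- (a + b)) > 0"
        "convolve g2 g4 (- (a + c)) > 0" "convolve g2 g3 (b + c) > 0"
        using p g convolve_pos[of g1 g2 a b] convolve_pos[of g1 g3 a c] convolve_pos[of g3 g4 c "- a - b - c"]
          convolve_pos[of g2 g4 b "- a - b - c"] convolve_pos[of g2 g3 b c] by (simp_all add: algebra_simps)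
      moreover from this have "convolve g2 (convolve g3 g4) (- a) > 0" "convolve g1 (convolve g2 g3) (a + b + c) > 0"
        using p g convolve_pos[of g2 "convolve g3 g4" b "- (a + b)"] convolve_pos[of g1 "convolve g2 g3" a "b + c"]
        by (simp_all add: convolve_nonneg add.assoc)
      ultimately show ?thesis using p
        by (simp add: AB_def AC_def A_def D_def ln_mult algebra_simps)
    next
      case False
      then have "?J a b c = 0" using g by (metis less_le mult_nonneg_nonneg quad_weight_def)
      then show ?thesis by simp
    qed
  qed
  then have "?S (\<lambda>a b c. ln (AB (a + b)) + ln (AC (a + c)) - ln (A a) - ln (D (- a - b - c))) \<le> 0"
    using i1 i2 by linarith
  then have "entropy A + entropy D \<le> entropy AB + entropy AC"
    unfolding eA eAB eAC eD by (simp add: right_diff_distrib distrib_left sum.distrib sum_subtractf)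
  then show ?thesis by (simp only: A_def[abs_def] D_def[abs_def] AB_def[abs_def] AC_def[abs_def])
qed

section \<open>Cycles over a finite set of roles\<close>

text \<open>The convolution of all \<open>f j\<close> with \<open>j\<close> in \<open>S\<close>,
  written as a sum over tuples so that no order of the roles has to be chosen.\<close>

definition role_conv :: "('j \<Rightarrow> 'v::{ab_group_add,finite} \<Rightarrow> real) \<Rightarrow> 'j set \<Rightarrow> 'v \<Rightarrow> real" where
  "role_conv f S w = (\<Sum>z | z \<in> PiE S (\<lambda>_. UNIV) \<and> (\<Sum>j\<in>S. z j) = w. \<Prod>j\<in>S. f j (z j))"

text \<open>If the product-form weights on the roles \<open>J\<close> have total mass 1, this is the distribution of the
  partial sum over the roles \<open>S\<close>.\<close>

definition role_marginal :: "('j \<Rightarrow> 'v::{ab_group_add,finite} \<Rightarrow> real) \<Rightarrow> 'j set \<Rightarrow> 'j set \<Rightarrow> 'v \<Rightarrow> real" where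
  "role_marginal f J S w = role_conv f S w * role_conv f (J - S) (- w)"

lemma role_conv_empty: "role_conv f {} w = (if w = 0 then 1 else 0)"
  by (auto simp: role_conv_def)

lemma role_conv_nonneg: "(\<And>j x. f j x \<ge> 0) \<Longrightarrow> role_conv f S w \<ge> 0"
  by (auto simp: role_conv_def intro!: sum_nonneg prod_nonneg)

lemma role_conv_cong: "(\<And>j. j \<in> S \<Longrightarrow> f j = g j) \<Longrightarrow> role_conv f S = role_conv g S"
  by (auto simp: role_conv_def fun_eq_iff intro!: sum.cong prod.cong)

lemma role_conv_insert:
  assumes "finite S" "j \<notin> S"
  shows "role_conv f (insert j S) = convolve (f j) (role_conv f S)"
proof
  fix w
  have fin: "finite (PiE S (\<lambda>_. UNIV :: 'b set))" using assms by (intro finite_PiE) auto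
  have "convolve (f j) (role_conv f S) w =
      (\<Sum>x\<in>UNIV. \<Sum>z | z \<in> PiE S (\<lambda>_. UNIV) \<and> (\<Sum>j\<in>S. z j) = w - x. f j x * (\<Prod>j\<in>S. f j (z j)))"
    by (simp add: convolve_def role_conv_def sum_distrib_left)
  also have "\<dots> = (\<Sum>(x, z)\<in>Sigma UNIV (\<lambda>x. {z. z \<in> PiE S (\<lambda>_. UNIV) \<and> (\<Sum>j\<in>S. z j) = w - x}). f j x * (\<Prod>j\<in>S. f j (z j)))"
    using fin by (intro sum.Sigma) auto
  also have "\<dots> = role_conv f (insert j S) w"
    unfolding role_conv_def
  proof (rule sum.reindex_bij_witness[where i = "\<lambda>z. (z j, z(j := undefined))" and j = "\<lambda>(x, z). z(j := x)"])
    fix t assume "t \<in> Sigma UNIV (\<lambda>x. {z. z \<in> PiE S (\<lambda>_. UNIV) \<and> (\<Sum>j\<in>S. z j) = w - x})"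
    then obtain x z where t: "t = (x, z)" "z \<in> PiE S (\<lambda>_. UNIV)" "(\<Sum>j\<in>S. z j) = w - x" by auto
    have s: "(\<Sum>i\<in>S. (z(j := x)) i) = (\<Sum>i\<in>S. z i)" and p: "(\<Prod>i\<in>S. f i ((z(j := x)) i)) = (\<Prod>i\<in>S. f i (z i))"
      using assms by (auto intro!: sum.cong prod.cong)
    show "(\<lambda>z. (z j, z(j := undefined))) (case t of (x, z) \<Rightarrow> z(j := x)) = t"
      using t assms by (auto simp: PiE_def extensional_def fun_eq_iff)
    show "(case t of (x, z) \<Rightarrow> z(j := x)) \<in> {z. z \<in> PiE (insert j S) (\<lambda>_. UNIV) \<and> (\<Sum>j\<in>insert j S. z j) = w}"
      using t assms s by (auto simp: PiE_def extensional_def)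
    show "(\<Prod>i\<in>insert j S. f i ((case t of (x, z) \<Rightarrow> z(j := x)) i)) = (case t of (x, z) \<Rightarrow> f j x * (\<Prod>j\<in>S. f j (z j)))"
      using t assms p by simp
  next
    fix z assume "z \<in> {z. z \<in> PiE (insert j S) (\<lambda>_. UNIV) \<and> (\<Sum>j\<in>insert j S. z j) = w}"
    then have z: "z \<in> PiE (insert j S) (\<lambda>_. UNIV)" "z j + (\<Sum>i\<in>S. z i) = w" using assms by auto
    have s: "(\<Sum>i\<in>S. (z(j := undefined)) i) = (\<Sum>i\<in>S. z i)" using assms by (auto intro!: sum.cong)
    show "(case (z j, z(j := undefined)) of (x, z) \<Rightarrow> z(j := x)) = z" by simp
    show "(z j, z(j := undefined)) \<in> Sigma UNIV (\<lambda>x. {z. z \<in> PiE S (\<lambda>_. UNIV) \<and> (\<Sum>j\<in>S. z j) = w - x})"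
      using z assms s by (auto simp: PiE_def extensional_def)
  qed
  finally show "role_conv f (insert j S) w = convolve (f j) (role_conv f S) w" ..
qed

lemma convolve_role_conv_empty: "convolve g (role_conv f {}) = g"
  by (simp add: fun_eq_iff convolve_def role_conv_empty if_distrib cong: if_cong)

lemma role_conv_singleton: "role_conv f {j} = f j"
  by (simp add: role_conv_insert convolve_role_conv_empty)

lemma role_conv_Un:
  assumes "finite A" "finite B" "A \<inter> B = {}"
  shows "role_conv f (A \<union> B) = convolve (role_conv f A) (role_conv f B)"
  using assms
proof (induction A rule: finite_induct)
  case empty
  then show ?case using convolve_role_conv_empty[of "role_conv f B" f] by (simp add: convolve_commute)
next
  case (insert j A)
  then show ?case by (simp add: role_conv_insert convolve_assoc)
qed

lemma role_marginal_nonneg: "(\<And>j x. f j x \<ge> 0) \<Longrightarrow> role_marginal f J S w \<ge> 0"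
  by (simp add: role_marginal_def role_conv_nonneg)

lemma entropy_role_marginal_compl:
  assumes "S \<subseteq> J"
  shows "entropy (role_marginal f J (J - S)) = entropy (role_marginal f J S)"
proof -
  have "role_marginal f J (J - S) = (\<lambda>w. role_marginal f J S (- w))"
    using assms by (simp add: role_marginal_def fun_eq_iff double_diff mult.commute)
  then show ?thesis using entropy_uminus[of "role_marginal f J S"] by simp
qed

text \<open>\<open>entropy_sum_submodular\<close> for the blocks {i}, \<open>T\<close>, {x} and the
  remaining roles \<open>D\<close>. The partial sum over \<open>D\<close> is minus the one over its
  complement, so both have the same entropy.\<close>

lemma role_entropy_submodular:
  assumes J: "finite J" and f: "\<And>j x. f j x \<ge> 0"
    and T: "T \<subseteq> J" "i \<in> J" "x \<in> J" "i \<notin> T" "x \<notin> T" "i \<noteq> x"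
  shows "entropy (role_marginal f J {i}) + entropy (role_marginal f J (insert x (insert i T)))
    \<le> entropy (role_marginal f J (insert i T)) + entropy (role_marginal f J {i, x})"
proof -
  define D where "D = J - insert x (insert i T)"
  have fin: "finite T" "finite D" using J T by (auto simp: D_def intro: finite_subset)
  note nn = role_conv_nonneg[OF f]
  have c1: "role_conv f (J - {i}) = convolve (role_conv f T) (convolve (f x) (role_conv f D))"
  proof -
    have "J - {i} = T \<union> insert x D" "T \<inter> insert x D = {}" "x \<notin> D" using T by (auto simp: D_def)
    then show ?thesis using fin by (simp add: role_conv_Un role_conv_insert convolve_ac)
  qed
  have c2: "role_conv f (insert x (insert i T)) = convolve (f i) (convolve (role_conv f T) (f x))"
    using T fin by (simp add: role_conv_insert convolve_ac)
  have c3: "role_conv f (J - insert i T) = convolve (f x) (role_conv f D)"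
  proof -
    have "J - insert i T = insert x D" "x \<notin> D" using T by (auto simp: D_def)
    then show ?thesis using fin by (simp add: role_conv_insert)
  qed
  have c4: "role_conv f (J - {i, x}) = convolve (role_conv f T) (role_conv f D)"
  proof -
    have "J - {i, x} = T \<union> D" "T \<inter> D = {}" using T by (auto simp: D_def)
    then show ?thesis using fin by (simp add: role_conv_Un)
  qed
  have c5: "role_conv f (insert i T) = convolve (f i) (role_conv f T)" using T fin by (simp add: role_conv_insert)
  have c6: "role_conv f {i, x} = convolve (f i) (f x)" using T by (simp add: role_conv_insert role_conv_singleton)
  have "entropy (\<lambda>a. f i a * convolve (role_conv f T) (convolve (f x) (role_conv f D)) (- a)) +
      entropy (\<lambda>d. role_conv f D d * convolve (f i) (convolve (role_conv f T) (f x)) (- d))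
    \<le> entropy (\<lambda>w. convolve (f i) (role_conv f T) w * convolve (f x) (role_conv f D) (- w)) +
      entropy (\<lambda>w. convolve (f i) (f x) w * convolve (role_conv f T) (role_conv f D) (- w))"
    by (rule entropy_sum_submodular[OF f nn f nn])
  moreover have "role_marginal f J {i} = (\<lambda>a. f i a * convolve (role_conv f T) (convolve (f x) (role_conv f D)) (- a))"
    by (simp add: role_marginal_def fun_eq_iff role_conv_singleton c1)
  moreover have "role_marginal f J (J - insert x (insert i T)) = (\<lambda>d. role_conv f D d * convolve (f i) (convolve (role_conv f T) (f x)) (- d))"
  proof -
    have "J - (J - insert x (insert i T)) = insert x (insert i T)" using T by auto
    then show ?thesis by (simp only: role_marginal_def[abs_def] D_def[symmetric] c2)
  qed
  moreover have "role_marginal f J (insert i T) = (\<lambda>w. convolve (f i) (role_conv f T) w * convolve (f x) (role_conv f D) (- w))"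
    by (simp add: role_marginal_def fun_eq_iff c5 c3)
  moreover have "role_marginal f J {i, x} = (\<lambda>w. convolve (f i) (f x) w * convolve (role_conv f T) (role_conv f D) (- w))"
    by (simp add: role_marginal_def fun_eq_iff c6 c4)
  moreover have "entropy (role_marginal f J (J - insert x (insert i T))) = entropy (role_marginal f J (insert x (insert i T)))"
    using T by (intro entropy_role_marginal_compl) auto
  ultimately show ?thesis by simp
qed

text \<open>Merging the role of least entropy with a suitable other role does not decrease the least entropy:
  otherwise, by submodularity, the entropy of the partial sums over growing sets of roles would
  strictly decrease, down to the complement of a single role.\<close>

lemma exists_merge:
  assumes J: "finite J" "card J \<ge> 3" and f: "\<And>j x. f j x \<ge> 0"
    and i: "i \<in> J" "\<And>j. j \<in> J \<Longrightarrow> entropy (role_marginal f J {i}) \<le> entropy (role_marginal f J {j})"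
  obtains x where "x \<in> J" "x \<noteq> i" "entropy (role_marginal f J {i}) \<le> entropy (role_marginal f J {i, x})"
proof -
  have "\<exists>x\<in>J - {i}. entropy (role_marginal f J {i}) \<le> entropy (role_marginal f J {i, x})"
  proof (rule ccontr)
    assume "\<not> ?thesis"
    then have less: "entropy (role_marginal f J {i, x}) < entropy (role_marginal f J {i})" if "x \<in> J" "x \<noteq> i" for x
      using that by force
    have grow: "entropy (role_marginal f J (insert i T)) < entropy (role_marginal f J {i})"
      if "finite T" "T \<noteq> {}" "T \<subseteq> J - {i}" for T
      using that
    proof (induction T rule: finite_ne_induct)
      case (singleton x)
      then show ?case using less[of x] by auto
    next
      case (insert x T)
      then have "entropy (role_marginal f J {i}) + entropy (role_marginal f J (insert x (insert i T)))
          \<le> entropy (role_marginal f J (insert i T)) + entropy (role_marginal f J {i, x})"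
        using i by (intro role_entropy_submodular[OF J(1) f]) auto
      moreover have "entropy (role_marginal f J (insert i T)) < entropy (role_marginal f J {i})" using insert by auto
      moreover have "entropy (role_marginal f J {i, x}) < entropy (role_marginal f J {i})" using insert less[of x] by auto
      ultimately show ?case by (simp add: insert_commute)
    qed
    have "card (J - {i}) \<ge> 2" using J i by simp
    then obtain k where k: "k \<in> J - {i}" "J - {i} - {k} \<noteq> {}"
      by (metis One_nat_def card.empty card_Suc_Diff1 card_gt_0_iff finite_Diff J(1) less_Suc_eq_0_disj
          Suc_1 all_not_in_conv card_eq_0_iff not_less_eq_eq le_zero_eq nat.distinct(1))
    have "insert i (J - {i} - {k}) = J - {k}" using k i by auto
    then have "entropy (role_marginal f J (J - {k})) < entropy (role_marginal f J {i})"
      using grow[of "J - {i} - {k}"] J k by auto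
    then show False using i(2)[of k] entropy_role_marginal_compl[of "{k}" J f] k by auto
  qed
  then show ?thesis using that by blast
qed

text \<open>\<open>triangle_entropy_bound\<close> for three bare weight functions, with the triangle
  entropy expanded into expected log-weights. In this form one of the weights can be the convolution
  of all roles outside a merged pair.\<close>

lemma triangle_functional_bound:
  fixes g0 g1 g2 :: "'a::{field,finite} ^ 'n \<Rightarrow> real"
  assumes g: "\<And>x. g0 x \<ge> 0" "\<And>x. g1 x \<ge> 0" "\<And>x. g2 x \<ge> 0"
    and total: "convolve g0 (convolve g1 g2) 0 = 1"
    and cc: "0 \<le> cc" "cc \<le> 1"
    and low: "\<And>d. real (card (low_exponents CARD('a) d)) \<le> (real CARD('a) powr (1 - cc)) ^ d"
    and L: "L = ln (real CARD('a ^ 'n))"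
    and M0: "M0 = (\<lambda>x. g0 x * convolve g1 g2 (- x))"
    and M1: "M1 = (\<lambda>x. g1 x * convolve g0 g2 (- x))"
    and M2: "M2 = (\<lambda>x. g2 x * convolve g0 g1 (- x))"
  shows "cc * (2 * L + (\<Sum>x\<in>UNIV. M0 x * ln (g0 x)) + (\<Sum>x\<in>UNIV. M1 x * ln (g1 x)) + (\<Sum>x\<in>UNIV. M2 x * ln (g2 x)))
    \<le> (1 + cc) * (L - (entropy M0 + entropy M1 + entropy M2) / 3)"
proof -
  define f where "f j = (if j = 0 then g0 else if j = 1 then g1 else g2)" for j :: nat
  have f: "f j x \<ge> 0" for j x using g by (simp add: f_def)
  have W: "cycle_weight f (a, b) = g0 a * g1 b * g2 (- a - b)" for a b
    by (simp add: cycle_weight_def prod_less_3 f_def)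
  have pair: "(\<Sum>c\<in>UNIV. F c) = (\<Sum>a\<in>UNIV. \<Sum>b\<in>UNIV. F (a, b))" for F :: "('a ^ 'n) \<times> ('a ^ 'n) \<Rightarrow> real"
    by (simp add: sum.cartesian_product)
  have E0: "(\<Sum>c\<in>UNIV. cycle_weight f c * \<phi> (entry 0 c)) = (\<Sum>x\<in>UNIV. M0 x * \<phi> x)" for \<phi>
    by (simp add: pair W M0 convolve_def sum_distrib_left sum_distrib_right mult_ac)
  have E1: "(\<Sum>c\<in>UNIV. cycle_weight f c * \<phi> (entry 1 c)) = (\<Sum>x\<in>UNIV. M1 x * \<phi> x)" for \<phi>
    unfolding pair
    by (subst sum.swap) (simp add: W M1 convolve_def sum_distrib_left sum_distrib_right mult_ac minus_diff_commute)
  have E2: "(\<Sum>c\<in>UNIV. cycle_weight f c * \<phi> (entry 2 c)) = (\<Sum>x\<in>UNIV. M2 x * \<phi> x)" for \<phi>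
  proof -
    have "(\<Sum>c\<in>UNIV. cycle_weight f c * \<phi> (entry 2 c)) = (\<Sum>a\<in>UNIV. \<Sum>b\<in>UNIV. g0 a * g1 b * g2 (- a - b) * \<phi> (- a - b))"
      by (simp add: pair W)
    also have "\<dots> = (\<Sum>a\<in>UNIV. \<Sum>x\<in>UNIV. g0 a * g1 (- x - a) * g2 x * \<phi> x)"
    proof (rule sum.cong[OF refl])
      fix a
      show "(\<Sum>b\<in>UNIV. g0 a * g1 b * g2 (- a - b) * \<phi> (- a - b)) = (\<Sum>x\<in>UNIV. g0 a * g1 (- x - a) * g2 x * \<phi> x)"
        by (rule sum.reindex_bij_witness[where i = "\<lambda>x. - x - a" and j = "\<lambda>b. - a - b"]) auto
    qed
    also have "\<dots> = (\<Sum>x\<in>UNIV. \<Sum>a\<in>UNIV. g0 a * g1 (- x - a) * g2 x * \<phi> x)" by (rule sum.swap)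
    also have "\<dots> = (\<Sum>x\<in>UNIV. M2 x * \<phi> x)"
      by (simp add: M2 convolve_def sum_distrib_left sum_distrib_right mult_ac)
    finally show ?thesis .
  qed
  \<comment> \<open>Testing against indicators recovers a marginal from its expectations.\<close>
  have marg: "cycle_marginal f j = M" if "\<And>\<phi>. (\<Sum>c\<in>UNIV. cycle_weight f c * \<phi> (entry j c)) = (\<Sum>x\<in>UNIV. M x * \<phi> x)"
    for j and M :: "'a ^ 'n \<Rightarrow> real"
  proof
    fix y
    have "(\<Sum>x\<in>UNIV. cycle_marginal f j x * of_bool (x = y)) = (\<Sum>x\<in>UNIV. M x * of_bool (x = y))"
      using that[of "\<lambda>x. of_bool (x = y)"] by (simp add: sum_cycle_marginal)
    then show "cycle_marginal f j y = M y" by simp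
  qed
  have "(\<Sum>c\<in>UNIV. cycle_weight f c) = 1"
    using total by (simp add: pair W convolve_def sum_distrib_left mult_ac)
  from triangle_entropy_bound[OF f this cc low L]
  have "cc * (2 * L - entropy (cycle_weight f)) \<le> (1 + cc) * (L - (\<Sum>j<3. entropy (cycle_marginal f j)) / 3)" .
  moreover have three: "(\<Sum>j<(3::nat). G j) = G 0 + G 1 + G 2" for G :: "nat \<Rightarrow> real"
    by (simp only: numeral_3_eq_3 numeral_2_eq_2 One_nat_def sum.lessThan_Suc) simp
  moreover have H: "entropy (cycle_weight f) = - ((\<Sum>x\<in>UNIV. M0 x * ln (g0 x)) + (\<Sum>x\<in>UNIV. M1 x * ln (g1 x)) + (\<Sum>x\<in>UNIV. M2 x * ln (g2 x)))"
    unfolding entropy_cycle_weight[OF f] three E0[symmetric] E1[symmetric] E2[symmetric] by (simp add: f_def)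
  then have "2 * L - entropy (cycle_weight f) = 2 * L + (\<Sum>x\<in>UNIV. M0 x * ln (g0 x)) + (\<Sum>x\<in>UNIV. M1 x * ln (g1 x)) + (\<Sum>x\<in>UNIV. M2 x * ln (g2 x))"
    by simp
  ultimately show ?thesis by (simp only: three marg[OF E0] marg[OF E1] marg[OF E2])
qed

subsection \<open>Entropy of cycles\<close>

text \<open>The right-hand side is the entropy of the cycle distribution, written role by role so
  that merging two roles changes only their terms. Each merge enlarges the coefficient of \<beta> by
  1 / \<open>cc\<close>.\<close>

theorem cycle_entropy_bound:
  fixes f :: "'j \<Rightarrow> 'a::{field,finite} ^ 'n \<Rightarrow> real"
  assumes J: "finite J" "card J \<ge> 3" and f: "\<And>j x. f j x \<ge> 0"
    and total: "role_conv f J 0 = 1"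
    and ent: "\<And>j. j \<in> J \<Longrightarrow> L - \<beta> \<le> entropy (role_marginal f J {j})"
    and cc: "0 < cc" "cc \<le> 1 / 2"
    and low: "\<And>d. real (card (low_exponents CARD('a) d)) \<le> (real CARD('a) powr (1 - cc)) ^ d"
    and L: "L = ln (real CARD('a ^ 'n))"
  shows "(real (card J) - 1) * L - ((real (card J) - 2) / cc + 1) * \<beta>
    \<le> - (\<Sum>j\<in>J. \<Sum>x\<in>UNIV. role_marginal f J {j} x * ln (f j x))"
proof -
  obtain n where "card J = n + 3" using J(2) by (metis add.commute le_Suc_ex)
  with J(1) f total ent show ?thesis
  proof (induction n arbitrary: J f)
    case 0
    then have "card J = 3" by simp
    then obtain i j l where ijl: "J = {i, j, l}" "i \<noteq> j" "j \<noteq> l" "i \<noteq> l" by (auto simp: card_3_iff)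
    have sets: "J - {i} = {j, l}" "J - {j} = {i, l}" "J - {l} = {i, j}" using ijl by auto
    have two: "role_conv f {a, b} = convolve (f a) (f b)" if "a \<noteq> b" for a b
      using that by (simp add: role_conv_insert role_conv_singleton)
    have m: "role_marginal f J {i} = (\<lambda>x. f i x * convolve (f j) (f l) (- x))"
      "role_marginal f J {j} = (\<lambda>x. f j x * convolve (f i) (f l) (- x))"
      "role_marginal f J {l} = (\<lambda>x. f l x * convolve (f i) (f j) (- x))"
      by (simp_all only: role_marginal_def[abs_def] sets role_conv_singleton two[OF ijl(2)] two[OF ijl(3)] two[OF ijl(4)])
    have "role_conv f J = convolve (f i) (convolve (f j) (f l))"
      unfolding ijl(1) two[OF ijl(3), symmetric] using ijl by (intro role_conv_insert) auto
    then have t: "convolve (f i) (convolve (f j) (f l)) 0 = 1" using 0 by simp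
    define A where "A j = (\<Sum>x\<in>UNIV. role_marginal f J {j} x * ln (f j x))" for j
    have "cc * (2 * L + A i + A j + A l) \<le> (1 + cc) * (L - (entropy (role_marginal f J {i})
        + entropy (role_marginal f J {j}) + entropy (role_marginal f J {l})) / 3)"
      unfolding A_def using cc by (intro triangle_functional_bound[OF _ _ _ t _ _ low L m]) (auto intro: 0)
    also have "\<dots> \<le> (1 + cc) * \<beta>"
      using cc 0(4)[of i] 0(4)[of j] 0(4)[of l] ijl by (intro mult_left_mono) (auto simp: field_simps)
    finally have "2 * L + A i + A j + A l \<le> (1 + cc) * \<beta> / cc" using cc by (simp add: field_simps)
    also have "\<dots> = (1 / cc + 1) * \<beta>" using cc by (simp add: field_simps)
    finally have "2 * L - (1 / cc + 1) * \<beta> \<le> - (A i + A j + A l)" by simp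
    moreover have "(\<Sum>j\<in>J. A j) = A i + A j + A l" using ijl by simp
    ultimately show ?case using \<open>card J = 3\<close> by (simp add: A_def)
  next
    case (Suc n)
    note f = Suc.prems(2)
    define e where "e S = entropy (role_marginal f J S)" for S
    have "J \<noteq> {}" using Suc.prems by auto
    then obtain i where i: "i \<in> J" "\<And>j. j \<in> J \<Longrightarrow> e {i} \<le> e {j}"
      using ex_is_arg_min_if_finite[of J "\<lambda>j. e {j}"] Suc.prems(1) by (force simp: is_arg_min_linorder)
    obtain x where x: "x \<in> J" "x \<noteq> i" "e {i} \<le> e {i, x}"
      using exists_merge[of J f i] Suc.prems i by (auto simp: e_def)
    define R where "R = J - {i, x}"
    \<comment> \<open>The merged role keeps the index \<open>i\<close>; \<open>x\<close> leaves the
      set of roles.\<close>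
    define f' where "f' = f(i := convolve (f i) (f x))"
    define J' where "J' = J - {x}"
    have finR: "finite R" and finJ': "finite J'" using Suc.prems by (auto simp: R_def J'_def)
    have iJ': "i \<in> J'" using i x by (simp add: J'_def)
    have f'nn: "f' j y \<ge> 0" for j y using f by (simp add: f'_def convolve_nonneg)
    have conv': "role_conv f' S = role_conv f (insert x S)" if "i \<in> S" "S \<subseteq> J'" for S
    proof -
      define S0 where "S0 = S - {i}"
      have S: "S = insert i S0" "i \<notin> S0" "x \<notin> S0" "finite S0"
        using that finJ' by (auto simp: S0_def J'_def intro: finite_subset)
      have "role_conv f' S = convolve (f' i) (role_conv f' S0)" using S by (simp add: role_conv_insert)
      also have "role_conv f' S0 = role_conv f S0" using S by (intro role_conv_cong) (auto simp: f'_def)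
      also have "convolve (f' i) (role_conv f S0) = role_conv f (insert x (insert i S0))"
        using S x by (simp add: f'_def role_conv_insert convolve_ac)
      finally show ?thesis using S by simp
    qed
    have conv0: "role_conv f' S = role_conv f S" if "i \<notin> S" for S
      using that by (intro role_conv_cong) (auto simp: f'_def)
    have marg: "role_marginal f' J' {j} = role_marginal f J {j}" if "j \<in> J'" "j \<noteq> i" for j
    proof -
      have "insert x (J' - {j}) = J - {j}" using that x by (auto simp: J'_def)
      then show ?thesis using that iJ' by (simp add: role_marginal_def fun_eq_iff conv0 conv')
    qed
    have marg_i: "role_marginal f' J' {i} = role_marginal f J {i, x}"
    proof -
      have "J' - {i} = J - {i, x}" by (auto simp: J'_def)
      then show ?thesis using iJ' by (simp add: role_marginal_def fun_eq_iff conv0 conv' insert_commute)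
    qed
    have total': "role_conv f' J' 0 = 1"
    proof -
      have "insert x J' = J" using x by (auto simp: J'_def)
      then show ?thesis using Suc.prems(3) conv'[OF iJ'] by simp
    qed
    have ent': "L - \<beta> \<le> entropy (role_marginal f' J' {j})" if "j \<in> J'" for j
    proof (cases "j = i")
      case True
      then show ?thesis using Suc.prems(4)[OF i(1)] x(3) marg_i by (simp add: e_def)
    next
      case False
      then show ?thesis using Suc.prems(4)[of j] marg[OF that False] that by (simp add: J'_def)
    qed
    have cardJ': "card J' = n + 3" using Suc.prems x by (simp add: J'_def)
    define A where "A j = (\<Sum>y\<in>UNIV. role_marginal f J {j} y * ln (f j y))" for j
    define g where "g = role_conv f R"
    define mw where "mw = role_marginal f J {i, x}"
    define C where "C = (\<Sum>w\<in>UNIV. mw w * ln (convolve (f i) (f x) w))"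
    define D where "D = (\<Sum>w\<in>UNIV. mw w * ln (g (- w)))"
    have gnn: "g y \<ge> 0" for y unfolding g_def using f by (rule role_conv_nonneg)
    have pair: "role_conv f {i, x} = convolve (f i) (f x)"
      using x by (simp add: role_conv_insert role_conv_singleton)
    have mw: "mw = (\<lambda>w. convolve (f i) (f x) w * g (- w))"
      by (simp add: mw_def role_marginal_def fun_eq_iff pair g_def R_def)
    have IH: "(real (card J') - 1) * L - ((real (card J') - 2) / cc + 1) * \<beta>
      \<le> - (\<Sum>j\<in>J'. \<Sum>y\<in>UNIV. role_marginal f' J' {j} y * ln (f' j y))"
      by (rule Suc.IH[OF finJ' f'nn total' ent' cardJ'])
    have "(\<Sum>j\<in>J'. \<Sum>y\<in>UNIV. role_marginal f' J' {j} y * ln (f' j y)) = C + (\<Sum>j\<in>R. A j)"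
    proof -
      define G where "G j = (\<Sum>y\<in>UNIV. role_marginal f' J' {j} y * ln (f' j y))" for j
      have "J' = insert i R" "i \<notin> R" using iJ' by (auto simp: J'_def R_def)
      then have "sum G J' = G i + sum G R" using finR by simp
      moreover have "G i = C" unfolding G_def marg_i C_def mw_def by (simp add: f'_def)
      moreover have "sum G R = (\<Sum>j\<in>R. A j)"
        using marg by (intro sum.cong refl) (auto simp: G_def A_def f'_def R_def J'_def)
      ultimately show ?thesis by (simp add: G_def)
    qed
    with IH cardJ' have IH': "(real n + 2) * L - ((real n + 1) / cc + 1) * \<beta> \<le> - C - (\<Sum>j\<in>R. A j)"
      by (simp add: add.commute)
    have Jsum: "(\<Sum>j\<in>J. A j) = A i + A x + (\<Sum>j\<in>R. A j)"
    proof -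
      have "J = insert i (insert x R)" "i \<notin> insert x R" "x \<notin> R" using i x by (auto simp: R_def)
      then show ?thesis using finR by simp
    qed
    have m1: "role_marginal f J {i} = (\<lambda>y. f i y * convolve (f x) g (- y))"
    proof -
      have "J - {i} = insert x R" "x \<notin> R" using x by (auto simp: R_def)
      then show ?thesis using finR by (simp add: role_marginal_def fun_eq_iff role_conv_singleton role_conv_insert g_def)
    qed
    have m2: "role_marginal f J {x} = (\<lambda>y. f x y * convolve (f i) g (- y))"
    proof -
      have "J - {x} = insert i R" "i \<notin> R" using i x by (auto simp: R_def)
      then show ?thesis using finR by (simp add: role_marginal_def fun_eq_iff role_conv_singleton role_conv_insert g_def)
    qed
    have m3: "(\<lambda>y. mw (- y)) = (\<lambda>y. g y * convolve (f i) (f x) (- y))" by (simp add: mw fun_eq_iff)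
    have t: "convolve (f i) (convolve (f x) g) 0 = 1"
    proof -
      have "J = insert i (insert x R)" "i \<notin> insert x R" "x \<notin> R" using i x by (auto simp: R_def)
      then show ?thesis using finR Suc.prems(3) by (simp add: role_conv_insert g_def)
    qed
    have "cc * (2 * L + A i + A x + (\<Sum>y\<in>UNIV. mw (- y) * ln (g y))) \<le> (1 + cc) * (L - (e {i} + e {x} + entropy (\<lambda>y. mw (- y))) / 3)"
      unfolding A_def e_def using cc f gnn
      by (intro triangle_functional_bound[OF _ _ _ t _ _ low L m1 m2 m3]) auto
    moreover have "(\<Sum>y\<in>UNIV. mw (- y) * ln (g y)) = D"
      unfolding D_def using sum_UNIV_uminus[of "\<lambda>w. mw w * ln (g (- w))"] by simp
    ultimately have tri: "cc * (2 * L + A i + A x + D) \<le> (1 + cc) * (L - (e {i} + e {x} + e {i, x}) / 3)"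
      by (simp add: entropy_uminus e_def mw_def)
    \<comment> \<open>The law of the pair sum is the merged weight times the convolution of the
      rest. \<open>C\<close> is the term of the merged role in the shorter cycle, \<open>D\<close>
      the term of the third role in the triangle.\<close>
    have "e {i, x} = - C - D"
    proof -
      have "mw w * ln (mw w) = mw w * ln (convolve (f i) (f x) w) + mw w * ln (g (- w))" for w
      proof (cases "mw w = 0")
        case False
        then have "convolve (f i) (f x) w \<noteq> 0" "g (- w) \<noteq> 0" by (auto simp: mw)
        moreover have "convolve (f i) (f x) w \<ge> 0" "g (- w) \<ge> 0" using f gnn by (auto intro: convolve_nonneg)
        ultimately have "ln (mw w) = ln (convolve (f i) (f x) w) + ln (g (- w))" by (simp add: mw ln_mult)
        then show ?thesis by (simp add: distrib_left)
      qed simp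
      then show ?thesis by (simp add: e_def flip: mw_def) (simp add: entropy_def C_def D_def sum.distrib)
    qed
    then have D: "D = - C - e {i, x}" by simp
    have b: "L - \<beta> \<le> e {i}" "L - \<beta> \<le> e {x}" "L - \<beta> \<le> e {i, x}"
      using Suc.prems(4)[OF i(1)] Suc.prems(4)[OF x(1)] x(3) by (auto simp: e_def)
    \<comment> \<open>Substituting \<open>D\<close> moves \<open>cc\<close> times the deficit L - e
      {i, x} to the right, lowering its coefficient from (1 + cc)/3 to (1 - 2 cc)/3. This stays
      nonnegative because cc \<le> 1/2, and the three coefficients add up to 1.\<close>
    have "cc * (L + (A i + A x - C)) \<le> (1 + cc) / 3 * ((L - e {i}) + (L - e {x})) + (1 - 2 * cc) / 3 * (L - e {i, x})"
      using tri unfolding D by (simp add: field_simps)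
    also have "\<dots> \<le> (1 + cc) / 3 * (\<beta> + \<beta>) + (1 - 2 * cc) / 3 * \<beta>"
      using b cc by (intro add_mono mult_left_mono) auto
    also have "\<dots> = \<beta>" by (simp add: field_simps)
    finally have "L + (A i + A x - C) \<le> \<beta> / cc" using cc by (simp add: field_simps)
    moreover have "((real n + 2) / cc + 1) * \<beta> = ((real n + 1) / cc + 1) * \<beta> + \<beta> / cc"
      using cc by (simp add: field_simps)
    ultimately have "(real n + 3) * L - ((real n + 2) / cc + 1) * \<beta> \<le> - (\<Sum>j\<in>J. A j)"
      using IH' unfolding Jsum by (simp add: algebra_simps)
    moreover have "real (card J) = real n + 4" using Suc.prems by simp
    ultimately show ?case by (simp add: A_def add.commute)
  qed
qed

section \<open>Expectations and supports of cycle distributions\<close>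

text \<open>The test function is absorbed into the weight of role \<open>j\<close>; both sides are
  then the total mass of the modified weights.\<close>

lemma role_marginal_expectation:
  assumes "finite J" "j \<in> J"
  shows "(\<Sum>z | z \<in> PiE J (\<lambda>_. UNIV) \<and> (\<Sum>i\<in>J. z i) = 0. (\<Prod>i\<in>J. f i (z i)) * \<phi> (z j))
    = (\<Sum>x\<in>UNIV. role_marginal f J {j} x * \<phi> x)"
proof -
  define f' where "f' = f(j := \<lambda>x. f j x * \<phi> x)"
  have "(\<Prod>i\<in>J. f' i (z i)) = (\<Prod>i\<in>J. f i (z i)) * \<phi> (z j)" for z
  proof -
    have "(\<Prod>i\<in>J - {j}. f' i (z i)) = (\<Prod>i\<in>J - {j}. f i (z i))" by (intro prod.cong) (auto simp: f'_def)
    then show ?thesis using assms by (simp add: prod.remove[of J j] f'_def mult_ac)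
  qed
  then have "(\<Sum>z | z \<in> PiE J (\<lambda>_. UNIV) \<and> (\<Sum>i\<in>J. z i) = 0. (\<Prod>i\<in>J. f i (z i)) * \<phi> (z j)) = role_conv f' J 0"
    by (simp add: role_conv_def)
  also have "\<dots> = convolve (f' j) (role_conv f' (J - {j})) 0"
    using role_conv_insert[of "J - {j}" j f'] assms by (simp add: insert_absorb)
  also have "role_conv f' (J - {j}) = role_conv f (J - {j})" by (intro role_conv_cong) (auto simp: f'_def)
  also have "convolve (f' j) (role_conv f (J - {j})) 0 = (\<Sum>x\<in>UNIV. role_marginal f J {j} x * \<phi> x)"
    by (simp add: convolve_def f'_def role_marginal_def role_conv_singleton mult_ac)
  finally show ?thesis .
qed

lemma sum_role_marginal:
  assumes "finite J" "j \<in> J"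
  shows "(\<Sum>x\<in>UNIV. role_marginal f J {j} x) = role_conv f J 0"
  using role_marginal_expectation[OF assms, of f "\<lambda>_. 1"] by (simp add: role_conv_def)

text \<open>The left-hand side is the entropy of the distribution on cycles with weights
  \<open>\<Prod>j\<in>J. f j (z j)\<close>.\<close>

lemma weighted_log_le_ln_card:
  fixes f :: "'j \<Rightarrow> 'v::{ab_group_add,finite} \<Rightarrow> real"
  assumes J: "finite J" and f: "\<And>j x. f j x \<ge> 0" and total: "role_conv f J 0 = 1"
    and \<Gamma>: "finite \<Gamma>" "\<And>z. z \<in> PiE J (\<lambda>_. UNIV) \<Longrightarrow> (\<Sum>j\<in>J. z j) = 0 \<Longrightarrow> (\<And>j. j \<in> J \<Longrightarrow> f j (z j) > 0) \<Longrightarrow> z \<in> \<Gamma>"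
  shows "- (\<Sum>j\<in>J. \<Sum>x\<in>UNIV. role_marginal f J {j} x * ln (f j x)) \<le> ln (real (card \<Gamma>))"
proof -
  define Z where "Z = {z :: 'j \<Rightarrow> 'v. z \<in> PiE J (\<lambda>_. UNIV) \<and> (\<Sum>j\<in>J. z j) = 0}"
  define P where "P z = (\<Prod>j\<in>J. f j (z j))" for z
  have Pnn: "P z \<ge> 0" for z using f by (simp add: P_def prod_nonneg)
  have "Z \<subseteq> PiE J (\<lambda>_. UNIV)" by (auto simp: Z_def)
  moreover have "finite (PiE J (\<lambda>_. UNIV :: 'v set))" using J by (intro finite_PiE) auto
  ultimately have finZ: "finite Z" by (rule finite_subset)
  have sumP: "sum P Z = 1" using total by (simp add: role_conv_def Z_def P_def)
  have fpos: "f j (z j) > 0" if "P z \<noteq> 0" "j \<in> J" for z j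
  proof -
    have "f j (z j) \<noteq> 0" using that J by (auto simp: P_def)
    then show ?thesis using f[of j "z j"] by simp
  qed
  have supp: "z \<in> \<Gamma>" if "z \<in> Z" "P z \<noteq> 0" for z
    using that fpos \<Gamma>(2) by (auto simp: Z_def)
  have lnP: "P z * ln (P z) = (\<Sum>j\<in>J. P z * ln (f j (z j)))" for z
  proof (cases "P z = 0")
    case False
    have "ln (P z) = (\<Sum>j\<in>J. ln (f j (z j)))"
      unfolding P_def using fpos[OF False] by (intro ln_prod J) (metis less_irrefl)
    then show ?thesis by (simp add: sum_distrib_left)
  qed simp
  have "(\<Sum>j\<in>J. \<Sum>x\<in>UNIV. role_marginal f J {j} x * ln (f j x)) = (\<Sum>j\<in>J. \<Sum>z\<in>Z. P z * ln (f j (z j)))"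
    unfolding Z_def P_def using J by (intro sum.cong refl role_marginal_expectation[symmetric])
  also have "\<dots> = (\<Sum>z\<in>Z. P z * ln (P z))" unfolding lnP by (rule sum.swap)
  finally have eq: "(\<Sum>j\<in>J. \<Sum>x\<in>UNIV. role_marginal f J {j} x * ln (f j x)) = (\<Sum>z\<in>Z. P z * ln (P z))" .
  define N where "N = real (card \<Gamma>)"
  have "\<Gamma> \<noteq> {}"
  proof
    assume "\<Gamma> = {}"
    then have "sum P Z = 0" using supp by (intro sum.neutral) auto
    then show False using sumP by simp
  qed
  then have N: "N > 0" using \<Gamma>(1) by (simp add: N_def card_gt_0_iff)
  \<comment> \<open>The uniform distribution on \<Gamma>, restricted to cycles, as comparison weight
    in Gibbs' inequality.\<close>
  define Q where "Q z = (if z \<in> \<Gamma> then 1 / N else 0)" for z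
  have "sum Q Z = real (card (Z \<inter> \<Gamma>)) / N" using finZ by (simp add: Q_def sum.If_cases)
  also have "\<dots> \<le> 1" using N \<Gamma>(1) by (simp add: N_def card_mono)
  finally have "(\<Sum>z\<in>Z. P z * ln (Q z)) \<le> (\<Sum>z\<in>Z. P z * ln (P z))"
    using finZ Pnn N sumP supp by (intro gibbs) (auto simp: Q_def)
  moreover have "(\<Sum>z\<in>Z. P z * ln (Q z)) = (\<Sum>z\<in>Z. P z * - ln N)"
    using supp N by (intro sum.cong refl) (auto simp: Q_def ln_div)
  moreover have "(\<Sum>z\<in>Z. P z * - ln N) = - ln N"
    using sumP by (simp only: sum_distrib_right[symmetric])
  ultimately show ?thesis unfolding eq N_def by linarith
qed

section \<open>Balanced weights on a matching\<close>

lemma role_conv_remove: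
  assumes "finite J" "j \<in> J"
  shows "role_conv f J 0 = (\<Sum>x\<in>UNIV. f j x * role_conv f (J - {j}) (- x))"
  using role_conv_insert[of "J - {j}" j f] assms by (simp add: insert_absorb convolve_def)

text \<open>Tilting by s = \<eta>/4 gains s (a - b) \<ge> s \<eta> to first order and loses at most
  s^2 to second order; the net change is at most -3\<eta>^2/16.\<close>

lemma exp_shift_le:
  fixes a b \<eta> :: real
  assumes "0 \<le> a" "0 \<le> b" "a + b \<le> 1" "b + \<eta> \<le> a" "0 < \<eta>" "\<eta> < 1"
  shows "1 + a * (exp (- (\<eta> / 4)) - 1) + b * (exp (\<eta> / 4) - 1) \<le> 1 - \<eta>\<^sup>2 / 8"
proof -
  define s where "s = \<eta> / 4"
  have s: "0 < s" "s < 1" using assms by (auto simp: s_def)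
  have "exp (- s) - 1 \<le> - s + s\<^sup>2" "exp s - 1 \<le> s + s\<^sup>2"
    using exp_le_quadratic[of s] exp_le_quadratic[of "- s"] s by auto
  then have "a * (exp (- s) - 1) + b * (exp s - 1) \<le> a * (- s + s\<^sup>2) + b * (s + s\<^sup>2)"
    using assms by (intro add_mono mult_left_mono)
  also have "\<dots> = (a + b) * s\<^sup>2 - s * (a - b)" by (simp add: algebra_simps)
  also have "\<dots> \<le> 1 * s\<^sup>2 - s * \<eta>" using assms s by (intro diff_mono mult_right_mono mult_left_mono) auto
  also have "\<dots> \<le> - (\<eta>\<^sup>2 / 8)" by (simp add: s_def power2_eq_square)
  finally show ?thesis by (simp add: s_def)
qed

text \<open>Weights supported on the entries of a matching with product 1 have total mass at least 1, since
  the matched cycles alone have mass at least 1 by pigeonhole. At a near-minimiser of the total mass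
  the marginals are almost uniform: otherwise shifting weight between two entries of the same role
  would decrease the total mass by a fixed factor.\<close>

lemma balanced_weights:
  fixes S :: "('j \<Rightarrow> 'v::{ab_group_add,finite}) set"
  assumes J: "finite J" "J \<noteq> {}" and S: "finite S" "S \<noteq> {}"
    and cycles: "\<And>z. z \<in> S \<Longrightarrow> z \<in> PiE J (\<lambda>_. UNIV) \<and> (\<Sum>j\<in>J. z j) = 0"
    and disjoint: "\<And>j. j \<in> J \<Longrightarrow> inj_on (\<lambda>z. z j) S"
    and \<eta>: "0 < \<eta>" "\<eta> < 1"
  obtains f where "\<And>j x. f j x \<ge> 0" "\<And>j x. j \<in> J \<Longrightarrow> f j x > 0 \<Longrightarrow> x \<in> (\<lambda>z. z j) ` S"
    "role_conv f J 0 = 1"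
    "\<And>j x. j \<in> J \<Longrightarrow> role_marginal f J {j} x \<le> 1 / real (card S) + \<eta>"
proof -
  define M where "M j = (\<lambda>z. z j) ` S" for j
  \<comment> \<open>Fixing the product of all weights prevents scaling them down, and shifting
    weight within a role preserves it.\<close>
  define W where "W = {f :: 'j \<Rightarrow> 'v \<Rightarrow> real. (\<forall>j x. f j x \<ge> 0) \<and> (\<forall>j\<in>J. \<forall>x. f j x > 0 \<longleftrightarrow> x \<in> M j) \<and> (\<Prod>j\<in>J. \<Prod>x\<in>M j. f j x) = 1}"
  define tot where "tot f = role_conv f J 0" for f :: "'j \<Rightarrow> 'v \<Rightarrow> real"
  have cardM: "card (M j) = card S" if "j \<in> J" for j
    using disjoint[OF that] by (simp add: M_def card_image)
  have tot_ge: "tot f \<ge> 1" if f: "f \<in> W" for f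
  proof -
    have fnn: "f j x \<ge> 0" for j x using f by (simp add: W_def)
    \<comment> \<open>By disjointness every matched entry of a role occurs in exactly one cycle of
      \<open>S\<close>, so the weights of the matched cycles multiply to 1.\<close>
    have "(\<Prod>z\<in>S. \<Prod>j\<in>J. f j (z j)) = (\<Prod>j\<in>J. \<Prod>z\<in>S. f j (z j))" by (rule prod.swap)
    also have "\<dots> = (\<Prod>j\<in>J. \<Prod>x\<in>M j. f j x)"
      using disjoint by (intro prod.cong refl) (simp add: M_def prod.reindex)
    finally have one: "(\<Prod>z\<in>S. \<Prod>j\<in>J. f j (z j)) = 1" using f by (simp add: W_def)
    have "\<exists>z\<in>S. (\<Prod>j\<in>J. f j (z j)) \<ge> 1"
    proof (rule ccontr)
      assume "\<not> ?thesis"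
      then have less: "(\<Prod>j\<in>J. f j (z j)) < 1" if "z \<in> S" for z using that by (simp add: not_le)
      have "(\<Prod>z\<in>S. \<Prod>j\<in>J. f j (z j)) < (\<Prod>z\<in>S. 1)"
      proof -
        obtain z where "z \<in> S" using S by blast
        then show ?thesis using S less fnn by (intro prod_mono_strict[of z]) (auto intro: prod_nonneg less_imp_le)
      qed
      then show False using one by simp
    qed
    then obtain z where z: "z \<in> S" "(\<Prod>j\<in>J. f j (z j)) \<ge> 1" by blast
    have "finite (PiE J (\<lambda>_. UNIV :: 'v set))" using J by (intro finite_PiE) auto
    then have "finite {z :: 'j \<Rightarrow> 'v. z \<in> PiE J (\<lambda>_. UNIV) \<and> (\<Sum>j\<in>J. z j) = 0}" by simp
    then have "(\<Prod>j\<in>J. f j (z j)) \<le> tot f"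
      unfolding tot_def role_conv_def using z cycles fnn
      by (intro member_le_sum[of z _ "\<lambda>z. \<Prod>j\<in>J. f j (z j)"]) (auto intro: prod_nonneg)
    with z show ?thesis by simp
  qed
  have "(\<lambda>j x. of_bool (x \<in> M j)) \<in> W" by (auto simp: W_def intro!: prod.neutral)
  then have "W \<noteq> {}" by blast
  define I where "I = Inf (tot ` W)"
  have bdd: "bdd_below (tot ` W)" using tot_ge by (intro bdd_belowI[of _ 1]) auto
  have I: "I \<ge> 1" unfolding I_def using tot_ge \<open>W \<noteq> {}\<close> by (intro cINF_greatest) auto
  have \<eta>2: "\<eta>\<^sup>2 / 8 < 1" "\<eta>\<^sup>2 / 8 > 0" using \<eta> power_le_one[of \<eta> 2] by auto
  \<comment> \<open>A total mass below this threshold would fall below the infimum after one more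
    factor 1 - \<eta>^2/8. Working with a near-minimiser avoids having to show that a minimiser
    exists.\<close>
  then have "I < I / (1 - \<eta>\<^sup>2 / 8)" using I by (simp add: field_simps)
  then obtain f where f: "f \<in> W" "tot f < I / (1 - \<eta>\<^sup>2 / 8)"
    using cInf_less_iff[of "tot ` W" "I / (1 - \<eta>\<^sup>2 / 8)"] bdd \<open>W \<noteq> {}\<close> by (auto simp: I_def)
  have near: "tot f * (1 - \<eta>\<^sup>2 / 8) < I" using f(2) \<eta>2 by (simp add: field_simps)
  have fnn: "f j x \<ge> 0" for j x using f by (simp add: W_def)
  have fpos: "f j x > 0 \<longleftrightarrow> x \<in> M j" if "j \<in> J" for j x using f that by (simp add: W_def)
  have T: "tot f > 0" using tot_ge[OF f(1)] by simp
  define P where "P j x = role_marginal f J {j} x / tot f" for j x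
  have P: "P j x = f j x * role_conv f (J - {j}) (- x) / tot f" for j x
    by (simp add: P_def role_marginal_def role_conv_singleton)
  have Pnn: "P j x \<ge> 0" for j x using fnn T by (simp add: P_def role_marginal_nonneg)
  have sumP: "(\<Sum>x\<in>UNIV. P j x) = 1" if "j \<in> J" for j
    using sum_role_marginal[OF J(1) that, of f] T by (simp add: P_def tot_def flip: sum_divide_distrib)
  have P0: "P j x = 0" if "j \<in> J" "x \<notin> M j" for j x
    using fpos[OF that(1), of x] fnn[of j x] that by (simp add: P)
  have bal: "P j x \<le> P j y + \<eta>" if j: "j \<in> J" and xy: "x \<in> M j" "y \<in> M j" for j x y
  proof (rule ccontr)
    assume less: "\<not> P j x \<le> P j y + \<eta>"
    then have "x \<noteq> y" using \<eta> by auto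
    \<comment> \<open>Weight is taken from the heavy entry \<open>x\<close> and given to the light
      entry \<open>y\<close>, by reciprocal factors.\<close>
    define g where "g u = (if u = x then f j x * exp (- (\<eta> / 4)) else if u = y then f j y * exp (\<eta> / 4) else f j u)" for u
    define f' where "f' = f(j := g)"
    have prod_g: "(\<Prod>u\<in>M j. g u) = (\<Prod>u\<in>M j. f j u)"
    proof -
      have split: "M j = insert x (insert y (M j - {x, y}))" using xy by auto
      have "(\<Prod>u\<in>M j - {x, y}. g u) = (\<Prod>u\<in>M j - {x, y}. f j u)" by (intro prod.cong) (auto simp: g_def)
      moreover have "(\<Prod>u\<in>M j. h u) = h x * (h y * (\<Prod>u\<in>M j - {x, y}. h u))" for h :: "'v \<Rightarrow> real"
        using \<open>x \<noteq> y\<close> by (subst split) simp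
      moreover have "g x * g y = f j x * f j y" using \<open>x \<noteq> y\<close> by (simp add: g_def flip: exp_add)
      ultimately show ?thesis by (simp flip: mult.assoc)
    qed
    have "(\<Prod>i\<in>J. \<Prod>u\<in>M i. f' i u) = (\<Prod>i\<in>J. \<Prod>u\<in>M i. f i u)"
      by (rule prod.cong[OF refl]) (simp add: f'_def prod_g)
    moreover have "g u \<ge> 0" "g u > 0 \<longleftrightarrow> f j u > 0" for u using fnn by (auto simp: g_def zero_less_mult_iff)
    ultimately have "f' \<in> W" using f(1) j by (auto simp: W_def f'_def)
    then have "I \<le> tot f'" unfolding I_def using bdd by (intro cINF_lower)
    define G where "G u = role_conv f (J - {j}) (- u)" for u
    have G': "role_conv f' (J - {j}) = role_conv f (J - {j})" by (intro role_conv_cong) (auto simp: f'_def)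
    have "tot f' = (\<Sum>u\<in>UNIV. g u * G u)"
      unfolding tot_def role_conv_remove[OF J(1) j] G' by (simp add: f'_def G_def)
    also have "\<dots> = (\<Sum>u\<in>UNIV. f j u * G u + ((if u = x then f j x * G x * (exp (- (\<eta> / 4)) - 1) else 0)
        + (if u = y then f j y * G y * (exp (\<eta> / 4) - 1) else 0)))"
      using \<open>x \<noteq> y\<close> by (intro sum.cong refl) (auto simp: g_def algebra_simps)
    also have "\<dots> = (\<Sum>u\<in>UNIV. f j u * G u) + (f j x * G x * (exp (- (\<eta> / 4)) - 1) + f j y * G y * (exp (\<eta> / 4) - 1))"
      unfolding sum.distrib by simp
    also have "(\<Sum>u\<in>UNIV. f j u * G u) = tot f" unfolding tot_def role_conv_remove[OF J(1) j] by (simp add: G_def)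
    also have "tot f + (f j x * G x * (exp (- (\<eta> / 4)) - 1) + f j y * G y * (exp (\<eta> / 4) - 1))
        = tot f * (1 + P j x * (exp (- (\<eta> / 4)) - 1) + P j y * (exp (\<eta> / 4) - 1))"
      using T by (simp add: P G_def distrib_left)
    also have "\<dots> \<le> tot f * (1 - \<eta>\<^sup>2 / 8)"
    proof (rule mult_left_mono)
      have "(\<Sum>u\<in>{x, y}. P j u) \<le> (\<Sum>u\<in>UNIV. P j u)" using Pnn by (intro sum_mono2) auto
      then have "P j x + P j y \<le> 1" using \<open>x \<noteq> y\<close> sumP[OF j] by simp
      then show "1 + P j x * (exp (- (\<eta> / 4)) - 1) + P j y * (exp (\<eta> / 4) - 1) \<le> 1 - \<eta>\<^sup>2 / 8"
        using Pnn less \<eta> by (intro exp_shift_le) auto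
    qed (use T in simp)
    finally show False using near \<open>I \<le> tot f'\<close> by linarith
  qed
  have upper: "P j x \<le> 1 / real (card S) + \<eta>" if j: "j \<in> J" for j x
  proof (cases "x \<in> M j")
    case True
    \<comment> \<open>All \<open>card S\<close> matched entries of the role have mass at least
      \<open>P j x - \<eta>\<close>, and these masses add up to at most 1.\<close>
    have "real (card S) * (P j x - \<eta>) = (\<Sum>y\<in>M j. P j x - \<eta>)" using cardM[OF j] by simp
    also have "\<dots> \<le> (\<Sum>y\<in>M j. P j y)"
    proof (rule sum_mono)
      fix y assume "y \<in> M j"
      then show "P j x - \<eta> \<le> P j y" using bal[OF j True, of y] by simp
    qed
    also have "\<dots> \<le> (\<Sum>y\<in>UNIV. P j y)" using Pnn by (intro sum_mono2) auto
    also have "\<dots> = 1" by (rule sumP[OF j])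
    finally show ?thesis using S by (simp add: field_simps card_gt_0_iff)
  qed (use P0[OF j] \<eta> in simp)
  obtain i where i: "i \<in> J" using J by blast
  \<comment> \<open>Rescaling a single role normalises the total mass and divides every marginal by
    \<open>tot f\<close>.\<close>
  define F where "F = f(i := \<lambda>x. f i x / tot f)"
  have scale: "role_conv F A = (\<lambda>w. role_conv f A w / tot f)" if "i \<in> A" "finite A" for A
  proof -
    have "role_conv F A = convolve (F i) (role_conv F (A - {i}))"
      using role_conv_insert[of "A - {i}" i F] that by (simp add: insert_absorb)
    also have "role_conv F (A - {i}) = role_conv f (A - {i})" by (intro role_conv_cong) (auto simp: F_def)
    also have "convolve (F i) (role_conv f (A - {i})) = (\<lambda>w. convolve (f i) (role_conv f (A - {i})) w / tot f)"
      by (simp add: fun_eq_iff convolve_def F_def sum_divide_distrib)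
    also have "convolve (f i) (role_conv f (A - {i})) = role_conv f A"
      using role_conv_insert[of "A - {i}" i f] that by (simp add: insert_absorb)
    finally show ?thesis .
  qed
  have same: "role_conv F A = role_conv f A" if "i \<notin> A" for A
    using that by (intro role_conv_cong) (auto simp: F_def)
  have marg: "role_marginal F J {j} x = P j x" if "j \<in> J" for j x
  proof (cases "j = i")
    case True
    then show ?thesis by (simp add: role_marginal_def P_def scale same)
  next
    case False
    then show ?thesis using i J by (simp add: role_marginal_def P_def scale same)
  qed
  show ?thesis
  proof (rule that[of F])
    show "F j x \<ge> 0" for j x using fnn T by (simp add: F_def)
    show "x \<in> (\<lambda>z. z j) ` S" if "j \<in> J" "F j x > 0" for j x
    proof -
      have "f j x > 0" using that T by (auto simp: F_def zero_less_divide_iff split: if_splits)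
      then show ?thesis using fpos[OF that(1)] by (simp add: M_def)
    qed
    show "role_conv F J 0 = 1" using scale[OF i J(1)] T by (simp add: tot_def)
    show "role_marginal F J {j} x \<le> 1 / real (card S) + \<eta>" if "j \<in> J" for j x
      using marg[OF that] upper[OF that] by simp
  qed
qed

lemma entropy_ge:
  assumes "\<And>x. P x \<ge> 0" "sum P UNIV = 1" "\<And>x. P x \<le> b" "b > 0"
  shows "- ln b \<le> entropy P"
proof -
  have "(\<Sum>x\<in>UNIV. P x * ln (P x)) \<le> (\<Sum>x\<in>UNIV. P x * ln b)"
  proof (rule sum_mono)
    fix x
    show "P x * ln (P x) \<le> P x * ln b"
      using assms(1,3)[of x] assms(4) by (cases "P x = 0") (auto intro!: mult_left_mono)
  qed
  also have "\<dots> = ln b" using assms(2) by (simp flip: sum_distrib_right)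
  finally show ?thesis by (simp add: entropy_def)
qed

text \<open>Balanced weights live on the matched entries, so \<Gamma> contains every cycle of
  positive weight, and their marginals have entropy at least nearly ln(card S). Thus
  \<open>cycle_entropy_bound\<close> applies with deficit close to L - ln(card S), and its entropy
  is at most ln(card \<Gamma>).\<close>

theorem matching_cycles_bound:
  fixes S \<Gamma> :: "('j \<Rightarrow> 'a::{field,finite} ^ 'n) set"
  assumes J: "finite J" "card J \<ge> 3" and S: "finite S" "S \<noteq> {}"
    and cycles: "\<And>z. z \<in> S \<Longrightarrow> z \<in> PiE J (\<lambda>_. UNIV) \<and> (\<Sum>j\<in>J. z j) = 0"
    and disjoint: "\<And>j. j \<in> J \<Longrightarrow> inj_on (\<lambda>z. z j) S"
    and \<Gamma>: "finite \<Gamma>" "\<And>z. z \<in> PiE J (\<lambda>j. (\<lambda>z. z j) ` S) \<Longrightarrow> (\<Sum>j\<in>J. z j) = 0 \<Longrightarrow> z \<in> \<Gamma>"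
    and cc: "0 < cc" "cc \<le> 1 / 2"
    and low: "\<And>d. real (card (low_exponents CARD('a) d)) \<le> (real CARD('a) powr (1 - cc)) ^ d"
    and L: "L = ln (real CARD('a ^ 'n))"
  shows "(real (card J) - 1) * L - ((real (card J) - 2) / cc + 1) * (L - ln (real (card S))) \<le> ln (real (card \<Gamma>))"
proof -
  define m where "m = real (card S)"
  have m: "m \<ge> 1" using S by (simp add: m_def Suc_leI card_gt_0_iff)
  define K where "K = (real (card J) - 2) / cc + 1"
  have K: "K > 0" using J(2) cc by (simp add: K_def add_nonneg_pos)
  have step: "(real (card J) - 1) * L - K * (L - ln m) - ln (real (card \<Gamma>)) \<le> K * \<delta>" if \<delta>: "0 < \<delta>" "\<delta> < 1" for \<delta>
  proof -
    \<comment> \<open>Turns the bound on the marginals into (1 + \<delta>) / m, so the deficit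
      exceeds L - ln m by at most \<delta>, which is arbitrarily small.\<close>
    define \<eta> where "\<eta> = \<delta> / m"
    have \<eta>: "0 < \<eta>" "\<eta> < 1" using \<delta> m by (auto simp: \<eta>_def divide_less_eq)
    have "J \<noteq> {}" using J by auto
    from balanced_weights[OF J(1) this S cycles disjoint \<eta>] obtain f where f: "\<And>j x. f j x \<ge> 0"
      "\<And>j x. j \<in> J \<Longrightarrow> f j x > 0 \<Longrightarrow> x \<in> (\<lambda>z. z j) ` S" "role_conv f J 0 = 1"
      "\<And>j x. j \<in> J \<Longrightarrow> role_marginal f J {j} x \<le> 1 / m + \<eta>"
      unfolding m_def by blast
    define \<beta> where "\<beta> = L + ln (1 / m + \<eta>)"
    have pos: "1 / m + \<eta> > 0" using m \<eta> by (simp add: add_pos_pos)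
    have "L - \<beta> \<le> entropy (role_marginal f J {j})" if "j \<in> J" for j
      using entropy_ge[of "role_marginal f J {j}" "1 / m + \<eta>"] f that pos sum_role_marginal[OF J(1) that, of f]
      by (simp add: \<beta>_def role_marginal_nonneg)
    from cycle_entropy_bound[OF J f(1,3) this cc low L]
    have "(real (card J) - 1) * L - K * \<beta> \<le> - (\<Sum>j\<in>J. \<Sum>x\<in>UNIV. role_marginal f J {j} x * ln (f j x))"
      by (simp add: K_def)
    also have "\<dots> \<le> ln (real (card \<Gamma>))"
      using f(2) \<Gamma> by (intro weighted_log_le_ln_card[OF J(1) f(1,3)]) (auto simp: PiE_iff)
    finally have "(real (card J) - 1) * L - K * \<beta> \<le> ln (real (card \<Gamma>))" .
    moreover have "\<beta> \<le> L - ln m + \<delta>"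
    proof -
      have "1 / m + \<eta> = (1 + \<delta>) / m" by (simp add: \<eta>_def add_divide_distrib)
      then have "ln (1 / m + \<eta>) = ln (1 + \<delta>) - ln m" using m \<delta> by (simp add: ln_div)
      also have "ln (1 + \<delta>) \<le> \<delta>" using \<delta> by (intro ln_add_one_self_le_self) auto
      finally show ?thesis by (simp add: \<beta>_def)
    qed
    then have "K * \<beta> \<le> K * (L - ln m + \<delta>)" using K by (intro mult_left_mono) auto
    ultimately show ?thesis by (simp add: algebra_simps)
  qed
  have "(real (card J) - 1) * L - K * (L - ln m) - ln (real (card \<Gamma>)) \<le> 0"
  proof (rule field_le_epsilon)
    fix e :: real assume e: "e > 0"
    define \<delta> where "\<delta> = min (e / K) (1 / 2)"
    have "K * \<delta> \<le> e" using K by (simp add: \<delta>_def min_def field_simps)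
    moreover have "0 < \<delta>" "\<delta> < 1" using K e by (auto simp: \<delta>_def min_def)
    ultimately show "(real (card J) - 1) * L - K * (L - ln m) - ln (real (card \<Gamma>)) \<le> 0 + e"
      using step[of \<delta>] by linarith
  qed
  then show ?thesis by (simp add: K_def m_def)
qed

theorem theorem4:
  fixes p k :: nat and \<epsilon> :: real
    and X :: "nat \<Rightarrow> ('a::{field,finite} ^ 'n) set"
    and S :: "(nat \<Rightarrow> 'a ^ 'n) set"
  assumes "prime p" and "CARD('a) = p"
    and "k \<ge> 3" and "0 < \<epsilon>" and "\<epsilon> < 1"
    and "S \<subseteq> k_cycles k X"
    and "pairwise_disjoint_cycles k S"
    and "real (card S) \<ge> \<epsilon> * real p ^ CARD('n)"
  shows "real (card (k_cycles k X)) \<ge> \<epsilon> powr (C_pk p k) * (real p ^ CARD('n)) ^ (k - 1)"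
proof -
  define N where "N = real p ^ CARD('n)"
  have p: "p \<ge> 2" using assms(1) by (rule prime_ge_2_nat)
  have N: "N > 0" using p by (simp add: N_def)
  have cardV: "real CARD('a ^ 'n) = N" using assms(2) by (simp add: N_def)
  have "finite (PiE {1..k} (\<lambda>_. UNIV :: ('a ^ 'n) set))" by (intro finite_PiE) auto
  moreover have sub: "k_cycles k X \<subseteq> PiE {1..k} (\<lambda>_. UNIV)" by (auto simp: k_cycles_def)
  ultimately have fin: "finite (k_cycles k X)" by (rule finite_subset[rotated])
  have m: "real (card S) \<ge> \<epsilon> * N" using assms(8) by (simp add: N_def)
  moreover have "\<epsilon> * N > 0" using assms(4) N by simp
  ultimately have cardS: "real (card S) > 0" by linarith
  \<comment> \<open>An infinite set would have \<open>card\<close> 0.\<close>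
  then have S: "finite S" "S \<noteq> {}" by (auto simp: card_gt_0_iff)
  \<comment> \<open>The coefficient (k - 2) / c + 1 with c = \<open>c_p3 p\<close> is
    \<open>C_pk p k\<close>, because \<open>C_p3 p\<close> - 1 = 1 / c.\<close>
  have "(real (card {1..k}) - 1) * ln N - ((real (card {1..k}) - 2) / c_p3 p + 1) * (ln N - ln (real (card S)))
    \<le> ln (real (card (k_cycles k X)))"
  proof (rule matching_cycles_bound[OF _ _ S])
    show "z \<in> PiE {1..k} (\<lambda>_. UNIV) \<and> (\<Sum>j\<in>{1..k}. z j) = 0" if "z \<in> S" for z
      using that assms(6) by (auto simp: k_cycles_def)
    show "inj_on (\<lambda>z. z j) S" if "j \<in> {1..k}" for j
      using assms(7) that unfolding pairwise_disjoint_cycles_def disjoint_cycles_def inj_on_def by blast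
    show "finite (k_cycles k X)" by (rule fin)
    show "z \<in> k_cycles k X" if z: "z \<in> PiE {1..k} (\<lambda>j. (\<lambda>z. z j) ` S)" and sum: "(\<Sum>j\<in>{1..k}. z j) = 0" for z
    proof -
      have "z j \<in> X j" if j: "j \<in> {1..k}" for j
      proof -
        have "z j \<in> (\<lambda>z. z j) ` S" using z j by (rule PiE_mem)
        then obtain y where "y \<in> S" "z j = y j" by blast
        then show ?thesis using assms(6) j by (auto simp: k_cycles_def PiE_iff)
      qed
      then show ?thesis using z sum by (auto simp: k_cycles_def PiE_iff)
    qed
    show "real (card (low_exponents CARD('a) d)) \<le> (real CARD('a) powr (1 - c_p3 p)) ^ d" for d
      unfolding assms(2) by (rule card_low_exponents_le_powr[OF p])
  qed (use assms(3) c_p3_pos[OF p] c_p3_le[OF p] cardV in auto)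
  then have main: "(real k - 1) * ln N - C_pk p k * (ln N - ln (real (card S))) \<le> ln (real (card (k_cycles k X)))"
    by (simp add: C_pk_def C_p3_def)
  have "C_pk p k \<ge> 0" using assms(3) c_p3_pos[OF p] by (simp add: C_pk_def C_p3_def)
  moreover have "ln (\<epsilon> * N) \<le> ln (real (card S))" using m assms(4) N cardS by simp
  then have "ln \<epsilon> \<le> - (ln N - ln (real (card S)))" using assms(4) N by (simp add: ln_mult)
  ultimately have "C_pk p k * ln \<epsilon> \<le> C_pk p k * - (ln N - ln (real (card S)))" by (intro mult_left_mono)
  with main have "(real k - 1) * ln N + C_pk p k * ln \<epsilon> \<le> ln (real (card (k_cycles k X)))"
    by (simp add: algebra_simps)
  \<comment> \<open>Needed to undo \<open>ln\<close>, whose value at 0 is a mere convention.\<close>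
  moreover have "card (k_cycles k X) > 0" using fin S assms(6) by (auto simp: card_gt_0_iff)
  ultimately have "exp ((real k - 1) * ln N + C_pk p k * ln \<epsilon>) \<le> real (card (k_cycles k X))"
    by (subst ln_ge_iff[symmetric]) auto
  moreover have "exp ((real k - 1) * ln N + C_pk p k * ln \<epsilon>) = \<epsilon> powr (C_pk p k) * N ^ (k - 1)"
  proof -
    have "exp ((real k - 1) * ln N) = N powr real (k - 1)" using N assms(3) by (simp add: powr_def of_nat_diff)
    also have "\<dots> = N ^ (k - 1)" using N by (rule powr_realpow)
    finally show ?thesis using assms(4) by (simp add: exp_add powr_def)
  qed
  ultimately show ?thesis by (simp add: N_def)
qed

end
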